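(* Let $p$ be a prime. Suppose that $G$ is a finite solvable group acted on by automorphisms by an elementary abelian $p$-group $A$ with $|A|\geq p^{4}$. If this action is good and $C_G(a)$ is supersolvable for every nontrivial element $a\in A$, then $G$ is supersolvable.
   Context: All groups are finite. If a group $A$ acts on a group $G$ by automorphisms, the action is called good if $H=[H,B]C_H(B)$ for every subgroup $B\le A$ and every $B$-invariant subgroup $H\le G$. *)

theory Defs
  imports "HOL-Algebra.Algebra"
begin

definition supersolvable :: "('a, 'b) monoid_scheme \<Rightarrow> bool" where
  "supersolvable G \<longleftrightarrow> (\<exists>(n::nat) (Gs :: nat \<Rightarrow> 'a set).
      Gs 0 = {\<one>\<^bsub>G\<^esub>} \<and> Gs n = carrier G \<and>
      (\<forall>i\<le>n. Gs i \<lhd> G) \<and>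
      (\<forall>i<n. Gs i \<subseteq> Gs (Suc i) \<and>
              cyclic_group ((G\<lparr>carrier := Gs (Suc i)\<rparr>) Mod (Gs i))))"

definition acts_by_automorphisms ::
  "('c, 'd) monoid_scheme \<Rightarrow> ('a, 'b) monoid_scheme \<Rightarrow> ('c \<Rightarrow> 'a \<Rightarrow> 'a) \<Rightarrow> bool" where
  "acts_by_automorphisms A G \<phi> \<longleftrightarrow> group A \<and> group G \<and> \<phi> \<in> hom A (AutoGroup G)"

definition comm_act :: "('a, 'b) monoid_scheme \<Rightarrow> ('c \<Rightarrow> 'a \<Rightarrow> 'a) \<Rightarrow> 'a set \<Rightarrow> 'c set \<Rightarrow> 'a set" where
  "comm_act G \<phi> H B = generate G {inv\<^bsub>G\<^esub> h \<otimes>\<^bsub>G\<^esub> \<phi> b h | h b. h \<in> H \<and> b \<in> B}"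

definition fix_act :: "('c \<Rightarrow> 'a \<Rightarrow> 'a) \<Rightarrow> 'a set \<Rightarrow> 'c set \<Rightarrow> 'a set" where
  "fix_act \<phi> H B = {h \<in> H. \<forall>b \<in> B. \<phi> b h = h}"

definition good_action ::
  "('c, 'd) monoid_scheme \<Rightarrow> ('a, 'b) monoid_scheme \<Rightarrow> ('c \<Rightarrow> 'a \<Rightarrow> 'a) \<Rightarrow> bool" where
  "good_action A G \<phi> \<longleftrightarrow> acts_by_automorphisms A G \<phi> \<and>
     (\<forall>B H. subgroup B A \<longrightarrow> subgroup H G \<longrightarrow> (\<forall>b \<in> B. \<phi> b ` H \<subseteq> H) \<longrightarrow>
        H = comm_act G \<phi> H B <#>\<^bsub>G\<^esub> fix_act \<phi> H B)"

end

theory Submission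
  imports Defs "HOL-Computational_Algebra.Polynomial" "HOL-Number_Theory.Residues"
begin

hide_const (open) Polynomial.order

text \<open>Everything happens inside \<open>G\<close>, by induction on an \<open>A\<close>-invariant subgroup \<open>H\<close>. Goodness
  enters once: if \<open>B \<le> A\<close> and \<open>X/M\<close> is an irreducible abelian \<open>B\<close>-section, its kernel \<open>K\<close> in \<open>B\<close>
  has index at most \<open>p\<close>, and \<open>X = [X,K] C_X(K) \<le> M C_X(K)\<close>; hence every \<open>B\<close>-invariant subgroup
  is generated by the fixed points of subgroups of index at most \<open>p\<close> in \<open>B\<close>.

  Let \<open>N/M\<close> be an \<open>A\<close>-chief factor of \<open>H\<close> of exponent \<open>r\<close> such that \<open>H/N\<close> is already
  supersolvable, and \<open>C = C_H(N/M)\<close>. If \<open>N \<noteq> H\<close>, then \<open>H'N\<close> is proper, so it is supersolvable by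
  induction, and \<open>x^(r-1) \<in> C\<close> for \<open>x \<in> H'\<close>. If \<open>x\<close> and \<open>y\<close> are fixed by subgroups of index at
  most \<open>p\<close> in \<open>A\<close>, both are fixed by some \<open>B\<close> with \<open>|B| \<ge> p^2\<close> (here \<open>|A| \<ge> p^4\<close> is needed); for
  \<open>1 \<noteq> b \<in> B\<close> supersolvability of \<open>C_G(b)\<close> makes \<open>[x,y]\<close> and \<open>x^(r-1)\<close> act as \<open>r\<close>-elements on
  \<open>C_N(b)\<close> modulo \<open>M\<close>, and these fixed points generate \<open>N\<close>. So \<open>[x,y] \<in> C\<close>, the group \<open>H/C\<close> is
  abelian, and every element of it has order dividing some \<open>(r-1)r^k\<close>. Such an element has an
  eigenvector in each nontrivial invariant section, its eigenspaces are \<open>H\<close>-invariant, and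
  therefore \<open>N/M\<close> has an \<open>H\<close>-invariant series with cyclic factors.\<close>

section \<open>Integer polynomials acting on abelian groups\<close>

text \<open>Each passage to a subgroup of index at most \<open>p\<close> may cost a factor
  \<open>p\<close>: two are spent on \<open>x\<close> and \<open>y\<close>, a third on a generator
  of \<open>N\<close>, fixed by a subgroup of index at most \<open>p\<close> in \<open>B\<close>.
  What is left of \<open>|A| \<ge> p^4\<close> has order at least \<open>p\<close>, hence a
  nontrivial element \<open>b\<close>, and only then does the hypothesis on \<open>C_G(b)\<close>
  apply.

  The commutator \<open>[x,y]\<close> lies in \<open>C\<close> because two powers of it with coprime
  exponents do: an \<open>r^k\<close>-th by the argument on fixed points, the
  \<open>(r-1)\<close>-th because \<open>[x,y]\<close> is in \<open>H'\<close>. The latter fact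
  grows from a single coset: \<open>H'N\<close> acts by power maps on the bottom of a series of
  \<open>N/M\<close>, so by Fermat all \<open>(r-1)\<close>-th powers fix a nontrivial coset there;
  the cosets fixed in this way form an \<open>H\<close>- and \<open>A\<close>-invariant subgroup,
  which must be \<open>N/M\<close>.

  Exponents \<open>(r-1)r^k\<close> are harmless over the prime field: the \<open>r^k\<close> part
  is unipotent and \<open>X^(r-1) - 1\<close> splits. Working with subgroups of \<open>G\<close>
  throughout spares the transfer of the hypotheses to quotients.\<close>

lemma freshman_dream_minus_one:
  assumes "Factorial_Ring.prime (p::nat)"
  shows "\<exists>q. [:-1, 1:] ^ p = monom 1 p - 1 + smult (int p) q"
proof -
  let ?c = "\<lambda>k. of_nat (p choose k) * monom 1 1 ^ k * (-1 :: int poly) ^ (p - k)"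
  have p1: "p > 1"
    using assms prime_gt_1_nat by blast
  have "[:-1, 1:] ^ p = (monom 1 1 + (-1 :: int poly)) ^ p"
    by (simp add: monom_altdef one_pCons)
  also have "\<dots> = (\<Sum>k\<le>p. ?c k)"
    by (rule binomial_ring)
  also have "\<dots> = ?c 0 + ?c p + sum ?c {0<..<p}"
  proof -
    have "{..p} = insert 0 (insert p {0<..<p})"
      using p1 by auto
    then show ?thesis
      using p1 by (simp add: add.assoc)
  qed
  finally have eq: "[:-1, 1:] ^ p = ?c 0 + ?c p + sum ?c {0<..<p}" .
  have const: "[:int p:] = of_nat p"
    by (simp add: of_nat_poly)
  have "of_nat p dvd sum ?c {0<..<p}"
  proof (rule dvd_sum)
    fix k assume "k \<in> {0<..<p}"
    then have "p dvd (p choose k)"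
      using assms by (intro dvd_choose_prime) auto
    then have "(of_nat p :: int poly) dvd of_nat (p choose k)"
      by (metis dvd_def of_nat_mult)
    then show "of_nat p dvd ?c k"
      by (simp add: mult.assoc)
  qed
  then obtain q1 where q1: "sum ?c {0<..<p} = smult (int p) q1"
    unfolding const[symmetric] dvd_def by auto
  show ?thesis
  \<comment> \<open>The sign \<open>(-1)^p\<close> is \<open>-1\<close> only for odd
    \<open>p\<close>. For \<open>p = 2\<close> the constant term is \<open>1 = -1 + 2\<close>, and
    the surplus joins the multiple of \<open>p\<close>.\<close>
  proof (cases "p = 2")
    case True
    have "?c 0 = 1" "?c p = monom 1 p"
      using True by (auto simp: monom_power)
    then have "[:-1, 1:] ^ p = monom 1 p - 1 + smult (int p) (1 + q1)"
      using eq q1 True by (simp add: smult_add_right numeral_poly)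
    then show ?thesis ..
  next
    case False
    then have "odd p"
      using assms p1 prime_odd_nat[of p] by auto
    then have "?c 0 = -1" "?c p = monom 1 p"
      by (auto simp: monom_power)
    then show ?thesis
      using eq q1 by auto
  qed
qed

text \<open>\<open>q(f)\<close> applied to \<open>m\<close>, the abelian group being written multiplicatively.\<close>

definition poly_act :: "('a, 'b) monoid_scheme \<Rightarrow> ('a \<Rightarrow> 'a) \<Rightarrow> int poly \<Rightarrow> 'a \<Rightarrow> 'a" where
  "poly_act G f q m = fold_coeffs (\<lambda>a s. m [^]\<^bsub>G\<^esub> a \<otimes>\<^bsub>G\<^esub> f s) q \<one>\<^bsub>G\<^esub>"

text \<open>Integer polynomials act with \<open>X\<close> as \<open>f\<close>. Staying over the
  integers, a group of exponent \<open>p\<close> need not be turned into a vector space: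
  coefficients divisible by \<open>p\<close> simply act trivially.\<close>

locale abelian_endo = comm_group G for G (structure) +
  fixes f
  assumes endo: "f \<in> hom G G"
begin

sublocale f: group_hom G G f
  using endo by unfold_locales

lemma poly_act_0 [simp]: "poly_act G f 0 m = \<one>"
  by (simp add: poly_act_def)

lemma poly_act_pCons [simp]:
  "m \<in> carrier G \<Longrightarrow> poly_act G f (pCons a q) m = m [^] a \<otimes> f (poly_act G f q m)"
  by (cases "a = 0 \<and> q = 0") (auto simp: poly_act_def)

lemma poly_act_closed [simp]: "m \<in> carrier G \<Longrightarrow> poly_act G f q m \<in> carrier G"
  by (induction q) auto

lemma poly_act_add:
  assumes "m \<in> carrier G"
  shows "poly_act G f (p + q) m = poly_act G f p m \<otimes> poly_act G f q m"
proof (induction p q rule: poly_induct2)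
  case (pCons a p b q)
  then show ?case
    using assms by (simp add: int_pow_mult m_ac)
qed (use assms in auto)

lemma poly_act_smult:
  assumes "m \<in> carrier G"
  shows "poly_act G f (smult a q) m = poly_act G f q m [^] a"
proof (induction q)
  case (pCons b q)
  then show ?case
    using assms
    by (simp add: int_pow_distrib int_pow_pow f.hom_int_pow mult.commute)
qed (use assms in auto)

lemma poly_act_mult:
  assumes "m \<in> carrier G"
  shows "poly_act G f (p * q) m = poly_act G f p (poly_act G f q m)"
proof (induction p)
  case (pCons a p)
  then show ?case
    using assms by (simp add: poly_act_add poly_act_smult)
qed (use assms in auto)

lemma funpow_closed: "m \<in> carrier G \<Longrightarrow> (f ^^ n) m \<in> carrier G"
  by (induction n) auto

lemma funpow_hom: "f ^^ n \<in> hom G G"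
  by (intro homI, simp add: funpow_closed) (induction n, auto simp: funpow_closed)

lemma poly_act_monom:
  assumes "m \<in> carrier G"
  shows "poly_act G f (monom 1 n) m = (f ^^ n) m"
proof (induction n)
  case 0
  then show ?case using assms by (simp add: monom_0)
next
  case (Suc n)
  then show ?case using assms by (simp add: monom_Suc funpow_closed)
qed

lemma poly_act_uminus_one:
  assumes "m \<in> carrier G"
  shows "poly_act G f (- 1) m = inv m"
  using assms by (simp add: one_pCons int_pow_neg)

section \<open>Fixed points and eigenvectors from factorizations modulo a prime\<close>

lemma poly_act_linear:
  assumes "m \<in> carrier G"
  shows "poly_act G f [:- c, 1:] m = \<one> \<longleftrightarrow> f m = m [^] c"
proof -
  have "poly_act G f [:- c, 1:] m = inv (m [^] c) \<otimes> f m"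
    using assms by (simp add: int_pow_neg)
  then show ?thesis
    using assms by (metis f.hom_closed int_pow_closed inv_solve_left' one_closed r_one)
qed

lemma poly_act_power_minus_one:
  assumes "m \<in> carrier G"
  shows "poly_act G f (monom 1 n - 1) m = (f ^^ n) m \<otimes> inv m"
  using poly_act_add[OF assms, of "monom 1 n" "-1"] assms
  by (simp add: poly_act_monom poly_act_uminus_one)

text \<open>Modulo \<open>p\<close> the polynomial \<open>X^p - 1\<close> is
  \<open>(X - 1)^p\<close>, so iterating \<open>f - 1\<close> on \<open>m\<close> reaches the
  identity; a value just before the identity is fixed by \<open>f\<close>.\<close>

lemma fixed_point_of_prime_power_step:
  assumes p: "Factorial_Ring.prime (p::nat)" and expo: "\<And>x. x \<in> carrier G \<Longrightarrow> x [^] p = \<one>"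
    and m: "m \<in> carrier G" "m \<noteq> \<one>" and fm: "(f ^^ p) m = m"
  shows "\<exists>u\<in>carrier G. u \<noteq> \<one> \<and> f u = u"
proof -
  obtain q where q: "[:-1, 1:] ^ p = monom 1 p - 1 + smult (int p) q"
    using freshman_dream_minus_one[OF p] by blast
  let ?d = "\<lambda>j. poly_act G f ([:-1, 1:] ^ j) m"
  have "?d p = \<one>"
    unfolding q using m fm expo poly_act_add poly_act_power_minus_one[of m p]
    by (simp add: poly_act_smult int_pow_int)
  moreover have "?d 0 \<noteq> \<one>"
    using m by (simp add: one_pCons)
  ultimately obtain j where j: "?d j \<noteq> \<one>" "?d (Suc j) = \<one>"
    using ex_least_nat_less[of "\<lambda>j. ?d j = \<one>" p] by blast
  have "poly_act G f [:-1, 1:] (?d j) = \<one>"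
    using j(2) m by (metis poly_act_mult power_Suc)
  then have "f (?d j) = ?d j [^] (1::int)"
    using m poly_act_linear[of "?d j" 1] by simp
  then show ?thesis
    using j(1) m by (intro bexI[of _ "?d j"]) auto
qed

text \<open>One factor \<open>p\<close> is removed at a time: \<open>f ^^ (p ^ k)\<close> is an
  endomorphism whose \<open>p\<close>-th power fixes \<open>m\<close>, so it has a nontrivial fixed
  point of its own.\<close>

lemma fixed_point_of_prime_power:
  assumes p: "Factorial_Ring.prime (p::nat)" and expo: "\<And>x. x \<in> carrier G \<Longrightarrow> x [^] p = \<one>"
    and m: "m \<in> carrier G" "m \<noteq> \<one>" and fm: "(f ^^ (p ^ k)) m = m"
  shows "\<exists>u\<in>carrier G. u \<noteq> \<one> \<and> f u = u"
  using m fm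
proof (induction k arbitrary: m)
  case (Suc k)
  let ?g = "f ^^ (p ^ k)"
  interpret g: abelian_endo G ?g
    by unfold_locales (rule funpow_hom)
  have "(?g ^^ p) m = m"
    using Suc.prems by (simp add: funpow_mult mult.commute)
  then obtain u where "u \<in> carrier G" "u \<noteq> \<one>" "?g u = u"
    using g.fixed_point_of_prime_power_step[OF p expo] Suc.prems by blast
  then show ?case
    using Suc.IH by blast
qed auto

text \<open>Peel off one root at a time: \<open>q\<close> is \<open>(X - c) s\<close> up to a
  multiple of \<open>p\<close>. Either \<open>s\<close> kills \<open>m\<close> and the argument
  continues with \<open>s\<close>, or \<open>s\<close> applied to \<open>m\<close> is an eigenvector
  for \<open>c\<close>. The other roots remain roots of \<open>s\<close>, as distinct members of
  \<open>{1..<p}\<close> are incongruent. The process cannot reach the polynomial \<open>1\<close>,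
  which does not kill \<open>m\<close>.\<close>

lemma eigenvector_of_split_poly:
  assumes p: "Factorial_Ring.prime (p::nat)" and expo: "\<And>x. x \<in> carrier G \<Longrightarrow> x [^] p = \<one>"
    and m: "m \<in> carrier G" "m \<noteq> \<one>"
  shows "finite S \<Longrightarrow> S \<subseteq> {1..<int p} \<Longrightarrow> (\<And>c. c \<in> S \<Longrightarrow> int p dvd poly q c) \<Longrightarrow>
    degree q = card S \<Longrightarrow> lead_coeff q = 1 \<Longrightarrow> poly_act G f q m = \<one> \<Longrightarrow>
    \<exists>c. \<exists>u\<in>carrier G. u \<noteq> \<one> \<and> f u = u [^] (c::int)"
proof (induction S arbitrary: q rule: finite_induct)
  case empty
  then have "q = [:1:]"
    by (metis card.empty coeff_pCons_0 degree_eq_zeroE)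
  then show ?case
    using empty m by (simp add: one_pCons)
next
  case (insert c S)
  define s where "s = synthetic_div q c"
  obtain t where t: "poly q c = int p * t"
    using insert.prems by (meson dvdE insertI1)
  have q: "q = [:- c, 1:] * s + [:poly q c:]"
    using synthetic_div_correct'[of c q] by (simp add: s_def)
  have deg: "degree s = card S"
    using insert by (simp add: s_def degree_synthetic_div)
  have "q \<noteq> 0" "degree q \<noteq> 0"
    using insert by auto
  then have s0: "s \<noteq> 0"
    by (simp add: s_def synthetic_div_eq_0_iff)
  have "degree ([:- c, 1:] * s) = Suc (degree s)"
    using s0 by (subst degree_mult_eq) auto
  then have "lead_coeff q = lead_coeff ([:- c, 1:] * s)"
    by (metis q add.commute degree_pCons_0 lead_coeff_add_le zero_less_Suc)
  then have lead: "lead_coeff s = 1"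
    using insert.prems lead_coeff_mult[of "[:- c, 1:]" s] by (simp del: mult_pCons_left)
  have roots: "int p dvd poly s d" if "d \<in> S" for d
  proof -
    have "int p dvd poly q d"
      using insert.prems that by simp
    moreover have "poly q d = (d - c) * poly s d + int p * t"
      by (subst q) (simp add: t algebra_simps)
    ultimately have "int p dvd (d - c) * poly s d"
      by (metis dvd_add_left_iff dvd_triv_left)
    moreover have "\<not> int p dvd (d - c)"
    proof
      assume "int p dvd d - c"
      moreover have "d \<in> {1..<int p}" "c \<in> {1..<int p}" "d \<noteq> c"
        using insert.prems(1) insert.hyps(2) that by blast+
      ultimately show False
        using dvd_imp_le_int[of "d - c" "int p"] by (cases "d < c") auto
    qed
    ultimately show ?thesis
      using p by (meson prime_dvd_mult_iff prime_nat_int_transfer)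
  qed
  show ?case
  proof (cases "poly_act G f s m = \<one>")
    case True
    then show ?thesis
      using insert deg lead roots by auto
  next
    case False
    have "[:poly q c:] = smult (int p) [:t:]"
      by (simp add: t)
    then have "poly_act G f q m = poly_act G f ([:- c, 1:] * s + smult (int p) [:t:]) m"
      using q by simp
    also have "\<dots> = poly_act G f [:- c, 1:] (poly_act G f s m)"
      using m expo by (simp only: poly_act_add poly_act_smult poly_act_mult poly_act_closed int_pow_int r_one)
    finally have "f (poly_act G f s m) = poly_act G f s m [^] c"
      using insert.prems(5) m poly_act_linear[of "poly_act G f s m" c] poly_act_closed by metis
    then show ?thesis
      using False m poly_act_closed by blast
  qed
qed

text \<open>The two parts of the exponent are treated in turn. The \<open>p^k\<close> part is
  unipotent, so \<open>f^(p-1)\<close> fixes some nontrivial \<open>u\<close>; then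
  \<open>X^(p-1) - 1\<close> kills \<open>u\<close>, and by Fermat it has all of
  \<open>1, ..., p-1\<close> as roots.\<close>

lemma eigenvector:
  assumes p: "Factorial_Ring.prime (p::nat)" and expo: "\<And>x. x \<in> carrier G \<Longrightarrow> x [^] p = \<one>"
    and m: "m \<in> carrier G" "m \<noteq> \<one>"
    and fm: "\<And>x. x \<in> carrier G \<Longrightarrow> (f ^^ ((p - 1) * p ^ k)) x = x"
  shows "\<exists>c. \<exists>u\<in>carrier G. u \<noteq> \<one> \<and> f u = u [^] (c::int)"
proof -
  have p1: "p > 1"
    using p prime_gt_1_nat by blast
  let ?g = "f ^^ (p - 1)"
  interpret g: abelian_endo G ?g
    by unfold_locales (rule funpow_hom)
  have "(?g ^^ (p ^ k)) m = m"
    using fm m by (simp add: funpow_mult mult.commute)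
  then obtain u where u: "u \<in> carrier G" "u \<noteq> \<one>" "?g u = u"
    using g.fixed_point_of_prime_power[OF p expo m] by blast
  let ?q = "monom 1 (p - 1) - 1 :: int poly"
  have deg1: "degree ?q = p - 1"
    using p1 degree_add_eq_left[of "- 1 :: int poly" "monom 1 (p - 1)"]
    by (simp add: degree_monom_eq)
  show ?thesis
  proof (rule eigenvector_of_split_poly[OF p expo u(1,2), of "{1..<int p}" ?q])
    show "int p dvd poly ?q c" if "c \<in> {1..<int p}" for c
    proof -
      have c: "int (nat c) = c" "0 < c" "c < int p"
        using that by auto
      have "\<not> p dvd nat c"
        using that by (auto dest: dvd_imp_le)
      then have "[nat c ^ (p - 1) = 1] (mod p)"
        using p fermat_theorem by blast
      then have "[int (nat c ^ (p - 1)) = int 1] (mod int p)"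
        using cong_int_iff by blast
      then have "[c ^ (p - 1) = 1] (mod int p)"
        using c(1) by simp
      then show ?thesis
        by (simp add: poly_monom cong_iff_dvd_diff)
    qed
    show "lead_coeff ?q = 1"
      using p1 deg1 by simp
    show "poly_act G f ?q u = \<one>"
      using u by (simp add: poly_act_power_minus_one)
  qed (use deg1 in auto)
qed

end

section \<open>Fixed-point-free pairs of operators\<close>

lemma (in comm_monoid) finprod_swap:
  assumes "finite S" "finite T" "\<And>i j. i \<in> S \<Longrightarrow> j \<in> T \<Longrightarrow> a i j \<in> carrier G"
  shows "(\<Otimes>i\<in>S. \<Otimes>j\<in>T. a i j) = (\<Otimes>j\<in>T. \<Otimes>i\<in>S. a i j)"
  using assms(1,3)
proof (induction S rule: finite_induct)
  case (insert i S)
  then have "(\<Otimes>j\<in>T. \<Otimes>i\<in>insert i S. a i j) = (\<Otimes>j\<in>T. a i j \<otimes> (\<Otimes>i\<in>S. a i j))"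
    by (intro finprod_cong') (auto simp: Pi_iff)
  also have "\<dots> = (\<Otimes>j\<in>T. a i j) \<otimes> (\<Otimes>j\<in>T. \<Otimes>i\<in>S. a i j)"
    using insert by (intro finprod_multf) (auto simp: Pi_iff)
  finally show ?case
    using insert by (simp add: Pi_iff)
qed (simp add: finprod_one_eqI)

context abelian_endo
begin

definition orbit_prod :: "nat \<Rightarrow> 'a \<Rightarrow> 'a" where
  "orbit_prod n x = (\<Otimes>i\<in>{..<n}. (f ^^ i) x)"

lemma orbit_prod_closed: "x \<in> carrier G \<Longrightarrow> orbit_prod n x \<in> carrier G"
  by (auto simp: orbit_prod_def funpow_closed)

lemma orbit_prod_fixed:
  assumes x: "x \<in> carrier G" and fx: "(f ^^ n) x = x"
  shows "f (orbit_prod n x) = orbit_prod n x"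
proof -
  \<comment> \<open>Both sides are the product over \<open>i \<le> k\<close>, with the first or the
    last factor split off; at \<open>k = n\<close> the factors split off agree and cancel.\<close>
  have "x \<otimes> f (orbit_prod k x) = orbit_prod k x \<otimes> (f ^^ k) x" for k
  proof (induction k)
    case (Suc k)
    have Suc_k: "orbit_prod (Suc k) x = orbit_prod k x \<otimes> (f ^^ k) x"
      using x by (simp add: orbit_prod_def lessThan_Suc Pi_iff funpow_closed m_comm)
    show ?case
      unfolding Suc_k using x Suc.IH
      by (simp add: orbit_prod_closed funpow_closed flip: m_assoc)
  qed (use x in \<open>simp add: orbit_prod_def\<close>)
  from this[of n] show ?thesis
    using x fx by (metis f.hom_closed l_cancel m_comm orbit_prod_closed)
qed

end

text \<open>The operators satisfy
  \<open>(\<Sum>j<p. \<Sum>k<p. f^k g^(j k)) = p + (\<Sum>0<k<p. f^k (\<Sum>j<p. (g^k)^j))\<close>, and each of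
  the norms \<open>\<Sum>k<p. (f g^j)^k\<close> and \<open>\<Sum>j<p. (g^k)^j\<close> vanishes, as its values are fixed
  points; hence the exponent divides \<open>p\<close>.\<close>

lemma (in comm_group) trivial_of_fixed_point_free_pair:
  assumes p: "Factorial_Ring.prime (p::nat)"
    and f: "f \<in> hom G G" and g: "g \<in> hom G G"
    and comm: "\<And>x. x \<in> carrier G \<Longrightarrow> f (g x) = g (f x)"
    and fp: "\<And>x. x \<in> carrier G \<Longrightarrow> (f ^^ p) x = x"
    and gp: "\<And>x. x \<in> carrier G \<Longrightarrow> (g ^^ p) x = x"
    and fpf1: "\<And>j x. j < p \<Longrightarrow> x \<in> carrier G \<Longrightarrow> f ((g ^^ j) x) = x \<Longrightarrow> x = \<one>"
    and fpf2: "\<And>k x. 0 < k \<Longrightarrow> k < p \<Longrightarrow> x \<in> carrier G \<Longrightarrow> (g ^^ k) x = x \<Longrightarrow> x = \<one>"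
  shows "carrier G = {\<one>}"
proof -
  have p1: "p > 1"
    using p prime_gt_1_nat by blast
  interpret F: abelian_endo G f
    by unfold_locales (rule f)
  interpret g: abelian_endo G g
    by unfold_locales (rule g)
  have gf: "(g ^^ j) (f x) = f ((g ^^ j) x)" if "x \<in> carrier G" for j x
    using that by (induction j) (auto simp: comm g.funpow_closed)
  have gff: "(g ^^ j) ((f ^^ k) x) = (f ^^ k) ((g ^^ j) x)" if "x \<in> carrier G" for j k x
    using that by (induction k) (auto simp: gf F.funpow_closed)
  have expo: "x [^] p = \<one>" if x: "x \<in> carrier G" for x
  proof -
    \<comment> \<open>Row \<open>j\<close> of this table multiplies to a norm of
      \<open>f g^j\<close>, column \<open>k\<close> to the image under \<open>f^k\<close> of a norm
      of \<open>g^k\<close>. Only column \<open>0\<close>, constantly \<open>x\<close>, escapes the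
      hypotheses, so multiplying out both ways leaves \<open>x^p = 1\<close>.\<close>
    let ?a = "\<lambda>j k. (f ^^ k) ((g ^^ (j * k)) x)"
    have closed [simp]: "?a j k \<in> carrier G" for j k
      using x by (simp add: F.funpow_closed g.funpow_closed)
    have row: "(\<Otimes>k\<in>{..<p}. ?a j k) = \<one>" if j: "j < p" for j
    proof -
      let ?h = "f \<circ> (g ^^ j)"
      have "?h \<in> hom G G"
        using Group.hom_compose[OF g.funpow_hom f] .
      then interpret h: abelian_endo G ?h
        by unfold_locales
      have pow: "(?h ^^ k) y = (f ^^ k) ((g ^^ (j * k)) y)" if "y \<in> carrier G" for k y
      proof (induction k)
        case (Suc k)
        have "(?h ^^ Suc k) y = f ((g ^^ j) ((f ^^ k) ((g ^^ (j * k)) y)))"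
          by (simp only: funpow.simps comp_apply Suc)
        also have "\<dots> = f ((f ^^ k) ((g ^^ j) ((g ^^ (j * k)) y)))"
          using that by (simp add: gff g.funpow_closed)
        also have "\<dots> = (f ^^ Suc k) ((g ^^ (j * Suc k)) y)"
          by (simp add: funpow_add)
        finally show ?case .
      qed simp
      have gpj: "(g ^^ (j * p)) y = y" if "y \<in> carrier G" for y
        using that by (induction j) (auto simp: funpow_add gp g.funpow_closed)
      have "(?h ^^ p) x = x"
        using x by (simp add: pow gpj fp)
      then have "?h (h.orbit_prod p x) = h.orbit_prod p x"
        using x by (intro h.orbit_prod_fixed)
      then have "h.orbit_prod p x = \<one>"
        using x j fpf1[of j "h.orbit_prod p x"] h.orbit_prod_closed by auto
      moreover have "h.orbit_prod p x = (\<Otimes>k\<in>{..<p}. ?a j k)"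
        unfolding h.orbit_prod_def using x by (intro finprod_cong') (auto simp: pow)
      ultimately show ?thesis
        by simp
    qed
    have column: "(\<Otimes>j\<in>{..<p}. ?a j k) = (if k = 0 then x [^] p else \<one>)" if k: "k < p" for k
    proof (cases "k = 0")
      case True
      then show ?thesis
        using x by (simp add: finprod_const)
    next
      case False
      interpret gk: abelian_endo G "g ^^ k"
        by unfold_locales (rule g.funpow_hom)
      have pow: "((g ^^ k) ^^ j) = g ^^ (j * k)" for j
        by (simp add: funpow_mult mult.commute)
      have "((g ^^ k) ^^ p) x = x"
      proof -
        have "(g ^^ (k * p)) x = x"
          using x by (induction k) (auto simp: funpow_add gp)
        then show ?thesis
          by (simp add: funpow_mult)
      qed
      then have "(g ^^ k) (gk.orbit_prod p x) = gk.orbit_prod p x"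
        using x by (intro gk.orbit_prod_fixed)
      then have one: "gk.orbit_prod p x = \<one>"
        using x k False fpf2[of k "gk.orbit_prod p x"] gk.orbit_prod_closed by auto
      interpret fk: group_hom G G "f ^^ k"
        using F.funpow_hom by unfold_locales
      have "(\<Otimes>j\<in>S. ?a j k) = (f ^^ k) (\<Otimes>j\<in>S. (g ^^ (j * k)) x)" if "finite S" for S
        using that
        by (induction S rule: finite_induct) (auto simp: x g.funpow_closed F.funpow_closed Pi_iff)
      then have "(\<Otimes>j\<in>{..<p}. ?a j k) = (f ^^ k) (gk.orbit_prod p x)"
        unfolding gk.orbit_prod_def pow by simp
      then show ?thesis
        using one False by simp
    qed
    have "\<one> = (\<Otimes>j\<in>{..<p}. \<Otimes>k\<in>{..<p}. ?a j k)"
      using row by (intro finprod_one_eqI[symmetric]) auto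
    also have "\<dots> = (\<Otimes>k\<in>{..<p}. \<Otimes>j\<in>{..<p}. ?a j k)"
      by (intro finprod_swap) auto
    also have "\<dots> = (\<Otimes>k\<in>{..<p}. if k = 0 then x [^] p else \<one>)"
      using column x by (intro finprod_cong') auto
    also have "\<dots> = (\<Otimes>k\<in>insert 0 {0<..<p}. if k = 0 then x [^] p else \<one>)"
      using p1 by (intro arg_cong2[where f = "finprod G"] refl) auto
    also have "\<dots> = x [^] p \<otimes> (\<Otimes>k\<in>{0<..<p}. if k = 0 then x [^] p else \<one>)"
      using x by (subst finprod_insert) auto
    also have "(\<Otimes>k\<in>{0<..<p}. if k = 0 then x [^] p else \<one>) = \<one>"
      by (intro finprod_one_eqI) auto
    finally show ?thesis
      using x by simp
  qed
  \<comment> \<open>In exponent \<open>p\<close> the relation \<open>f^p = 1\<close> forces a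
    nontrivial fixed point of \<open>f\<close> itself, which \<open>fpf1\<close> at
    \<open>j = 0\<close> excludes.\<close>
  have "x = \<one>" if x: "x \<in> carrier G" for x
  proof (rule ccontr)
    assume "x \<noteq> \<one>"
    then obtain u where "u \<in> carrier G" "u \<noteq> \<one>" "f u = u"
      using F.fixed_point_of_prime_power_step[OF p expo x _ fp[OF x]] by blast
    then show False
      using fpf1[of 0 u] p1 by simp
  qed
  then show ?thesis
    by auto
qed

section \<open>Sections\<close>

lemma (in group) normal_in_subgroupI:
  assumes "subgroup W G" "subgroup M G" "M \<subseteq> W"
    and "\<And>x m. x \<in> W \<Longrightarrow> m \<in> M \<Longrightarrow> x \<otimes> m \<otimes> inv x \<in> M"
  shows "M \<lhd> G\<lparr>carrier := W\<rparr>"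
proof -
  interpret W: group "G\<lparr>carrier := W\<rparr>"
    using assms(1) by (rule subgroup_imp_group)
  show ?thesis
    unfolding W.normal_inv_iff
    using assms subgroup_incl[OF assms(2,1)] by (auto simp: m_inv_consistent)
qed

text \<open>The coset \<open>M #> x\<close> is formed in \<open>G\<close> and so does not depend on
  \<open>W\<close>: facts about cosets move freely between sections with the same \<open>M\<close>
  and different \<open>W\<close>.\<close>

locale group_section = group G for G (structure) +
  fixes W M
  assumes W_subgroup: "subgroup W G" and M_normal: "M \<lhd> G\<lparr>carrier := W\<rparr>"
begin

abbreviation "Q \<equiv> G\<lparr>carrier := W\<rparr> Mod M"

sublocale Q: group Q
  using M_normal by (rule normal.factorgroup_is_group)

sublocale M: normal M "G\<lparr>carrier := W\<rparr>"
  by (rule M_normal)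

lemma W_carrier: "x \<in> W \<Longrightarrow> x \<in> carrier G"
  using W_subgroup subgroup.subset by blast

lemma M_subgroup: "subgroup M G"
  using M.subgroup_axioms W_subgroup incl_subgroup by blast

lemma M_subset: "M \<subseteq> W"
  using M.subset by simp

lemma M_conj: "x \<in> W \<Longrightarrow> m \<in> M \<Longrightarrow> x \<otimes> m \<otimes> inv x \<in> M"
  using M.inv_op_closed2[of x m] W_subgroup by (simp add: m_inv_consistent)

lemma r_coset_restrict: "M #>\<^bsub>G\<lparr>carrier := W\<rparr>\<^esub> x = M #> x"
  by (simp add: r_coset_def)

lemma carrier_Q: "carrier Q = (#>) M ` W"
  unfolding carrier_FactGroup by (simp add: r_coset_restrict)

lemma coset_mult: "x \<in> W \<Longrightarrow> y \<in> W \<Longrightarrow> (M #> x) \<otimes>\<^bsub>Q\<^esub> (M #> y) = M #> (x \<otimes> y)"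
  using M.rcos_sum[of x y] by (simp add: r_coset_def set_mult_def)

lemma coset_in_Q [simp]: "x \<in> W \<Longrightarrow> M #> x \<in> carrier Q"
  by (simp add: carrier_Q)

lemma coset_pow: "x \<in> W \<Longrightarrow> (M #> x) [^]\<^bsub>Q\<^esub> (n::nat) = M #> (x [^] n)"
  using M.FactGroup_pow[of x n] by (simp add: r_coset_restrict nat_pow_consistent[symmetric])

lemma coset_int_pow: "x \<in> W \<Longrightarrow> (M #> x) [^]\<^bsub>Q\<^esub> (n::int) = M #> (x [^] n)"
  using M.FactGroup_int_pow[of x n] W_subgroup
  by (simp add: r_coset_restrict int_pow_consistent)

lemma coset_eq_iff: "x \<in> W \<Longrightarrow> y \<in> W \<Longrightarrow> M #> x = M #> y \<longleftrightarrow> x \<otimes> inv y \<in> M"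
proof -
  assume xy: "x \<in> W" "y \<in> W"
  then have "x \<in> M #> y \<longleftrightarrow> x \<otimes> inv y \<in> M"
    using subgroup.rcos_module[OF M_subgroup group_axioms, of y x] W_carrier by blast
  moreover have "x \<in> M #> y \<longleftrightarrow> M #> x = M #> y"
    using xy W_carrier repr_independence[OF _ _ M_subgroup, of x y] rcos_self[OF _ M_subgroup, of x]
    by metis
  ultimately show ?thesis
    by simp
qed

lemma coset_eq_M_iff: "x \<in> W \<Longrightarrow> M #> x = M \<longleftrightarrow> x \<in> M"
  using M_subgroup W_carrier coset_join1 coset_join2 subgroup.subset by (metis subgroup.mem_carrier)

lemma coset_eq_iff': "x \<in> W \<Longrightarrow> y \<in> W \<Longrightarrow> M #> x = M #> y \<longleftrightarrow> inv x \<otimes> y \<in> M"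
proof -
  assume xy: "x \<in> W" "y \<in> W"
  then have "inv x \<in> W" "inv x \<otimes> y \<in> W"
    using W_subgroup by (auto intro: subgroup.m_inv_closed subgroup.m_closed)
  have "(M #> x) \<otimes>\<^bsub>Q\<^esub> (M #> (inv x \<otimes> y)) = M #> y"
    using xy \<open>inv x \<otimes> y \<in> W\<close> by (simp only: coset_mult) (simp add: W_carrier inv_solve_left flip: m_assoc)
  then have "M #> x = M #> y \<longleftrightarrow> M #> (inv x \<otimes> y) = \<one>\<^bsub>Q\<^esub>"
    using xy \<open>inv x \<otimes> y \<in> W\<close> by (metis Q.l_cancel_one' Q.r_cancel_one' coset_in_Q)
  then show ?thesis
    using \<open>inv x \<otimes> y \<in> W\<close> coset_eq_M_iff by simp
qed

lemma comm_group_Q: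
  assumes "derived G W \<subseteq> M"
  shows "comm_group Q"
proof (rule Q.group_comm_groupI)
  fix u v assume "u \<in> carrier Q" "v \<in> carrier Q"
  then obtain x y where xy: "x \<in> W" "y \<in> W" "u = M #> x" "v = M #> y"
    unfolding carrier_Q by blast
  have "x \<otimes> y \<otimes> inv x \<otimes> inv y \<in> derived G W"
    unfolding derived_def using xy by (intro generate.incl) auto
  then have "x \<otimes> y \<otimes> inv (y \<otimes> x) \<in> M"
    using assms xy by (auto simp: W_carrier inv_mult_group m_assoc)
  then show "u \<otimes>\<^bsub>Q\<^esub> v = v \<otimes>\<^bsub>Q\<^esub> u"
    using xy W_subgroup by (simp add: coset_mult coset_eq_iff subgroup.m_closed del: mult_FactGroup)
qed

text \<open>The map induced on \<open>W/M\<close> is represented by \<open>image f\<close>. For the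
  image of a coset to be a whole coset, \<open>f\<close> has to map \<open>M\<close> onto itself,
  hence an equality instead of an inclusion.\<close>

lemma image_coset:
  assumes "f \<in> hom (G\<lparr>carrier := W\<rparr>) G" "f ` M = M" "x \<in> W"
  shows "f ` (M #> x) = M #> f x"
proof -
  have "f (m \<otimes> x) = f m \<otimes> f x" if "m \<in> M" for m
    using hom_mult[OF assms(1), of m x] that assms(3) M_subset by auto
  then have "f ` (M #> x) = (\<lambda>m. f m \<otimes> f x) ` M"
    by (auto simp: r_coset_def image_iff)
  also have "\<dots> = M #> f x"
    by (subst (2) assms(2)[symmetric]) (auto simp: r_coset_def image_iff)
  finally show ?thesis .
qed

lemma image_hom_Q:
  assumes f: "f \<in> hom (G\<lparr>carrier := W\<rparr>) G" "f ` M = M" and W: "\<And>x. x \<in> W \<Longrightarrow> f x \<in> W"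
  shows "image f \<in> hom Q Q"
proof (rule homI)
  fix u assume "u \<in> carrier Q"
  then show "f ` u \<in> carrier Q"
    unfolding carrier_Q using image_coset[OF f] W by auto
next
  fix u v assume "u \<in> carrier Q" "v \<in> carrier Q"
  then obtain x y where xy: "x \<in> W" "y \<in> W" "u = M #> x" "v = M #> y"
    unfolding carrier_Q by blast
  then have "f (x \<otimes> y) = f x \<otimes> f y" "x \<otimes> y \<in> W"
    using hom_mult[OF f(1), of x y] W_subgroup by (auto intro: subgroup.m_closed)
  then show "f ` (u \<otimes>\<^bsub>Q\<^esub> v) = f ` u \<otimes>\<^bsub>Q\<^esub> f ` v"
    using xy W by (simp add: coset_mult image_coset[OF f] del: mult_FactGroup)
qed

lemma funpow_image_coset:
  assumes f: "f \<in> hom (G\<lparr>carrier := W\<rparr>) G" "f ` M = M" and W: "\<And>x. x \<in> W \<Longrightarrow> f x \<in> W"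
    and x: "x \<in> W"
  shows "(image f ^^ n) (M #> x) = M #> (f ^^ n) x \<and> (f ^^ n) x \<in> W"
  using W x by (induction n) (auto simp: image_coset[OF f])

end

text \<open>A perfect subgroup lies in every term of the derived series of \<open>G\<close>, and the
  last term is trivial.\<close>

lemma (in group) derived_proper_of_solvable:
  assumes "solvable G" "subgroup W G" "W \<noteq> {\<one>}"
  shows "derived G W \<noteq> W"
proof
  assume "derived G W = W"
  then have fixp: "(derived G ^^ n) W = W" for n
    by (induction n) auto
  obtain n where "(derived G ^^ n) (carrier G) = {\<one>}"
    using assms(1) solvable_imp_trivial_derived_seq unfolding solvable_def by blast
  then have "W \<subseteq> {\<one>}"
    using mono_exp_of_derived[of W "carrier G" n] assms(2) fixp subgroup.subset by metis
  then show False
    using assms(2,3) subgroup.one_closed by blast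
qed

text \<open>For a subgroup \<open>K\<close> it says that at most \<open>p\<close> cosets of
  \<open>K\<close>, all given by powers of one element, cover \<open>B\<close>. In this form its
  negation, taken at some \<open>a\<close> outside \<open>K\<close>, directly yields a
  \<open>y\<close> with every \<open>y a^i\<close> outside \<open>K\<close>.\<close>

definition cocyclic :: "('c, 'd) monoid_scheme \<Rightarrow> nat \<Rightarrow> 'c set \<Rightarrow> 'c set \<Rightarrow> bool" where
  "cocyclic A p B K \<longleftrightarrow> (\<exists>a\<in>B. \<forall>y\<in>B. \<exists>i<p. y \<otimes>\<^bsub>A\<^esub> a [^]\<^bsub>A\<^esub> i \<in> K)"

text \<open>The fibres \<open>F i\<close> cover \<open>D\<close>, and left translation by the
  inverse of one member embeds a fibre into \<open>D \<inter> K\<close>. Admitting any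
  \<open>D\<close> inside \<open>B\<close> allows two cocyclic subgroups to be intersected.\<close>

lemma (in comm_group) card_le_cocyclic:
  assumes fin: "finite (carrier G)" and B: "subgroup B G" and K: "subgroup K G"
    and D: "subgroup D G" "D \<subseteq> B" and coc: "cocyclic G p B K"
  shows "card D \<le> p * card (D \<inter> K)"
proof -
  obtain a where a: "a \<in> B" "\<And>y. y \<in> B \<Longrightarrow> \<exists>i<p. y \<otimes> a [^] i \<in> K"
    using coc unfolding cocyclic_def by blast
  have aG: "a \<in> carrier G"
    using a(1) B subgroup.mem_carrier by metis
  have DG: "y \<in> carrier G" if "y \<in> D" for y
    using that D(1) subgroup.mem_carrier by metis
  have finD: "finite D"
    using D(1) fin finite_subset subgroup.subset by metis
  define F where "F i = {y \<in> D. y \<otimes> a [^] i \<in> K}" for i :: nat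
  have "card (F i) \<le> card (D \<inter> K)" for i
  proof (cases "F i = {}")
    case False
    then obtain y0 where y0: "y0 \<in> D" "y0 \<otimes> a [^] i \<in> K"
      unfolding F_def by blast
    show ?thesis
    proof (rule card_inj_on_le[of "\<lambda>y. inv y0 \<otimes> y"])
      show "inj_on (\<lambda>y. inv y0 \<otimes> y) (F i)"
        using y0 DG by (auto simp: inj_on_def F_def)
      show "(\<lambda>y. inv y0 \<otimes> y) ` F i \<subseteq> D \<inter> K"
      proof (rule image_subsetI)
        fix y assume "y \<in> F i"
        then have y: "y \<in> D" "y \<otimes> a [^] i \<in> K"
          by (auto simp: F_def)
        have "inv (y0 \<otimes> a [^] i) \<otimes> (y \<otimes> a [^] i) \<in> K"
          using y0 y K subgroup.m_closed subgroup.m_inv_closed by metis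
        also have "inv (y0 \<otimes> a [^] i) \<otimes> (y \<otimes> a [^] i) = inv y0 \<otimes> y"
        proof -
          have "inv (y0 \<otimes> a [^] i) \<otimes> (y \<otimes> a [^] i) = inv y0 \<otimes> y \<otimes> (inv (a [^] i) \<otimes> a [^] i)"
            using y0 y DG aG by (simp add: inv_mult m_ac)
          then show ?thesis
            using y0 y DG aG by simp
        qed
        finally show "inv y0 \<otimes> y \<in> D \<inter> K"
          using y0 y D(1) subgroup.m_closed subgroup.m_inv_closed by (metis IntI)
      qed
    qed (use finD in auto)
  qed auto
  moreover have "D \<subseteq> (\<Union>i\<in>{..<p}. F i)"
    using a(2) D(2) unfolding F_def by auto
  ultimately have "card D \<le> (\<Sum>i\<in>{..<p}. card (F i))"
    using finD by (intro order.trans[OF card_mono card_UN_le]) (auto simp: F_def)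
  also have "\<dots> \<le> p * card (D \<inter> K)"
    using sum_bounded_above[of "{..<p}" "\<lambda>i. card (F i)"] \<open>\<And>i. card (F i) \<le> _\<close> by simp
  finally show ?thesis .
qed

section \<open>Generation by fixed points\<close>

declare mult_FactGroup [simp del]

locale elementary_good_action = group G + A: comm_group A
  for G (structure) and A :: "('c, 'd) monoid_scheme" +
  fixes p :: nat and \<phi> :: "'c \<Rightarrow> 'a \<Rightarrow> 'a"
  assumes p_prime: "Factorial_Ring.prime p"
    and finite_G: "finite (carrier G)" and finite_A: "finite (carrier A)"
    and solvable_G: "solvable G"
    and expo_A: "\<And>a. a \<in> carrier A \<Longrightarrow> a [^]\<^bsub>A\<^esub> p = \<one>\<^bsub>A\<^esub>"
    and act_closed: "\<And>a x. a \<in> carrier A \<Longrightarrow> x \<in> carrier G \<Longrightarrow> \<phi> a x \<in> carrier G"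
    and act_mult: "\<And>a x y. a \<in> carrier A \<Longrightarrow> x \<in> carrier G \<Longrightarrow> y \<in> carrier G \<Longrightarrow>
      \<phi> a (x \<otimes> y) = \<phi> a x \<otimes> \<phi> a y"
    and act_comp: "\<And>a b x. a \<in> carrier A \<Longrightarrow> b \<in> carrier A \<Longrightarrow> x \<in> carrier G \<Longrightarrow>
      \<phi> (a \<otimes>\<^bsub>A\<^esub> b) x = \<phi> a (\<phi> b x)"
    and act_one: "\<And>x. x \<in> carrier G \<Longrightarrow> \<phi> \<one>\<^bsub>A\<^esub> x = x"
    and good: "\<And>B H. subgroup B A \<Longrightarrow> subgroup H G \<Longrightarrow> (\<And>b. b \<in> B \<Longrightarrow> \<phi> b ` H \<subseteq> H) \<Longrightarrow>
      H \<subseteq> comm_act G \<phi> H B <#> fix_act \<phi> H B"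
begin

section \<open>Invariant subgroups and fixed points of the action\<close>

definition invariant :: "'c set \<Rightarrow> 'a set \<Rightarrow> bool" where
  "invariant B H \<longleftrightarrow> (\<forall>b\<in>B. \<forall>h\<in>H. \<phi> b h \<in> H)"

lemma finite_subgroup: "subgroup H G \<Longrightarrow> finite H"
  using finite_G finite_subset subgroup.subset by metis

lemma act_hom: "a \<in> carrier A \<Longrightarrow> \<phi> a \<in> hom G G"
  using act_closed act_mult by (auto intro: homI)

lemma act_group_hom: "a \<in> carrier A \<Longrightarrow> group_hom G G (\<phi> a)"
  using act_hom by unfold_locales

lemma act_inv_cancel:
  assumes "a \<in> carrier A" "x \<in> carrier G"
  shows "\<phi> a (\<phi> (inv\<^bsub>A\<^esub> a) x) = x" "\<phi> (inv\<^bsub>A\<^esub> a) (\<phi> a x) = x"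
  using assms act_comp[of a "inv\<^bsub>A\<^esub> a" x] act_comp[of "inv\<^bsub>A\<^esub> a" a x] act_one by auto

lemma act_pow:
  assumes "a \<in> carrier A" "x \<in> carrier G"
  shows "\<phi> (a [^]\<^bsub>A\<^esub> n) x = (\<phi> a ^^ n) x"
proof (induction n)
  case 0
  then show ?case using assms act_one by simp
next
  case (Suc n)
  have "\<phi> (a [^]\<^bsub>A\<^esub> Suc n) x = \<phi> (a \<otimes>\<^bsub>A\<^esub> a [^]\<^bsub>A\<^esub> n) x"
    using assms A.nat_pow_Suc2 by simp
  then show ?case
    using assms Suc act_comp[of a "a [^]\<^bsub>A\<^esub> n" x] by simp
qed

lemma invariant_image_eq:
  assumes "subgroup B A" "invariant B H" "H \<subseteq> carrier G" "b \<in> B"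
  shows "\<phi> b ` H = H"
proof -
  have "inv\<^bsub>A\<^esub> b \<in> B" "b \<in> carrier A"
    using assms(1,4) subgroup.m_inv_closed subgroup.mem_carrier by metis+
  then have "h \<in> \<phi> b ` H" if "h \<in> H" for h
    using that assms act_inv_cancel(1)[of b h] unfolding invariant_def
    by (intro image_eqI[of _ _ "\<phi> (inv\<^bsub>A\<^esub> b) h"]) auto
  then show ?thesis
    using assms unfolding invariant_def by auto
qed

lemma invariant_derived:
  assumes B: "subgroup B A" and H: "subgroup H G" "invariant B H"
  shows "invariant B (derived G H)"
  unfolding invariant_def
proof (intro ballI)
  fix b x assume b: "b \<in> B" and x: "x \<in> derived G H"
  interpret b: group_hom G G "\<phi> b"
    using act_group_hom b B subgroup.mem_carrier by metis
  have "\<phi> b ` derived G H = derived G (\<phi> b ` H)"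
    using b.derived_img[of H] H subgroup.subset by metis
  also have "\<phi> b ` H = H"
    using invariant_image_eq[OF B H(2)] H(1) b subgroup.subset by metis
  finally show "\<phi> b x \<in> derived G H"
    using x by blast
qed

lemma subgroup_derived: "subgroup H G \<Longrightarrow> subgroup (derived G H) G"
  using derived_is_subgroup subgroup.subset by metis

lemma fix_act_subgroup:
  assumes "subgroup H G" "B \<subseteq> carrier A"
  shows "subgroup (fix_act \<phi> H B) G"
proof (rule subgroupI)
  show "fix_act \<phi> H B \<subseteq> carrier G"
    using assms subgroup.subset unfolding fix_act_def by fastforce
  have "\<phi> b \<one> = \<one>" if "b \<in> B" for b
    using that assms act_hom[of b] hom_one[of "\<phi> b" G] group_axioms by blast
  then have "\<one> \<in> fix_act \<phi> H B"
    using assms subgroup.one_closed unfolding fix_act_def by blast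
  then show "fix_act \<phi> H B \<noteq> {}"
    by blast
next
  fix x assume "x \<in> fix_act \<phi> H B"
  then show "inv x \<in> fix_act \<phi> H B"
    using assms group_hom.hom_inv[OF act_group_hom, of _ x] subgroup.m_inv_closed[of H G x]
      subgroup.mem_carrier[of H G x] unfolding fix_act_def by (auto simp: subset_iff)
next
  fix x y assume "x \<in> fix_act \<phi> H B" "y \<in> fix_act \<phi> H B"
  then show "x \<otimes> y \<in> fix_act \<phi> H B"
    using assms subgroup.m_closed[of H G x y] act_mult[of _ x y]
      subgroup.mem_carrier[of H G] unfolding fix_act_def by (auto simp: subset_iff)
qed

lemma normal_of_derived_subset:
  assumes "subgroup U G" "subgroup M G" "derived G U \<subseteq> M" "M \<subseteq> U"
  shows "M \<lhd> G\<lparr>carrier := U\<rparr>"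
proof (rule normal_in_subgroupI)
  fix x m assume xm: "x \<in> U" "m \<in> M"
  then have "x \<otimes> m \<otimes> inv x \<otimes> inv m \<in> derived G U"
    using assms unfolding derived_def by (intro generate.incl) auto
  then have "(x \<otimes> m \<otimes> inv x \<otimes> inv m) \<otimes> m \<in> M"
    using subgroup.m_closed[OF assms(2)] assms(3) xm(2) by blast
  moreover have "x \<in> carrier G" "m \<in> carrier G"
    using xm subgroup.mem_carrier[OF assms(1)] subgroup.mem_carrier[OF assms(2)] by blast+
  ultimately show "x \<otimes> m \<otimes> inv x \<in> M"
    by (simp add: m_assoc)
qed (use assms in auto)

text \<open>An irreducible section is acted upon by a cyclic quotient of the elementary abelian
  group: outside the kernel all operators are fixed-point-free, and no two independent ones
  exist.\<close>

lemma cocyclic_kernel_of_irreducible: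
  assumes B: "subgroup B A"
    and U: "subgroup U G" "invariant B U" and M: "subgroup M G" "invariant B M"
    and der: "derived G U \<subseteq> M" and sub: "M \<subset> U"
    and irr: "\<And>Y. subgroup Y G \<Longrightarrow> invariant B Y \<Longrightarrow> M \<subseteq> Y \<Longrightarrow> Y \<subseteq> U \<Longrightarrow> Y = M \<or> Y = U"
  obtains K where "subgroup K A" "K \<subseteq> B" "cocyclic A p B K"
    "\<And>b x. b \<in> K \<Longrightarrow> x \<in> U \<Longrightarrow> inv x \<otimes> \<phi> b x \<in> M"
proof -
  have "M \<lhd> G\<lparr>carrier := U\<rparr>"
    using normal_of_derived_subset[OF U(1) M(1) der] sub by blast
  then interpret S: group_section G U M
    using U(1) by (intro group_section.intro group_section_axioms.intro group_axioms)
  interpret Q: comm_group S.Q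
    using der by (rule S.comm_group_Q)
  have BA: "b \<in> carrier A" if "b \<in> B" for b
    using that B subgroup.mem_carrier by metis
  have hom: "\<phi> b \<in> hom (G\<lparr>carrier := U\<rparr>) G" if "b \<in> B" for b
    using act_hom[OF BA[OF that]] U(1) subgroup.subset[of U G] by (auto simp: hom_def Pi_iff subset_iff)
  have imM: "\<phi> b ` M = M" if "b \<in> B" for b
    using invariant_image_eq[OF B M(2) _ that] M(1) subgroup.subset by metis
  have actU: "\<phi> b x \<in> U" if "b \<in> B" "x \<in> U" for b x
    using that U(2) unfolding invariant_def by blast
  have im: "\<phi> b ` (M #> x) = M #> \<phi> b x" if "b \<in> B" "x \<in> U" for b x
    using S.image_coset[OF hom imM] that by blast
  define K where "K = {b \<in> B. \<forall>x\<in>U. M #> \<phi> b x = M #> x}"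
  have K: "subgroup K A"
  proof (rule A.subgroupI)
    show "K \<subseteq> carrier A"
      using BA unfolding K_def by blast
    have "\<one>\<^bsub>A\<^esub> \<in> K"
      using subgroup.one_closed[OF B] act_one S.W_carrier unfolding K_def by simp
    then show "K \<noteq> {}"
      by blast
  next
    fix b assume b: "b \<in> K"
    then have inv: "inv\<^bsub>A\<^esub> b \<in> B"
      using subgroup.m_inv_closed[OF B] unfolding K_def by simp
    have "M #> \<phi> (inv\<^bsub>A\<^esub> b) x = M #> x" if x: "x \<in> U" for x
    proof -
      have "M #> \<phi> b (\<phi> (inv\<^bsub>A\<^esub> b) x) = M #> \<phi> (inv\<^bsub>A\<^esub> b) x"
        using b actU[OF inv x] unfolding K_def by blast
      then show ?thesis
        using act_inv_cancel(1)[of b x] b x S.W_carrier BA unfolding K_def by auto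
    qed
    then show "inv\<^bsub>A\<^esub> b \<in> K"
      using inv unfolding K_def by blast
  next
    fix b c assume bc: "b \<in> K" "c \<in> K"
    then have "M #> \<phi> (b \<otimes>\<^bsub>A\<^esub> c) x = M #> x" if "x \<in> U" for x
      using that act_comp[of b c x] BA S.W_carrier actU unfolding K_def by auto
    then show "b \<otimes>\<^bsub>A\<^esub> c \<in> K"
      using bc subgroup.m_closed[OF B] unfolding K_def by simp
  qed
  \<comment> \<open>The cosets fixed by \<open>b\<close> form a subgroup that is
    \<open>B\<close>-invariant because \<open>B\<close> is commutative. It is not all of
    \<open>U/M\<close>, as \<open>b\<close> acts nontrivially, so irreducibility makes it
    trivial.\<close>
  have fixed: "x \<in> M" if b: "b \<in> B" "b \<notin> K" and x: "x \<in> U" "M #> \<phi> b x = M #> x" for b x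
  proof -
    define Y where "Y = {x \<in> U. M #> \<phi> b x = M #> x}"
    have "subgroup Y G"
    proof (rule subgroupI)
      show "Y \<subseteq> carrier G"
        using S.W_carrier unfolding Y_def by blast
      show "Y \<noteq> {}"
        using x unfolding Y_def by blast
    next
      fix y assume y: "y \<in> Y"
      then have 1: "y \<in> U" "\<phi> b y \<in> U" "inv y \<in> U" "\<phi> b (inv y) = inv (\<phi> b y)"
        "M #> \<phi> b y = M #> y"
        using actU b subgroup.m_inv_closed[OF U(1)] group_hom.hom_inv[OF act_group_hom[OF BA[OF b(1)]], of y]
          S.W_carrier unfolding Y_def by auto
      have inv: "M #> inv z = inv\<^bsub>S.Q\<^esub> (M #> z)" if "z \<in> U" for z
        using S.coset_int_pow[OF that, of "-1"] that S.W_carrier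
        by (simp add: int_pow_neg S.Q.int_pow_neg)
      show "inv y \<in> Y"
        using 1 inv unfolding Y_def by simp
    next
      fix y z assume yz: "y \<in> Y" "z \<in> Y"
      then have yzU: "y \<in> U" "z \<in> U" "M #> \<phi> b y = M #> y" "M #> \<phi> b z = M #> z"
        unfolding Y_def by auto
      have "M #> \<phi> b (y \<otimes> z) = M #> (\<phi> b y \<otimes> \<phi> b z)"
        using b yzU by (simp add: act_mult BA S.W_carrier)
      also have "\<dots> = (M #> \<phi> b y) \<otimes>\<^bsub>S.Q\<^esub> (M #> \<phi> b z)"
        using S.coset_mult[OF actU[OF b(1) yzU(1)] actU[OF b(1) yzU(2)]] by simp
      also have "\<dots> = (M #> y) \<otimes>\<^bsub>S.Q\<^esub> (M #> z)"
        by (simp only: yzU)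
      also have "\<dots> = M #> (y \<otimes> z)"
        using yzU by (simp add: S.coset_mult)
      finally show "y \<otimes> z \<in> Y"
        using yz subgroup.m_closed[OF U(1)] unfolding Y_def by simp
    qed
    moreover have "invariant B Y"
      unfolding invariant_def
    proof (intro ballI)
      fix c y assume c: "c \<in> B" and y: "y \<in> Y"
      then have yU: "y \<in> U" "\<phi> b y \<in> U" "M #> \<phi> b y = M #> y"
        using actU b unfolding Y_def by auto
      have "M #> \<phi> b (\<phi> c y) = M #> \<phi> c (\<phi> b y)"
        using act_comp[OF BA[OF b(1)] BA[OF c] S.W_carrier[OF yU(1)]]
          act_comp[OF BA[OF c] BA[OF b(1)] S.W_carrier[OF yU(1)]]
          A.m_comm[OF BA[OF b(1)] BA[OF c]] by simp
      also have "\<dots> = \<phi> c ` (M #> \<phi> b y)"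
        using im[OF c yU(2)] by simp
      also have "\<dots> = \<phi> c ` (M #> y)"
        by (simp only: yU(3))
      also have "\<dots> = M #> \<phi> c y"
        using im[OF c yU(1)] .
      finally show "\<phi> c y \<in> Y"
        using actU c yU unfolding Y_def by simp
    qed
    moreover have "M \<subseteq> Y"
    proof
      fix m assume "m \<in> M"
      then have "m \<in> M" "\<phi> b m \<in> M" "m \<in> U" "\<phi> b m \<in> U"
        using M(2) S.M_subset b unfolding invariant_def by auto
      then have "M #> \<phi> b m = M" "M #> m = M"
        using S.coset_eq_M_iff by blast+
      then show "m \<in> Y"
        using \<open>m \<in> U\<close> unfolding Y_def by simp
    qed
    moreover have "Y \<subseteq> U"
      unfolding Y_def by blast
    ultimately have "Y = M \<or> Y = U"
      using irr by blast
    moreover have "Y \<noteq> U"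
    proof
      assume "Y = U"
      then have "\<forall>x\<in>U. M #> \<phi> b x = M #> x"
        unfolding Y_def by blast
      then show False
        using b unfolding K_def by simp
    qed
    moreover have "x \<in> Y"
      using x unfolding Y_def by simp
    ultimately show ?thesis
      by simp
  qed
  have "cocyclic A p B K"
  proof (rule ccontr)
    assume ncoc: "\<not> cocyclic A p B K"
    have p0: "0 < p"
      using p_prime prime_gt_0_nat by blast
    have "B \<noteq> K"
    proof
      assume "B = K"
      then have "\<forall>y\<in>B. \<exists>i<p. y \<otimes>\<^bsub>A\<^esub> \<one>\<^bsub>A\<^esub> [^]\<^bsub>A\<^esub> i \<in> K"
        using p0 BA by auto
      then show False
        using ncoc subgroup.one_closed[OF B] unfolding cocyclic_def by blast
    qed
    then obtain a where a: "a \<in> B" "a \<notin> K"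
      unfolding K_def by blast
    \<comment> \<open>The elements \<open>a\<close> and \<open>y\<close> are independent modulo
      \<open>K\<close>; the operators they induce on \<open>U/M\<close> form the fixed-point-free
      pair.\<close>
    then obtain y where y: "y \<in> B" "\<And>i. i < p \<Longrightarrow> y \<otimes>\<^bsub>A\<^esub> a [^]\<^bsub>A\<^esub> i \<notin> K"
      using ncoc unfolding cocyclic_def by blast
    have aA: "a \<in> carrier A" and yA: "y \<in> carrier A"
      using a y BA by auto
    have powB: "a [^]\<^bsub>A\<^esub> i \<in> B" for i :: nat
      using a(1) by (induction i) (auto intro: subgroup.one_closed[OF B] subgroup.m_closed[OF B])
    have pow: "(image (\<phi> b) ^^ n) (M #> x) = M #> \<phi> (b [^]\<^bsub>A\<^esub> n) x" if "b \<in> B" "x \<in> U" for b n x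
      using S.funpow_image_coset[OF hom imM, of b x n] that actU act_pow BA S.W_carrier by auto
    have "carrier S.Q = {\<one>\<^bsub>S.Q\<^esub>}"
    proof (rule Q.trivial_of_fixed_point_free_pair[OF p_prime, of "image (\<phi> y)" "image (\<phi> a)"])
      show "image (\<phi> y) \<in> hom S.Q S.Q" "image (\<phi> a) \<in> hom S.Q S.Q"
        using S.image_hom_Q[OF hom imM] y(1) a(1) actU by auto
    next
      fix u assume "u \<in> carrier S.Q"
      then obtain x where x: "x \<in> U" "u = M #> x"
        unfolding S.carrier_Q by blast
      show "\<phi> y ` \<phi> a ` u = \<phi> a ` \<phi> y ` u"
      proof -
        have "\<phi> y (\<phi> a x) = \<phi> a (\<phi> y x)"
          using act_comp[OF aA yA S.W_carrier[OF x(1)]] act_comp[OF yA aA S.W_carrier[OF x(1)]]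
            A.m_comm[OF aA yA] by simp
        then show ?thesis
          using x im a y actU by simp
      qed
      show "(image (\<phi> y) ^^ p) u = u" "(image (\<phi> a) ^^ p) u = u"
        using x pow a y expo_A aA yA act_one S.W_carrier by auto
    next
      fix j u assume j: "j < p" and "u \<in> carrier S.Q" and fx: "\<phi> y ` (image (\<phi> a) ^^ j) u = u"
      then obtain x where x: "x \<in> U" "u = M #> x"
        unfolding S.carrier_Q by blast
      have "M #> \<phi> (y \<otimes>\<^bsub>A\<^esub> a [^]\<^bsub>A\<^esub> j) x = M #> x"
        using fx x pow[OF a(1) x(1)] im[OF y(1)] actU[OF powB x(1)] act_comp yA BA[OF powB] S.W_carrier
        by simp
      then have "x \<in> M"
        using fixed[of "y \<otimes>\<^bsub>A\<^esub> a [^]\<^bsub>A\<^esub> j" x] x y j powB subgroup.m_closed[OF B] by metis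
      then show "u = \<one>\<^bsub>S.Q\<^esub>"
        using x S.coset_eq_M_iff by simp
    next
      fix k u assume k: "0 < k" "k < p" and "u \<in> carrier S.Q" and fx: "(image (\<phi> a) ^^ k) u = u"
      then obtain x where x: "x \<in> U" "u = M #> x"
        unfolding S.carrier_Q by blast
      \<comment> \<open>As \<open>k\<close> is invertible modulo \<open>p\<close>, some power of
        \<open>a^k\<close> is \<open>a\<close> itself, which is outside \<open>K\<close>.\<close>
      have "a [^]\<^bsub>A\<^esub> k \<notin> K"
      proof
        assume ak: "a [^]\<^bsub>A\<^esub> k \<in> K"
        have "coprime k p"
          using k p_prime by (metis coprime_commute dvd_imp_le leD prime_imp_coprime)
        then obtain l where "[k * l = 1] (mod p)"
          using cong_solve_coprime_nat by auto
        then have "k * l mod p = 1"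
          using k by (simp add: cong_def)
        then obtain t where t: "k * l = p * t + 1"
          by (metis mult_div_mod_eq)
        have "(a [^]\<^bsub>A\<^esub> k) [^]\<^bsub>A\<^esub> l = (a [^]\<^bsub>A\<^esub> p) [^]\<^bsub>A\<^esub> t \<otimes>\<^bsub>A\<^esub> a"
          using aA t by (simp add: A.nat_pow_pow flip: A.nat_pow_mult)
        then have "(a [^]\<^bsub>A\<^esub> k) [^]\<^bsub>A\<^esub> l = a"
          using aA expo_A by simp
        moreover have "(a [^]\<^bsub>A\<^esub> k) [^]\<^bsub>A\<^esub> l \<in> K"
          using ak by (induction l) (auto intro: subgroup.one_closed[OF K] subgroup.m_closed[OF K])
        ultimately show False
          using a by simp
      qed
      then have "x \<in> M"
        using fixed[of "a [^]\<^bsub>A\<^esub> k" x] x fx pow[OF a(1) x(1)] powB by simp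
      then show "u = \<one>\<^bsub>S.Q\<^esub>"
        using x S.coset_eq_M_iff by simp
    qed
    then have "U \<subseteq> M"
      using S.coset_eq_M_iff S.coset_in_Q by fastforce
    then show False
      using sub by blast
  qed
  moreover have "inv x \<otimes> \<phi> b x \<in> M" if "b \<in> K" "x \<in> U" for b x
    using that actU S.coset_eq_iff'[of x "\<phi> b x"] unfolding K_def by auto
  ultimately show ?thesis
    using that K unfolding K_def by blast
qed

text \<open>Kept as a union, not as the subgroup it generates: each element comes with one
  \<open>K\<close> that fixes it, and the later estimates of orders concern that
  \<open>K\<close>.\<close>

definition cocyclic_fix :: "'c set \<Rightarrow> 'a set \<Rightarrow> 'a set" where
  "cocyclic_fix B U = \<Union> {fix_act \<phi> U K | K. subgroup K A \<and> K \<subseteq> B \<and> cocyclic A p B K}"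

lemma cocyclic_fix_mono: "U \<subseteq> V \<Longrightarrow> cocyclic_fix B U \<subseteq> cocyclic_fix B V"
  unfolding cocyclic_fix_def fix_act_def by blast

lemma generated_by_cocyclic_fix:
  assumes B: "subgroup B A" and "subgroup U G" "invariant B U"
  shows "U \<subseteq> generate G (cocyclic_fix B U)"
  using assms(2,3)
proof (induction "card U" arbitrary: U rule: less_induct)
  case less
  have UG: "U \<subseteq> carrier G"
    using less.prems subgroup.subset by blast
  have cG: "cocyclic_fix B U \<subseteq> carrier G"
    using UG unfolding cocyclic_fix_def fix_act_def by blast
  show ?case
  proof (cases "U = {\<one>}")
    case True
    then show ?thesis
      using generate.one by simp
  next
    case False
    let ?P = "\<lambda>M. subgroup M G \<and> invariant B M \<and> derived G U \<subseteq> M \<and> M \<subset> U"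
    have "derived G U \<subset> U"
      using derived_proper_of_solvable[OF solvable_G less.prems(1) False]
        derived_incl[OF order_refl less.prems(1)] by blast
    then have "?P (derived G U)"
      using invariant_derived[OF B less.prems] subgroup_derived less.prems by blast
    \<comment> \<open>A largest proper invariant subgroup above the derived subgroup makes
      \<open>U/M\<close> abelian and irreducible, which is what provides \<open>K\<close> with
      \<open>[U,K] \<le> M\<close>.\<close>
    then obtain M where M: "?P M" and max: "\<And>Y. ?P Y \<Longrightarrow> card Y \<le> card M"
      using ex_has_greatest_nat[of ?P _ card "card U"] psubset_card_mono finite_subgroup less.prems(1)
      by (metis less_or_eq_imp_le)
    have finU: "finite U"
      using finite_subgroup less.prems by blast
    obtain K where K: "subgroup K A" "K \<subseteq> B" "cocyclic A p B K"
      and KM: "\<And>b x. b \<in> K \<Longrightarrow> x \<in> U \<Longrightarrow> inv x \<otimes> \<phi> b x \<in> M"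
    proof (rule cocyclic_kernel_of_irreducible[OF B less.prems])
      fix Y assume Y: "subgroup Y G" "invariant B Y" "M \<subseteq> Y" "Y \<subseteq> U"
      show "Y = M \<or> Y = U"
      proof (rule ccontr)
        assume "\<not> (Y = M \<or> Y = U)"
        then have "card Y \<le> card M" "M \<subset> Y"
          using Y M by (auto intro!: max)
        then show False
          using Y finU by (metis finite_subset leD psubset_card_mono)
      qed
    qed (use M in auto)
    have "M \<subseteq> generate G (cocyclic_fix B M)"
      using less.hyps[of M] M finU psubset_card_mono by blast
    then have MU: "M \<subseteq> generate G (cocyclic_fix B U)"
      using mono_generate[OF cocyclic_fix_mono[of M U]] M by blast
    have "comm_act G \<phi> U K \<subseteq> M"
      unfolding comm_act_def using KM M by (intro generate_subgroup_incl) auto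
    moreover have "fix_act \<phi> U K \<subseteq> generate G (cocyclic_fix B U)"
      using K generate.incl[of _ "cocyclic_fix B U" G] unfolding cocyclic_fix_def by blast
    moreover have "\<phi> b ` U \<subseteq> U" if "b \<in> K" for b
      using that K less.prems unfolding invariant_def by blast
    ultimately have "U \<subseteq> generate G (cocyclic_fix B U) <#> generate G (cocyclic_fix B U)"
      using good[OF K(1) less.prems(1)] MU unfolding set_mult_def by blast
    then show ?thesis
      using generate.eng unfolding set_mult_def by fast
  qed
qed

end

section \<open>Chains of normal subgroups with cyclic factors\<close>

text \<open>Normality in \<open>H\<close> is phrased with the operations of \<open>G\<close>, so the
  same \<open>K\<close> can be examined inside several subgroups \<open>H\<close>.\<close>

definition normal_sub :: "('a, 'b) monoid_scheme \<Rightarrow> 'a set \<Rightarrow> 'a set \<Rightarrow> bool" where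
  "normal_sub G H K \<longleftrightarrow> subgroup K G \<and> K \<subseteq> H \<and>
    (\<forall>h\<in>H. \<forall>k\<in>K. h \<otimes>\<^bsub>G\<^esub> k \<otimes>\<^bsub>G\<^esub> inv\<^bsub>G\<^esub> h \<in> K)"

text \<open>A chain of such steps from \<open>{\<one>}\<close> to \<open>H\<close> amounts to
  supersolvability of \<open>H\<close>, and one from \<open>M\<close> to \<open>H\<close> to that of
  \<open>H/M\<close>, without forming a quotient. As a relation it lets chains be spliced by
  transitivity.\<close>

definition cyclic_step :: "('a, 'b) monoid_scheme \<Rightarrow> 'a set \<Rightarrow> 'a set \<Rightarrow> 'a set \<Rightarrow> bool" where
  "cyclic_step G H K L \<longleftrightarrow> normal_sub G H K \<and> normal_sub G H L \<and> K \<subseteq> L \<and>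
    (\<exists>t\<in>L. \<forall>x\<in>L. \<exists>n::int. \<exists>k\<in>K. x = t [^]\<^bsub>G\<^esub> n \<otimes>\<^bsub>G\<^esub> k)"

text \<open>Unlike cyclicity of a factor, this consequence of it passes to subgroups and sections
  without any argument about subgroups of cyclic groups.\<close>

definition power_step :: "('a, 'b) monoid_scheme \<Rightarrow> 'a set \<Rightarrow> 'a set \<Rightarrow> 'a set \<Rightarrow> bool" where
  "power_step G H K L \<longleftrightarrow> normal_sub G H K \<and> normal_sub G H L \<and> K \<subseteq> L \<and>
    (\<forall>h\<in>H. \<exists>c::int. \<forall>l\<in>L. h \<otimes>\<^bsub>G\<^esub> l \<otimes>\<^bsub>G\<^esub> inv\<^bsub>G\<^esub> h \<otimes>\<^bsub>G\<^esub> inv\<^bsub>G\<^esub> (l [^]\<^bsub>G\<^esub> c) \<in> K)"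

lemma (in group) section_of_normal_sub:
  "subgroup H G \<Longrightarrow> normal_sub G H K \<Longrightarrow> group_section G H K"
  unfolding normal_sub_def
  by (intro group_section.intro group_section_axioms.intro group_axioms normal_in_subgroupI) auto

lemma (in group) section_of_normal_sub':
  assumes "normal_sub G H K" "subgroup L G" "K \<subseteq> L" "L \<subseteq> H"
  shows "group_section G L K"
  using assms unfolding normal_sub_def
  by (intro group_section.intro group_section_axioms.intro group_axioms normal_in_subgroupI) auto

lemma (in group) normal_sub_iff_normal:
  assumes H: "subgroup H G"
  shows "normal_sub G H K \<longleftrightarrow> K \<lhd> G\<lparr>carrier := H\<rparr>"
proof
  assume "K \<lhd> G\<lparr>carrier := H\<rparr>"
  then interpret group_section G H K
    using H by (intro group_section.intro group_section_axioms.intro group_axioms)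
  show "normal_sub G H K"
    using M_subgroup M_subset M_conj unfolding normal_sub_def by blast
qed (use H section_of_normal_sub group_section.M_normal in blast)

context group_section
begin

lemma coset_inv: "x \<in> W \<Longrightarrow> inv\<^bsub>Q\<^esub> (M #> x) = M #> inv x"
  using coset_int_pow[of x "-1"] W_carrier by (simp add: int_pow_neg Q.int_pow_neg)

lemma W_closed: "x \<in> W \<Longrightarrow> y \<in> W \<Longrightarrow> x \<otimes> y \<in> W" "x \<in> W \<Longrightarrow> inv x \<in> W"
  using subgroup.m_closed[OF W_subgroup] subgroup.m_inv_closed[OF W_subgroup] by auto

lemma coset_conj:
  "x \<in> W \<Longrightarrow> y \<in> W \<Longrightarrow> M #> (x \<otimes> y \<otimes> inv x) = (M #> x) \<otimes>\<^bsub>Q\<^esub> (M #> y) \<otimes>\<^bsub>Q\<^esub> inv\<^bsub>Q\<^esub> (M #> x)"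
  by (simp add: coset_inv coset_mult W_closed)

lemma W_pow_closed: "x \<in> W \<Longrightarrow> x [^] (n::nat) \<in> W" "x \<in> W \<Longrightarrow> x [^] (k::int) \<in> W"
  using subgroup_int_pow_closed[OF W_subgroup, of x k] subgroup_int_pow_closed[OF W_subgroup, of x "int n"]
  by (auto simp: int_pow_int)

end

section \<open>Conjugations that act as power maps\<close>

lemma (in group) conj_int_pow:
  assumes "h \<in> carrier G" "x \<in> carrier G"
  shows "h \<otimes> x [^] (n::int) \<otimes> inv h = (h \<otimes> x \<otimes> inv h) [^] n"
proof -
  have "h \<otimes> (x \<otimes> y) \<otimes> inv h = h \<otimes> x \<otimes> inv h \<otimes> (h \<otimes> y \<otimes> inv h)"
    if "x \<in> carrier G" "y \<in> carrier G" for x y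
    using that assms(1) by (simp add: m_assoc inv_solve_left)
  then have "(\<lambda>x. h \<otimes> x \<otimes> inv h) \<in> hom G G"
    using assms(1) by (intro homI) auto
  then interpret group_hom G G "\<lambda>x. h \<otimes> x \<otimes> inv h"
    by unfold_locales
  show ?thesis
    using hom_int_pow[OF assms(2)] by simp
qed

lemma (in group) conj_eq_self_iff:
  assumes "z \<in> carrier G" "s \<in> carrier G"
  shows "z \<otimes> s \<otimes> inv z = s \<longleftrightarrow> z \<otimes> s = s \<otimes> z"
  using assms by (metis inv_solve_right' m_closed)

lemma (in group) conj_mult:
  assumes "x \<in> carrier G" "y \<in> carrier G" "s \<in> carrier G"
  shows "x \<otimes> y \<otimes> s \<otimes> inv (x \<otimes> y) = x \<otimes> (y \<otimes> s \<otimes> inv y) \<otimes> inv x"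
  using assms by (simp add: inv_mult_group m_assoc)

text \<open>Power maps commute: \<open>x y\<close> and \<open>y x\<close> both send \<open>s\<close>
  to \<open>s^(c d)\<close>. The commutator is \<open>x y\<close> times the inverse of
  \<open>y x\<close>, and closure of \<open>S\<close> under conjugation keeps the intermediate
  element in \<open>S\<close>.\<close>

lemma (in group) commutator_acts_trivially:
  assumes x: "x \<in> carrier G" and y: "y \<in> carrier G" and S: "S \<subseteq> carrier G"
    and inv: "\<And>g s. g \<in> carrier G \<Longrightarrow> s \<in> S \<Longrightarrow> g \<otimes> s \<otimes> inv g \<in> S"
    and xs: "\<And>s. s \<in> S \<Longrightarrow> x \<otimes> s \<otimes> inv x = s [^] (c::int)"
    and ys: "\<And>s. s \<in> S \<Longrightarrow> y \<otimes> s \<otimes> inv y = s [^] (d::int)"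
    and s: "s \<in> S"
  shows "(x \<otimes> y \<otimes> inv x \<otimes> inv y) \<otimes> s \<otimes> inv (x \<otimes> y \<otimes> inv x \<otimes> inv y) = s"
proof -
  have eq: "(x \<otimes> y) \<otimes> s \<otimes> inv (x \<otimes> y) = (y \<otimes> x) \<otimes> s \<otimes> inv (y \<otimes> x)" if s: "s \<in> S" for s
  proof -
    have sG: "s \<in> carrier G"
      using s S by blast
    have "(x \<otimes> y) \<otimes> s \<otimes> inv (x \<otimes> y) = x \<otimes> s [^] d \<otimes> inv x"
      using x y sG s ys by (simp add: conj_mult)
    also have "\<dots> = s [^] (c * d)"
      using x sG s xs by (simp add: conj_int_pow int_pow_pow)
    also have "\<dots> = y \<otimes> s [^] c \<otimes> inv y"
      using y sG s ys by (simp add: conj_int_pow int_pow_pow mult.commute)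
    also have "\<dots> = (y \<otimes> x) \<otimes> s \<otimes> inv (y \<otimes> x)"
      using x y sG s xs by (simp add: conj_mult)
    finally show ?thesis .
  qed
  let ?s = "inv (y \<otimes> x) \<otimes> s \<otimes> inv (inv (y \<otimes> x))"
  have sG: "s \<in> carrier G" and s': "?s \<in> S"
    using inv[of "inv (y \<otimes> x)" s] x y s S by auto
  have "x \<otimes> y \<otimes> inv x \<otimes> inv y = (x \<otimes> y) \<otimes> inv (y \<otimes> x)"
    using x y by (simp add: inv_mult_group m_assoc)
  then have "(x \<otimes> y \<otimes> inv x \<otimes> inv y) \<otimes> s \<otimes> inv (x \<otimes> y \<otimes> inv x \<otimes> inv y)
      = (x \<otimes> y) \<otimes> ?s \<otimes> inv (x \<otimes> y)"
    using x y sG conj_mult[of "x \<otimes> y" "inv (y \<otimes> x)" s] by simp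
  also have "\<dots> = (y \<otimes> x) \<otimes> ?s \<otimes> inv (y \<otimes> x)"
    using eq[OF s'] .
  also have "\<dots> = s"
    using x y sG conj_mult[of "y \<otimes> x" "inv (y \<otimes> x)" s] by simp
  finally show ?thesis .
qed

text \<open>The element \<open>x^(r-1)\<close> sends \<open>s\<close> to the power with exponent
  \<open>c^(r-1)\<close>, which is \<open>1\<close> modulo \<open>r\<close> by Fermat. If
  \<open>r\<close> divides \<open>c\<close>, then \<open>s\<close> has a trivial conjugate and is
  itself trivial.\<close>

lemma (in group) pred_power_acts_trivially:
  assumes x: "x \<in> carrier G" and s: "s \<in> carrier G" and r: "Factorial_Ring.prime (r::nat)"
    and sr: "s [^] r = \<one>" and xs: "x \<otimes> s \<otimes> inv x = s [^] (c::int)"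
  shows "x [^] (r - 1) \<otimes> s \<otimes> inv (x [^] (r - 1)) = s"
proof (cases "int r dvd c")
  case True
  then obtain t where "c = int r * t"
    by (elim dvdE)
  then have "x \<otimes> s \<otimes> inv x = \<one>"
    using xs s sr int_pow_pow[of s "int r" t] by (simp add: int_pow_int)
  then have "s = \<one>"
    using x s by (metis conj_eq_self_iff inv_solve_right' l_cancel_one m_closed one_closed l_one r_cancel)
  then show ?thesis
    using x by simp
next
  case False
  have pow: "x [^] n \<otimes> s \<otimes> inv (x [^] n) = s [^] (c ^ n)" for n :: nat
  proof (induction n)
    case (Suc n)
    have "x [^] Suc n \<otimes> s \<otimes> inv (x [^] Suc n) = x \<otimes> s [^] (c ^ n) \<otimes> inv x"
      using x s Suc conj_mult[of x "x [^] n" s] nat_pow_Suc2[of x n] by simp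
    then show ?case
      using x s xs by (simp add: conj_int_pow int_pow_pow)
  qed (use s in auto)
  have "[c ^ (r - 1) = 1] (mod int r)"
  proof -
    have r0: "r > 0"
      using r prime_gt_0_nat by blast
    define d where "d = nat (c mod int r)"
    have d: "int d = c mod int r"
      using r0 by (simp add: d_def)
    have "\<not> r dvd d"
      using False d by (metis dvd_mod_iff int_dvd_int_iff dvd_refl)
    then have "[d ^ (r - 1) = 1] (mod r)"
      using r fermat_theorem by blast
    then have "[int d ^ (r - 1) = 1] (mod int r)"
      by (metis cong_int_iff of_nat_1 of_nat_power)
    moreover have "[c ^ (r - 1) = int d ^ (r - 1)] (mod int r)"
      unfolding d by (intro cong_pow) (simp add: cong_def)
    ultimately show ?thesis
      using cong_trans by blast
  qed
  then obtain t where t: "c ^ (r - 1) = 1 + int r * t"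
    by (metis cong_iff_lin cong_sym add.commute mult.commute)
  have "s [^] (1 + int r * t) = s"
    using s sr by (simp add: int_pow_mult int_pow_int flip: int_pow_pow)
  then show ?thesis
    using pow[of "r - 1"] t by simp
qed

text \<open>The exponent \<open>c\<close> read off at a generator \<open>t\<close> works for every
  \<open>l\<close>, because \<open>l\<close> is a power of \<open>t\<close> modulo
  \<open>K\<close>.\<close>

lemma (in group) cyclic_imp_power_step:
  assumes H: "subgroup H G" and step: "cyclic_step G H K L"
  shows "power_step G H K L"
proof -
  interpret S: group_section G H K
    using step H section_of_normal_sub unfolding cyclic_step_def by blast
  have L: "normal_sub G H L" and LH: "L \<subseteq> H"
    using step unfolding cyclic_step_def normal_sub_def by auto
  obtain t where t: "t \<in> L" and gen: "\<And>x. x \<in> L \<Longrightarrow> \<exists>n::int. \<exists>k\<in>K. x = t [^] n \<otimes> k"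
    using step unfolding cyclic_step_def by blast
  have tH: "t \<in> H"
    using t LH by blast
  have pow: "\<exists>n::int. K #> x = (K #> t) [^]\<^bsub>S.Q\<^esub> n" if x: "x \<in> L" for x
  proof -
    obtain n :: int and k where k: "k \<in> K" "x = t [^] n \<otimes> k"
      using gen[OF x] by blast
    have "K #> x = (K #> (t [^] n)) \<otimes>\<^bsub>S.Q\<^esub> (K #> k)"
      using k S.M_subset tH by (simp add: S.coset_mult S.W_pow_closed subset_iff)
    also have "K #> k = \<one>\<^bsub>S.Q\<^esub>"
      using S.coset_eq_M_iff[of k] k S.M_subset by auto
    finally show ?thesis
      using tH by (auto simp: S.coset_int_pow S.W_pow_closed simp del: one_FactGroup)
  qed
  have "\<exists>c::int. \<forall>l\<in>L. h \<otimes> l \<otimes> inv h \<otimes> inv (l [^] c) \<in> K" if h: "h \<in> H" for h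
  proof -
    have "h \<otimes> t \<otimes> inv h \<in> L"
      using L h t unfolding normal_sub_def by blast
    then obtain c :: int where c: "K #> (h \<otimes> t \<otimes> inv h) = (K #> t) [^]\<^bsub>S.Q\<^esub> c"
      using pow by blast
    have "h \<otimes> l \<otimes> inv h \<otimes> inv (l [^] c) \<in> K" if l: "l \<in> L" for l
    proof -
      have lH: "l \<in> H" and conj: "h \<otimes> l \<otimes> inv h \<in> H"
        using l LH h by (auto simp: S.W_closed)
      obtain n :: int where n: "K #> l = (K #> t) [^]\<^bsub>S.Q\<^esub> n"
        using pow l by blast
      have "K #> (h \<otimes> l \<otimes> inv h) = (K #> h) \<otimes>\<^bsub>S.Q\<^esub> (K #> t) [^]\<^bsub>S.Q\<^esub> n \<otimes>\<^bsub>S.Q\<^esub> inv\<^bsub>S.Q\<^esub> (K #> h)"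
        using h lH by (simp add: S.coset_conj n)
      also have "\<dots> = (K #> (h \<otimes> t \<otimes> inv h)) [^]\<^bsub>S.Q\<^esub> n"
        using h tH by (simp add: S.Q.conj_int_pow S.coset_conj)
      also have "\<dots> = (K #> l) [^]\<^bsub>S.Q\<^esub> c"
        using tH by (simp add: c n S.Q.int_pow_pow mult.commute)
      also have "\<dots> = K #> (l [^] c)"
        using lH by (rule S.coset_int_pow)
      finally show ?thesis
        using conj lH by (simp add: S.coset_eq_iff S.W_pow_closed)
    qed
    then show ?thesis
      by blast
  qed
  then show ?thesis
    using step unfolding cyclic_step_def power_step_def by blast
qed

section \<open>Indexed normal series and chains of cyclic steps\<close>

lemma (in group) supersolvable_imp_cyclic_chain:
  assumes H: "subgroup H G" and ss: "supersolvable (G\<lparr>carrier := H\<rparr>)"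
  shows "(cyclic_step G H)\<^sup>*\<^sup>* {\<one>} H"
proof -
  obtain n :: nat and N where N0: "N 0 = {\<one>}" and Nn: "N n = H"
    and nor: "\<And>i. i \<le> n \<Longrightarrow> N i \<lhd> G\<lparr>carrier := H\<rparr>"
    and sub: "\<And>i. i < n \<Longrightarrow> N i \<subseteq> N (Suc i)"
    and cyc: "\<And>i. i < n \<Longrightarrow> cyclic_group (G\<lparr>carrier := N (Suc i)\<rparr> Mod N i)"
    using ss unfolding supersolvable_def by auto
  have "cyclic_step G H (N i) (N (Suc i))" if i: "i < n" for i
  proof -
    have ns: "normal_sub G H (N i)" "normal_sub G H (N (Suc i))"
      using nor i normal_sub_iff_normal[OF H] by auto
    then interpret S: group_section G "N (Suc i)" "N i"
      using sub i by (intro section_of_normal_sub'[of H]) (auto simp: normal_sub_def)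
    obtain q where "q \<in> carrier S.Q" and q: "carrier S.Q = range (\<lambda>n::int. q [^]\<^bsub>S.Q\<^esub> n)"
      using cyc[OF i] S.Q.cyclic_group by blast
    then obtain t where t: "t \<in> N (Suc i)" "q = N i #> t"
      unfolding S.carrier_Q by blast
    have "\<exists>m::int. \<exists>k\<in>N i. x = t [^] m \<otimes> k" if x: "x \<in> N (Suc i)" for x
    proof -
      obtain m :: int where "N i #> x = q [^]\<^bsub>S.Q\<^esub> m"
        using q S.coset_in_Q[OF x] by auto
      then have "N i #> (t [^] m) = N i #> x"
        using t by (simp add: S.coset_int_pow)
      then have "inv (t [^] m) \<otimes> x \<in> N i"
        using t x by (simp add: S.coset_eq_iff' S.W_pow_closed)
      moreover have "x = t [^] m \<otimes> (inv (t [^] m) \<otimes> x)"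
        using t x S.W_carrier by (simp flip: m_assoc)
      ultimately show ?thesis
        by blast
    qed
    then show ?thesis
      using ns sub[OF i] t unfolding cyclic_step_def by blast
  qed
  then have "(cyclic_step G H ^^ n) (N 0) (N n)"
    unfolding relpowp_fun_conv by blast
  then show ?thesis
    using N0 Nn relpowp_imp_rtranclp by metis
qed

lemma (in group) cyclic_chain_imp_supersolvable:
  assumes "(cyclic_step G (carrier G))\<^sup>*\<^sup>* {\<one>} (carrier G)"
  shows "supersolvable G"
proof -
  obtain n where "(cyclic_step G (carrier G) ^^ n) {\<one>} (carrier G)"
    using assms rtranclp_imp_relpowp by fast
  then obtain N where N0: "N 0 = {\<one>}" and Nn: "N n = carrier G"
    and step: "\<And>i. i < n \<Longrightarrow> cyclic_step G (carrier G) (N i) (N (Suc i))"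
    unfolding relpowp_fun_conv by blast
  have nor: "N i \<lhd> G" if "i \<le> n" for i
  proof (cases "i = n")
    case True
    then show ?thesis
      using Nn normal_self by simp
  next
    case False
    then have "normal_sub G (carrier G) (N i)"
      using step that unfolding cyclic_step_def by simp
    then show ?thesis
      using normal_sub_iff_normal[OF subgroup_self] by simp
  qed
  have cyc: "cyclic_group (G\<lparr>carrier := N (Suc i)\<rparr> Mod N i)" if i: "i < n" for i
  proof -
    interpret S: group_section G "N (Suc i)" "N i"
      using step[OF i] by (intro section_of_normal_sub'[of "carrier G"])
        (auto simp: cyclic_step_def normal_sub_def)
    obtain t where t: "t \<in> N (Suc i)"
      and gen: "\<And>x. x \<in> N (Suc i) \<Longrightarrow> \<exists>n::int. \<exists>k\<in>N i. x = t [^] n \<otimes> k"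
      using step[OF i] unfolding cyclic_step_def by blast
    have "q \<in> range (\<lambda>n::int. (N i #> t) [^]\<^bsub>S.Q\<^esub> n)" if q: "q \<in> carrier S.Q" for q
    proof -
      obtain x where x: "x \<in> N (Suc i)" "q = N i #> x"
        using q unfolding S.carrier_Q by blast
      obtain m :: int and k where k: "k \<in> N i" "x = t [^] m \<otimes> k"
        using gen[OF x(1)] by blast
      have "inv (t [^] m) \<otimes> x = k"
        using k t S.W_carrier S.M_subset by (auto simp: subset_iff simp flip: m_assoc)
      then have "N i #> (t [^] m) = N i #> x"
        using t x k by (simp add: S.coset_eq_iff' S.W_pow_closed)
      then show ?thesis
        using x t by (auto simp: S.coset_int_pow)
    qed
    then show ?thesis
      unfolding S.Q.cyclic_group using t by (intro bexI[of _ "N i #> t"]) auto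
  qed
  show ?thesis
    unfolding supersolvable_def
  proof (intro exI conjI allI impI)
    show "N i \<subseteq> N (Suc i)" if "i < n" for i
      using step[OF that] unfolding cyclic_step_def by blast
  qed (fact N0, fact Nn, erule nor, erule cyc)
qed

section \<open>Elements acting along a chain of power steps\<close>

context group
begin

lemma normal_subD:
  assumes "normal_sub G H K"
  shows "subgroup K G" "K \<subseteq> H" "h \<in> H \<Longrightarrow> k \<in> K \<Longrightarrow> h \<otimes> k \<otimes> inv h \<in> K"
  using assms unfolding normal_sub_def by blast+

lemma cyclic_chain_normal:
  assumes "normal_sub G H M" "(cyclic_step G H)\<^sup>*\<^sup>* M W"
  shows "normal_sub G H W \<and> M \<subseteq> W"
  using assms(2,1) by (induction rule: rtranclp_induct) (auto simp: cyclic_step_def)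

text \<open>The two induced power maps commute on \<open>L/K\<close>. The acting group is the whole
  \<open>carrier G\<close>, since in the application a quotient of a subgroup takes the place of
  \<open>G\<close>.\<close>

lemma power_step_commutator:
  assumes step: "power_step G (carrier G) K L" and x: "x \<in> carrier G" and y: "y \<in> carrier G"
    and l: "l \<in> L"
  shows "(x \<otimes> y \<otimes> inv x \<otimes> inv y) \<otimes> l \<otimes> inv (x \<otimes> y \<otimes> inv x \<otimes> inv y) \<otimes> inv l \<in> K"
proof -
  have K: "normal_sub G (carrier G) K" and L: "normal_sub G (carrier G) L"
    using step unfolding power_step_def by auto
  interpret S: group_section G "carrier G" K
    using K subgroup_self section_of_normal_sub by blast
  have LG: "l \<in> carrier G" if "l \<in> L" for l
    using that normal_subD(2)[OF L] by blast
  have act: "\<exists>c::int. \<forall>s\<in>(#>) K ` L. (K #> g) \<otimes>\<^bsub>S.Q\<^esub> s \<otimes>\<^bsub>S.Q\<^esub> inv\<^bsub>S.Q\<^esub> (K #> g) = s [^]\<^bsub>S.Q\<^esub> c"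
    if g: "g \<in> carrier G" for g
  proof -
    obtain c :: int where c: "\<And>l. l \<in> L \<Longrightarrow> g \<otimes> l \<otimes> inv g \<otimes> inv (l [^] c) \<in> K"
      using step g unfolding power_step_def by blast
    have "(K #> g) \<otimes>\<^bsub>S.Q\<^esub> (K #> l) \<otimes>\<^bsub>S.Q\<^esub> inv\<^bsub>S.Q\<^esub> (K #> g) = (K #> l) [^]\<^bsub>S.Q\<^esub> c" if l: "l \<in> L" for l
    proof -
      have "K #> (g \<otimes> l \<otimes> inv g) = K #> (l [^] c)"
        using c[OF l] g LG[OF l] by (simp add: S.coset_eq_iff)
      then show ?thesis
        using g LG[OF l] S.coset_conj[of g l] S.coset_int_pow[of l c] by simp
    qed
    then show ?thesis
      by blast
  qed
  obtain c :: int where c: "\<And>s. s \<in> (#>) K ` L \<Longrightarrow>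
      (K #> x) \<otimes>\<^bsub>S.Q\<^esub> s \<otimes>\<^bsub>S.Q\<^esub> inv\<^bsub>S.Q\<^esub> (K #> x) = s [^]\<^bsub>S.Q\<^esub> c"
    using act[OF x] by blast
  obtain d :: int where d: "\<And>s. s \<in> (#>) K ` L \<Longrightarrow>
      (K #> y) \<otimes>\<^bsub>S.Q\<^esub> s \<otimes>\<^bsub>S.Q\<^esub> inv\<^bsub>S.Q\<^esub> (K #> y) = s [^]\<^bsub>S.Q\<^esub> d"
    using act[OF y] by blast
  have inv: "g \<otimes>\<^bsub>S.Q\<^esub> s \<otimes>\<^bsub>S.Q\<^esub> inv\<^bsub>S.Q\<^esub> g \<in> (#>) K ` L" if "g \<in> carrier S.Q" "s \<in> (#>) K ` L" for g s
  proof -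
    obtain h l where "h \<in> carrier G" "l \<in> L" "g = K #> h" "s = K #> l"
      using \<open>g \<in> carrier S.Q\<close> \<open>s \<in> (#>) K ` L\<close> unfolding S.carrier_Q by blast
    then show ?thesis
      using S.coset_conj[of h l] LG normal_subD(3)[OF L, of h l] by (metis imageI)
  qed
  let ?z = "x \<otimes> y \<otimes> inv x \<otimes> inv y"
  have z: "?z \<in> carrier G"
    using x y by simp
  have pz: "K #> ?z = (K #> x) \<otimes>\<^bsub>S.Q\<^esub> (K #> y) \<otimes>\<^bsub>S.Q\<^esub> inv\<^bsub>S.Q\<^esub> (K #> x) \<otimes>\<^bsub>S.Q\<^esub> inv\<^bsub>S.Q\<^esub> (K #> y)"
    using x y S.coset_inv[of x] S.coset_inv[of y] S.coset_mult[of x y]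
      S.coset_mult[of "x \<otimes> y" "inv x"] S.coset_mult[of "x \<otimes> y \<otimes> inv x" "inv y"] by simp
  have "(#>) K ` L \<subseteq> carrier S.Q"
    using S.coset_in_Q LG by blast
  then have "(K #> ?z) \<otimes>\<^bsub>S.Q\<^esub> (K #> l) \<otimes>\<^bsub>S.Q\<^esub> inv\<^bsub>S.Q\<^esub> (K #> ?z) = K #> l"
    unfolding pz
    using S.Q.commutator_acts_trivially[OF S.coset_in_Q[OF x] S.coset_in_Q[OF y] _ inv c d] l by blast
  then have "K #> (?z \<otimes> l \<otimes> inv ?z) = K #> l"
    using S.coset_conj[OF z LG[OF l]] by simp
  then show ?thesis
    using S.coset_eq_iff[of "?z \<otimes> l \<otimes> inv ?z" l] z LG[OF l] by simp
qed

lemma power_step_pred_power: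
  assumes step: "power_step G (carrier G) K L" and x: "x \<in> carrier G"
    and r: "Factorial_Ring.prime (r::nat)" and l: "l \<in> L" "l [^] r = \<one>"
  shows "x [^] (r - 1) \<otimes> l \<otimes> inv (x [^] (r - 1)) \<otimes> inv l \<in> K"
proof -
  have K: "normal_sub G (carrier G) K" and L: "normal_sub G (carrier G) L"
    using step unfolding power_step_def by auto
  interpret S: group_section G "carrier G" K
    using K subgroup_self section_of_normal_sub by blast
  have lG: "l \<in> carrier G"
    using l(1) normal_subD(2)[OF L] by blast
  obtain c :: int where "x \<otimes> l \<otimes> inv x \<otimes> inv (l [^] c) \<in> K"
    using step x l(1) unfolding power_step_def by blast
  then have "K #> (x \<otimes> l \<otimes> inv x) = K #> (l [^] c)"
    using x lG by (simp add: S.coset_eq_iff)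
  then have act: "(K #> x) \<otimes>\<^bsub>S.Q\<^esub> (K #> l) \<otimes>\<^bsub>S.Q\<^esub> inv\<^bsub>S.Q\<^esub> (K #> x) = (K #> l) [^]\<^bsub>S.Q\<^esub> c"
    using x lG S.coset_conj[of x l] S.coset_int_pow[of l c] by simp
  have "(K #> l) [^]\<^bsub>S.Q\<^esub> r = K #> \<one>"
    using lG l(2) S.coset_pow[of l r] by simp
  then have "(K #> l) [^]\<^bsub>S.Q\<^esub> r = \<one>\<^bsub>S.Q\<^esub>"
    using S.coset_eq_M_iff[of \<one>] subgroup.one_closed[OF S.M_subgroup] by simp
  then have "(K #> x) [^]\<^bsub>S.Q\<^esub> (r - 1) \<otimes>\<^bsub>S.Q\<^esub> (K #> l) \<otimes>\<^bsub>S.Q\<^esub> inv\<^bsub>S.Q\<^esub> ((K #> x) [^]\<^bsub>S.Q\<^esub> (r - 1)) = K #> l"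
    using S.Q.pred_power_acts_trivially[OF S.coset_in_Q[OF x] S.coset_in_Q[OF lG] r _ act] by blast
  then have "K #> (x [^] (r - 1) \<otimes> l \<otimes> inv (x [^] (r - 1))) = K #> l"
    using x lG S.coset_pow[of x "r - 1"] S.coset_conj[of "x [^] (r - 1)" l] by simp
  then show ?thesis
    using x lG by (simp add: S.coset_eq_iff)
qed

text \<open>The commutator \<open>u\<close> of \<open>z\<close> and \<open>l\<close> lies in
  \<open>K\<close> and commutes with \<open>z\<close>, so \<open>z^n l = u^n l z^n\<close> by
  induction; at \<open>n = r\<close> the factor \<open>u^n\<close> disappears.\<close>

lemma stabilizer_power_centralizes:
  assumes step: "\<And>l. l \<in> L \<Longrightarrow> z \<otimes> l \<otimes> inv z \<otimes> inv l \<in> K"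
    and z: "z \<in> carrier G" and K: "subgroup K G" and L: "L \<subseteq> carrier G" "K \<subseteq> L"
    and expo: "\<And>l. l \<in> K \<Longrightarrow> l [^] (r::nat) = \<one>"
    and cent: "\<And>l. l \<in> K \<Longrightarrow> z \<otimes> l = l \<otimes> z"
    and l: "l \<in> L"
  shows "z [^] r \<otimes> l = l \<otimes> z [^] r"
proof -
  define u where "u = z \<otimes> l \<otimes> inv z \<otimes> inv l"
  have u: "u \<in> K" "u \<in> carrier G" "l \<in> carrier G"
    using step[OF l] K l L subgroup.mem_carrier unfolding u_def by auto
  have zl: "z \<otimes> l = u \<otimes> l \<otimes> z"
    using z u unfolding u_def by (simp add: m_assoc)
  have zu: "z \<otimes> u [^] n = u [^] n \<otimes> z" for n :: nat
  proof (induction n)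
    case (Suc n)
    then show ?case
      using z u cent[OF u(1)] by (simp add: m_assoc flip: m_assoc[of z])
  qed (use z in simp)
  have "z [^] n \<otimes> l = u [^] n \<otimes> l \<otimes> z [^] n" for n :: nat
  proof (induction n)
    case (Suc n)
    have "z [^] Suc n \<otimes> l = z \<otimes> (z [^] n \<otimes> l)"
      using z u nat_pow_Suc2[of z n] by (simp add: m_assoc)
    also have "\<dots> = (z \<otimes> u [^] n) \<otimes> l \<otimes> z [^] n"
      using z u by (simp add: Suc m_assoc)
    also have "\<dots> = u [^] n \<otimes> (z \<otimes> l) \<otimes> z [^] n"
      using z u by (simp add: zu m_assoc)
    also have "\<dots> = u [^] Suc n \<otimes> l \<otimes> (z \<otimes> z [^] n)"
      using z u by (simp add: zl m_assoc)
    also have "z \<otimes> z [^] n = z [^] Suc n"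
      using z nat_pow_Suc2[of z n] by simp
    finally show ?case .
  qed (use z u in simp)
  from this[of r] show ?thesis
    using expo u z by simp
qed

text \<open>Each step of the chain costs one factor \<open>r\<close>: if \<open>z^(r^k)\<close>
  centralizes \<open>K\<close> and acts trivially on \<open>L/K\<close>, then its
  \<open>r\<close>-th power centralizes \<open>L\<close>. Trivial action on the factors is left
  abstract to serve both commutators and \<open>(r-1)\<close>-th powers; the latter call for the
  restriction to \<open>l^r = 1\<close>.\<close>

lemma chain_power_centralizes:
  assumes chain: "(power_step G (carrier G))\<^sup>*\<^sup>* {\<one>} T" and z: "z \<in> carrier G"
    and step: "\<And>K L l. power_step G (carrier G) K L \<Longrightarrow> l \<in> L \<Longrightarrow> l [^] (r::nat) = \<one> \<Longrightarrow>
      z \<otimes> l \<otimes> inv z \<otimes> inv l \<in> K"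
    and expo: "\<And>t. t \<in> T \<Longrightarrow> t [^] r = \<one>"
  shows "\<exists>k. \<forall>t\<in>T. z [^] (r ^ k) \<otimes> t = t \<otimes> z [^] (r ^ k)"
  using chain expo
proof (induction rule: rtranclp_induct)
  case base
  then show ?case
    using z by simp
next
  case (step K L)
  have K: "subgroup K G" and L: "subgroup L G" "K \<subseteq> L"
    using step.hyps(2) normal_subD(1) unfolding power_step_def by auto
  obtain k where k: "\<And>t. t \<in> K \<Longrightarrow> z [^] (r ^ k) \<otimes> t = t \<otimes> z [^] (r ^ k)"
    using step.IH step.prems L by blast
  have LG: "l \<in> carrier G" if "l \<in> L" for l
    using that subgroup.mem_carrier[OF L(1)] by blast
  have cancel: "a \<otimes> inv m \<otimes> (m \<otimes> b) = a \<otimes> b"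
    if "a \<in> carrier G" "m \<in> carrier G" "b \<in> carrier G" for a m b
    using that by (metis inv_closed l_inv l_one m_assoc m_closed)
  have conj: "z \<otimes> l \<otimes> inv z \<in> L" if "l \<in> L" for l
    using step.hyps(2) z that unfolding power_step_def normal_sub_def by blast
  \<comment> \<open>Trivial action on \<open>L/K\<close> is needed for the power
    \<open>z^(r^k)\<close>, not only for \<open>z\<close>.\<close>
  have "z [^] n \<otimes> l \<otimes> inv (z [^] n) \<otimes> inv l \<in> K \<and> z [^] n \<otimes> l \<otimes> inv (z [^] n) \<in> L"
    if "l \<in> L" for n :: nat and l
  proof (induction n)
    case 0
    then show ?case
      using LG[OF that] that subgroup.one_closed[OF K] by simp
  next
    case (Suc n)
    let ?m = "z [^] n \<otimes> l \<otimes> inv (z [^] n)"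
    have eq: "z [^] Suc n \<otimes> l \<otimes> inv (z [^] Suc n) = z \<otimes> ?m \<otimes> inv z"
      using z LG[OF that] conj_mult[of z "z [^] n" l] nat_pow_Suc2[of z n] by simp
    have "z \<otimes> ?m \<otimes> inv z \<otimes> inv ?m \<in> K"
      using assms(3)[OF step.hyps(2), of ?m] Suc step.prems by blast
    then have "(z \<otimes> ?m \<otimes> inv z \<otimes> inv ?m) \<otimes> (?m \<otimes> inv l) \<in> K"
      using Suc subgroup.m_closed[OF K] by blast
    moreover have "(z \<otimes> ?m \<otimes> inv z \<otimes> inv ?m) \<otimes> (?m \<otimes> inv l) = z \<otimes> ?m \<otimes> inv z \<otimes> inv l"
      by (rule cancel) (use z LG[OF that] in auto)
    ultimately have "z \<otimes> ?m \<otimes> inv z \<otimes> inv l \<in> K"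
      by simp
    then show ?case
      unfolding eq using conj Suc by blast
  qed
  note stab = this
  have "(z [^] (r ^ k)) [^] r \<otimes> l = l \<otimes> (z [^] (r ^ k)) [^] r" if "l \<in> L" for l
  proof (rule stabilizer_power_centralizes[where K = K and L = L, OF _ _ K _ L(2) _ k that])
    show "l [^] r = \<one>" if "l \<in> K" for l
      using step.prems L(2) that by blast
    show "L \<subseteq> carrier G"
      using LG by blast
  qed (use that z stab in auto)
  then have "z [^] (r ^ Suc k) \<otimes> l = l \<otimes> z [^] (r ^ Suc k)" if "l \<in> L" for l
    using that z by (simp add: nat_pow_pow mult.commute)
  then show ?case
    by blast
qed

text \<open>In the first nontrivial term of the chain the group acts by genuine powers, with nothing
  left to factor out, and Fermat applies to any of its nontrivial elements.\<close>

lemma chain_centralized_element: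
  assumes chain: "(power_step G (carrier G))\<^sup>*\<^sup>* {\<one>} T" and r: "Factorial_Ring.prime (r::nat)"
    and expo: "\<And>t. t \<in> T \<Longrightarrow> t [^] r = \<one>" and "T \<noteq> {\<one>}"
  shows "\<exists>t\<in>T. t \<noteq> \<one> \<and> (\<forall>x\<in>carrier G. x [^] (r - 1) \<otimes> t = t \<otimes> x [^] (r - 1))"
  using chain expo \<open>T \<noteq> {\<one>}\<close>
proof (induction rule: rtranclp_induct)
  case (step K L)
  have K: "subgroup K G" and L: "subgroup L G" "K \<subseteq> L"
    using step.hyps(2) normal_subD(1) unfolding power_step_def by auto
  show ?case
  proof (cases "K = {\<one>}")
    case True
    have "\<one> \<in> L"
      using subgroup.one_closed[OF L(1)] .
    then obtain t where t: "t \<in> L" "t \<noteq> \<one>"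
      using step.prems(2) by blast
    have tG: "t \<in> carrier G"
      using t subgroup.mem_carrier[OF L(1)] by blast
    have "x [^] (r - 1) \<otimes> t = t \<otimes> x [^] (r - 1)" if x: "x \<in> carrier G" for x
    proof -
      have "x [^] (r - 1) \<otimes> t \<otimes> inv (x [^] (r - 1)) \<otimes> inv t = \<one>"
        using power_step_pred_power[OF step.hyps(2) x r t(1) step.prems(1)[OF t(1)]] True by simp
      then have "x [^] (r - 1) \<otimes> t \<otimes> inv (x [^] (r - 1)) = t"
        using x tG inv_solve_right[of \<one> "x [^] (r - 1) \<otimes> t \<otimes> inv (x [^] (r - 1))" t] by simp
      then show ?thesis
        using x tG by (simp add: conj_eq_self_iff)
    qed
    then show ?thesis
      using t by blast
  next
    case False
    then show ?thesis
      using step.IH step.prems L by blast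
  qed
qed simp

text \<open>Intersect the chain with \<open>N\<close> and reduce modulo \<open>M\<close>. Power
  steps survive both operations, because the exponent belonging to a conjugating element stays the
  same.\<close>

lemma section_power_chain:
  assumes chain: "(power_step G V)\<^sup>*\<^sup>* {\<one>} V" and Y: "subgroup Y G" "Y \<subseteq> V"
    and M: "normal_sub G Y M" and N: "normal_sub G Y N"
  shows "(power_step (G\<lparr>carrier := Y\<rparr> Mod M) (carrier (G\<lparr>carrier := Y\<rparr> Mod M)))\<^sup>*\<^sup>*
    {\<one>\<^bsub>G\<lparr>carrier := Y\<rparr> Mod M\<^esub>} ((#>) M ` N)"
proof -
  interpret S: group_section G Y M
    using Y(1) M section_of_normal_sub by blast
  interpret \<pi>: group_hom "G\<lparr>carrier := Y\<rparr>" S.Q "(#>) M"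
    by (intro group_hom.intro group_hom_axioms.intro S.Q.group_axioms subgroup_imp_group Y(1) homI)
      (auto simp: S.coset_mult)
  let ?R = "power_step S.Q (carrier S.Q)"
  have nor: "normal_sub S.Q (carrier S.Q) ((#>) M ` (N \<inter> K))" if K: "normal_sub G V K" for K
    unfolding normal_sub_def
  proof (intro conjI ballI)
    have "subgroup (N \<inter> K) (G\<lparr>carrier := Y\<rparr>)"
      using subgroups_Inter_pair normal_subD[OF K] normal_subD[OF N] Y(1)
      by (intro subgroup_incl) auto
    then show "subgroup ((#>) M ` (N \<inter> K)) S.Q"
      by (rule \<pi>.subgroup_img_is_subgroup)
    show "(#>) M ` (N \<inter> K) \<subseteq> carrier S.Q"
      using normal_subD(2)[OF N] by auto
    fix q s assume "q \<in> carrier S.Q" "s \<in> (#>) M ` (N \<inter> K)"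
    then obtain y n where yn: "y \<in> Y" "n \<in> N" "n \<in> K" "q = M #> y" "s = M #> n"
      unfolding S.carrier_Q by blast
    then have "y \<otimes> n \<otimes> inv y \<in> N \<inter> K"
      using normal_subD(3)[OF K, of y n] normal_subD(3)[OF N, of y n] Y(2) by blast
    then show "q \<otimes>\<^bsub>S.Q\<^esub> s \<otimes>\<^bsub>S.Q\<^esub> inv\<^bsub>S.Q\<^esub> q \<in> (#>) M ` (N \<inter> K)"
      using yn S.coset_conj[of y n] normal_subD(2)[OF N] by (metis imageI subsetD)
  qed
  have step: "?R ((#>) M ` (N \<inter> K)) ((#>) M ` (N \<inter> L))" if KL: "power_step G V K L" for K L
    unfolding power_step_def
  proof (intro conjI ballI)
    show "normal_sub S.Q (carrier S.Q) ((#>) M ` (N \<inter> K))" "normal_sub S.Q (carrier S.Q) ((#>) M ` (N \<inter> L))"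
      using KL nor unfolding power_step_def by auto
    show "(#>) M ` (N \<inter> K) \<subseteq> (#>) M ` (N \<inter> L)"
      using KL unfolding power_step_def by blast
    fix q assume "q \<in> carrier S.Q"
    then obtain y where y: "y \<in> Y" "q = M #> y"
      unfolding S.carrier_Q by blast
    obtain c :: int where c: "\<And>l. l \<in> L \<Longrightarrow> y \<otimes> l \<otimes> inv y \<otimes> inv (l [^] c) \<in> K"
      using KL y Y(2) unfolding power_step_def by blast
    have "q \<otimes>\<^bsub>S.Q\<^esub> s \<otimes>\<^bsub>S.Q\<^esub> inv\<^bsub>S.Q\<^esub> q \<otimes>\<^bsub>S.Q\<^esub> inv\<^bsub>S.Q\<^esub> (s [^]\<^bsub>S.Q\<^esub> c) \<in> (#>) M ` (N \<inter> K)"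
      if s: "s \<in> (#>) M ` (N \<inter> L)" for s
    proof -
      obtain l where l: "l \<in> N" "l \<in> L" "s = M #> l"
        using s by blast
      have lY: "l \<in> Y"
        using l normal_subD(2)[OF N] by blast
      have "inv (l [^] c) \<in> N"
        using subgroup_int_pow_closed[OF normal_subD(1)[OF N] l(1)]
          subgroup.m_inv_closed[OF normal_subD(1)[OF N]] by blast
      then have "y \<otimes> l \<otimes> inv y \<otimes> inv (l [^] c) \<in> N"
        using normal_subD(3)[OF N y(1) l(1)] subgroup.m_closed[OF normal_subD(1)[OF N]] by blast
      moreover have "M #> (y \<otimes> l \<otimes> inv y \<otimes> inv (l [^] c))
          = q \<otimes>\<^bsub>S.Q\<^esub> s \<otimes>\<^bsub>S.Q\<^esub> inv\<^bsub>S.Q\<^esub> q \<otimes>\<^bsub>S.Q\<^esub> inv\<^bsub>S.Q\<^esub> (s [^]\<^bsub>S.Q\<^esub> c)"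
        using y l lY
        by (simp add: S.coset_inv S.coset_mult S.coset_int_pow S.W_closed S.W_pow_closed)
      ultimately show ?thesis
        using c[OF l(2)] by (metis IntI imageI)
    qed
    then show "\<exists>c::int. \<forall>s\<in>(#>) M ` (N \<inter> L).
        q \<otimes>\<^bsub>S.Q\<^esub> s \<otimes>\<^bsub>S.Q\<^esub> inv\<^bsub>S.Q\<^esub> q \<otimes>\<^bsub>S.Q\<^esub> inv\<^bsub>S.Q\<^esub> (s [^]\<^bsub>S.Q\<^esub> c) \<in> (#>) M ` (N \<inter> K)"
      by blast
  qed
  have "?R\<^sup>*\<^sup>* {\<one>\<^bsub>S.Q\<^esub>} ((#>) M ` (N \<inter> T))" if "(power_step G V)\<^sup>*\<^sup>* {\<one>} T" for T
    using that
  proof (induction rule: rtranclp_induct)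
    case base
    have "M #> \<one> = \<one>\<^bsub>S.Q\<^esub>"
      using subgroup.one_closed[OF S.M_subgroup] S.coset_eq_M_iff[of \<one>] S.M_subset by auto
    then have "(#>) M ` (N \<inter> {\<one>}) = {\<one>\<^bsub>S.Q\<^esub>}"
      using subgroup.one_closed[OF normal_subD(1)[OF N]] by auto
    then show ?case
      by simp
  next
    case (step K L)
    then show ?case
      using \<open>\<And>K L. power_step G V K L \<Longrightarrow> _\<close> by (meson rtranclp.rtrancl_into_rtrancl)
  qed
  from this[OF chain] show ?thesis
    using normal_subD(2)[OF N] Y(2) by (simp add: Int_absorb2)
qed

end

section \<open>Elements acting on a section\<close>

context group
begin

text \<open>In both cases \<open>z\<close> acts trivially on every factor of a chain through
  \<open>N/M\<close>: power maps commute, and \<open>(r-1)\<close>-th powers of power maps are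
  trivial in exponent \<open>r\<close>. Hence \<open>z\<close> induces an element of
  \<open>r\<close>-power order on \<open>N/M\<close>. In the application \<open>V\<close> is the
  centralizer of some \<open>b\<close> in \<open>G\<close>, and \<open>Y\<close> its part in
  \<open>H\<close>.\<close>

lemma section_power_centralizes:
  assumes chain: "(power_step G V)\<^sup>*\<^sup>* {\<one>} V" and Y: "subgroup Y G" "Y \<subseteq> V"
    and M: "normal_sub G Y M" and N: "normal_sub G Y N" and r: "Factorial_Ring.prime (r::nat)"
    and expo: "\<And>n. n \<in> N \<Longrightarrow> n [^] r \<in> M"
    and xy: "x \<in> Y" "y \<in> Y"
    and z: "z = x \<otimes> y \<otimes> inv x \<otimes> inv y \<or> z = x [^] (r - 1)"
  shows "\<exists>k. \<forall>n\<in>N. M #> (z [^] (r ^ k) \<otimes> n) = M #> (n \<otimes> z [^] (r ^ k))"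
proof -
  interpret S: group_section G Y M
    using Y(1) M by (rule section_of_normal_sub)
  have zY: "z \<in> Y"
    using z xy by (auto simp: S.W_closed S.W_pow_closed)
  have NY: "n \<in> Y" if "n \<in> N" for n
    using normal_subD(2)[OF N] that by blast
  have pz: "M #> z = (M #> x) \<otimes>\<^bsub>S.Q\<^esub> (M #> y) \<otimes>\<^bsub>S.Q\<^esub> inv\<^bsub>S.Q\<^esub> (M #> x) \<otimes>\<^bsub>S.Q\<^esub> inv\<^bsub>S.Q\<^esub> (M #> y)
      \<or> M #> z = (M #> x) [^]\<^bsub>S.Q\<^esub> (r - 1)"
    using z xy by (auto simp: S.coset_inv S.coset_mult S.coset_pow S.W_closed)
  have "\<exists>k. \<forall>t\<in>(#>) M ` N. (M #> z) [^]\<^bsub>S.Q\<^esub> (r ^ k) \<otimes>\<^bsub>S.Q\<^esub> t = t \<otimes>\<^bsub>S.Q\<^esub> (M #> z) [^]\<^bsub>S.Q\<^esub> (r ^ k)"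
  proof (rule S.Q.chain_power_centralizes[OF section_power_chain[OF chain Y M N] S.coset_in_Q[OF zY]])
    fix K L l assume step: "power_step S.Q (carrier S.Q) K L" "l \<in> L" "l [^]\<^bsub>S.Q\<^esub> r = \<one>\<^bsub>S.Q\<^esub>"
    show "(M #> z) \<otimes>\<^bsub>S.Q\<^esub> l \<otimes>\<^bsub>S.Q\<^esub> inv\<^bsub>S.Q\<^esub> (M #> z) \<otimes>\<^bsub>S.Q\<^esub> inv\<^bsub>S.Q\<^esub> l \<in> K"
      using pz S.Q.power_step_commutator[OF step(1) S.coset_in_Q[OF xy(1)] S.coset_in_Q[OF xy(2)] step(2)]
        S.Q.power_step_pred_power[OF step(1) S.coset_in_Q[OF xy(1)] r step(2,3)] by metis
  next
    fix t assume "t \<in> (#>) M ` N"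
    then obtain n where n: "n \<in> N" "t = M #> n"
      by blast
    have "M #> (n [^] r) = M"
      using expo[OF n(1)] NY[OF n(1)] S.coset_eq_M_iff[of "n [^] r"] S.W_pow_closed by blast
    then show "t [^]\<^bsub>S.Q\<^esub> r = \<one>\<^bsub>S.Q\<^esub>"
      using n NY by (simp add: S.coset_pow)
  qed
  then obtain k where k: "\<And>n. n \<in> N \<Longrightarrow>
      (M #> z) [^]\<^bsub>S.Q\<^esub> (r ^ k) \<otimes>\<^bsub>S.Q\<^esub> (M #> n) = (M #> n) \<otimes>\<^bsub>S.Q\<^esub> (M #> z) [^]\<^bsub>S.Q\<^esub> (r ^ k)"
    by blast
  have "M #> (z [^] (r ^ k) \<otimes> n) = M #> (n \<otimes> z [^] (r ^ k))" if n: "n \<in> N" for n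
    using k[OF n] zY NY[OF n] by (simp add: S.coset_pow S.coset_mult S.W_pow_closed)
  then show ?thesis
    by blast
qed

lemma section_centralized_element:
  assumes chain: "(power_step G Y)\<^sup>*\<^sup>* {\<one>} Y" and Y: "subgroup Y G"
    and M: "normal_sub G Y M" and N: "normal_sub G Y N" and MN: "M \<subset> N"
    and r: "Factorial_Ring.prime (r::nat)" and expo: "\<And>n. n \<in> N \<Longrightarrow> n [^] r \<in> M"
  shows "\<exists>n\<in>N. n \<notin> M \<and> (\<forall>x\<in>Y. M #> (x [^] (r - 1) \<otimes> n) = M #> (n \<otimes> x [^] (r - 1)))"
proof -
  interpret S: group_section G Y M
    using Y M by (rule section_of_normal_sub)
  have NY: "n \<in> Y" if "n \<in> N" for n
    using normal_subD(2)[OF N] that by blast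
  have "\<exists>t\<in>(#>) M ` N. t \<noteq> \<one>\<^bsub>S.Q\<^esub> \<and>
      (\<forall>x\<in>carrier S.Q. x [^]\<^bsub>S.Q\<^esub> (r - 1) \<otimes>\<^bsub>S.Q\<^esub> t = t \<otimes>\<^bsub>S.Q\<^esub> x [^]\<^bsub>S.Q\<^esub> (r - 1))"
  proof (rule S.Q.chain_centralized_element[OF section_power_chain[OF chain Y order_refl M N] r])
    fix t assume "t \<in> (#>) M ` N"
    then obtain n where n: "n \<in> N" "t = M #> n"
      by blast
    have "M #> (n [^] r) = M"
      using expo[OF n(1)] NY[OF n(1)] S.coset_eq_M_iff[of "n [^] r"] S.W_pow_closed by blast
    then show "t [^]\<^bsub>S.Q\<^esub> r = \<one>\<^bsub>S.Q\<^esub>"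
      using n NY by (simp add: S.coset_pow)
  next
    obtain n where n: "n \<in> N" "n \<notin> M"
      using MN by blast
    then have "M #> n \<noteq> M"
      using S.coset_eq_M_iff NY by blast
    then show "(#>) M ` N \<noteq> {\<one>\<^bsub>S.Q\<^esub>}"
      using n by auto
  qed
  then obtain n where n: "n \<in> N" "M #> n \<noteq> M"
    and cent: "\<And>x. x \<in> carrier S.Q \<Longrightarrow>
      x [^]\<^bsub>S.Q\<^esub> (r - 1) \<otimes>\<^bsub>S.Q\<^esub> (M #> n) = (M #> n) \<otimes>\<^bsub>S.Q\<^esub> x [^]\<^bsub>S.Q\<^esub> (r - 1)"
    by auto
  have "M #> (x [^] (r - 1) \<otimes> n) = M #> (n \<otimes> x [^] (r - 1))" if x: "x \<in> Y" for x
    using cent[OF S.coset_in_Q[OF x]] x NY[OF n(1)] by (simp add: S.coset_pow S.coset_mult S.W_pow_closed)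
  moreover have "n \<notin> M"
    using n NY S.coset_eq_M_iff by blast
  ultimately show ?thesis
    using n(1) by blast
qed

text \<open>With \<open>d\<close> the given commutator, \<open>h g = g h d\<close>; conjugations by
  \<open>h g\<close> and \<open>g h\<close> therefore agree on anything that \<open>d\<close>
  centralizes.\<close>

lemma conj_commute_of_commutator:
  assumes "g \<in> carrier G" "h \<in> carrier G" "n \<in> carrier G"
    and "(inv h \<otimes> inv g \<otimes> h \<otimes> g) \<otimes> n = n \<otimes> (inv h \<otimes> inv g \<otimes> h \<otimes> g)"
  shows "h \<otimes> (g \<otimes> n \<otimes> inv g) \<otimes> inv h = g \<otimes> (h \<otimes> n \<otimes> inv h) \<otimes> inv g"
proof -
  let ?d = "inv h \<otimes> inv g \<otimes> h \<otimes> g"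
  have hg: "h \<otimes> g = g \<otimes> h \<otimes> ?d"
  proof -
    have "g \<otimes> h \<otimes> ?d = g \<otimes> (h \<otimes> inv h) \<otimes> inv g \<otimes> h \<otimes> g"
      using assms(1,2) by (simp only: m_assoc m_closed inv_closed)
    then show ?thesis
      using assms(1,2) by simp
  qed
  have "h \<otimes> (g \<otimes> n \<otimes> inv g) \<otimes> inv h = h \<otimes> g \<otimes> n \<otimes> inv (h \<otimes> g)"
    using assms(1-3) by (simp add: conj_mult)
  also have "\<dots> = (g \<otimes> h) \<otimes> (?d \<otimes> n \<otimes> inv ?d) \<otimes> inv (g \<otimes> h)"
    unfolding hg using assms(1-3) by (intro conj_mult) auto
  also have "?d \<otimes> n \<otimes> inv ?d = n"
    using assms by (subst conj_eq_self_iff) auto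
  also have "(g \<otimes> h) \<otimes> n \<otimes> inv (g \<otimes> h) = g \<otimes> (h \<otimes> n \<otimes> inv h) \<otimes> inv g"
    using assms(1-3) by (simp add: conj_mult)
  finally show ?thesis .
qed

lemma coset_eq_mono:
  assumes M: "subgroup M G" and W: "subgroup W G" and "M \<subseteq> W"
    and x: "x \<in> carrier G" and y: "y \<in> carrier G" and eq: "M #> x = M #> y"
  shows "W #> x = W #> y"
proof -
  have "x \<in> M #> y"
    using rcos_self[OF x M] eq by simp
  then have "x \<in> W #> y"
    using \<open>M \<subseteq> W\<close> unfolding r_coset_def by blast
  then show ?thesis
    using repr_independence[OF _ y W] by simp
qed

end

text \<open>The last two conditions say that \<open>H\<close> induces on \<open>N/M\<close> an
  abelian group in which every order divides some \<open>(r-1)r^k\<close>. The operator group has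
  disappeared: from here on only linear algebra over the field with \<open>r\<close> elements is at
  work.\<close>

locale eigen_section = group G for G (structure) +
  fixes H M N :: "'a set" and r :: nat
  assumes finite_G: "finite (carrier G)" and H: "subgroup H G"
    and M: "normal_sub G H M" and N: "normal_sub G H N" and MN: "M \<subseteq> N"
    and der: "derived G N \<subseteq> M" and r: "Factorial_Ring.prime r"
    and expo: "\<And>n. n \<in> N \<Longrightarrow> n [^] r \<in> M"
    and pow_cent: "\<And>h. h \<in> H \<Longrightarrow> \<exists>k. \<forall>n\<in>N.
      M #> (h [^] ((r - 1) * r ^ k) \<otimes> n) = M #> (n \<otimes> h [^] ((r - 1) * r ^ k))"
    and comm_cent: "\<And>g h n. g \<in> H \<Longrightarrow> h \<in> H \<Longrightarrow> n \<in> N \<Longrightarrow>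
      M #> (g \<otimes> h \<otimes> inv g \<otimes> inv h \<otimes> n) = M #> (n \<otimes> (g \<otimes> h \<otimes> inv g \<otimes> inv h))"
begin

lemma HG: "h \<in> H \<Longrightarrow> h \<in> carrier G"
  using subgroup.mem_carrier[OF H] .

text \<open>Centralizing modulo \<open>M\<close> implies centralizing modulo the larger
  \<open>W\<close>, so conjugation by \<open>h\<close> on \<open>V/W\<close> has an order to which
  \<open>eigenvector\<close> applies.\<close>

lemma eigenvector_in_factor:
  assumes W: "normal_sub G H W" and V: "normal_sub G H V" and "M \<subseteq> W" "W \<subset> V" "V \<subseteq> N"
    and h: "h \<in> H"
  obtains c :: int and u where "u \<in> V" "u \<notin> W" "W #> (h \<otimes> u \<otimes> inv h) = W #> (u [^] c)"
proof -
  interpret S: group_section G V W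
    using section_of_normal_sub'[OF W normal_subD(1)[OF V]] normal_subD(2)[OF V] \<open>W \<subset> V\<close> by blast
  have "derived G V \<subseteq> W"
    using mono_derived[OF \<open>V \<subseteq> N\<close>] der \<open>M \<subseteq> W\<close> by blast
  then interpret Q: comm_group S.Q
    by (rule S.comm_group_Q)
  define f where "f x = h \<otimes> x \<otimes> inv h" for x
  have hG: "h \<in> carrier G"
    using HG h .
  have fV: "f x \<in> V" if "x \<in> V" for x
    using normal_subD(3)[OF V h that] by (simp add: f_def)
  have f_hom: "f \<in> hom (G\<lparr>carrier := V\<rparr>) G"
  proof (rule homI)
    fix x y assume "x \<in> carrier (G\<lparr>carrier := V\<rparr>)" "y \<in> carrier (G\<lparr>carrier := V\<rparr>)"
    then have xy: "x \<in> carrier G" "y \<in> carrier G"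
      using S.W_carrier by auto
    show "f (x \<otimes>\<^bsub>G\<lparr>carrier := V\<rparr>\<^esub> y) = f x \<otimes> f y"
      using xy hG by (simp add: f_def m_assoc inv_solve_left)
  qed (use S.W_carrier fV in auto)
  have fW: "f ` W = W"
  proof
    show "f ` W \<subseteq> W"
      using normal_subD(3)[OF W h] by (auto simp: f_def)
    show "W \<subseteq> f ` W"
    proof
      fix w assume w: "w \<in> W"
      have ih: "inv h \<in> H"
        using subgroup.m_inv_closed[OF H h] .
      have wG: "w \<in> carrier G"
        using subgroup.mem_carrier[OF normal_subD(1)[OF W] w] .
      have "inv h \<otimes> w \<otimes> inv (inv h) \<in> W"
        using normal_subD(3)[OF W ih w] .
      moreover have "f (inv h \<otimes> w \<otimes> inv (inv h)) = w"
        using conj_mult[of h "inv h" w] hG wG by (simp add: f_def)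
      ultimately show "w \<in> f ` W"
        by (metis imageI)
    qed
  qed
  interpret E: abelian_endo S.Q "image f"
    by unfold_locales (rule S.image_hom_Q[OF f_hom fW fV])
  have fpow: "(f ^^ n) x = h [^] n \<otimes> x \<otimes> inv (h [^] n)" if "x \<in> carrier G" for n x
  proof (induction n)
    case (Suc n)
    then show ?case
      using hG that conj_mult[of h "h [^] n" x] nat_pow_Suc2[of h n] by (simp add: f_def)
  qed (use that in simp)
  obtain k where k: "\<And>n. n \<in> N \<Longrightarrow>
      M #> (h [^] ((r - 1) * r ^ k) \<otimes> n) = M #> (n \<otimes> h [^] ((r - 1) * r ^ k))"
    using pow_cent[OF h] by blast
  obtain w where w: "w \<in> V" "w \<notin> W"
    using \<open>W \<subset> V\<close> by blast
  have "\<exists>c. \<exists>u\<in>carrier S.Q. u \<noteq> \<one>\<^bsub>S.Q\<^esub> \<and> f ` u = u [^]\<^bsub>S.Q\<^esub> (c::int)"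
  proof (rule E.eigenvector[OF r])
    fix u assume "u \<in> carrier S.Q"
    then obtain x where x: "x \<in> V" "u = W #> x"
      unfolding S.carrier_Q by blast
    have "W #> (x [^] r) = W"
      using expo[of x] x \<open>V \<subseteq> N\<close> \<open>M \<subseteq> W\<close> S.coset_eq_M_iff[of "x [^] r"] S.W_pow_closed(1)[of x r] by blast
    then show "u [^]\<^bsub>S.Q\<^esub> r = \<one>\<^bsub>S.Q\<^esub>"
      using x by (simp add: S.coset_pow)
    let ?p = "h [^] ((r - 1) * r ^ k)"
    have xG: "x \<in> carrier G"
      using S.W_carrier x(1) .
    have "W #> (?p \<otimes> x) = W #> (x \<otimes> ?p)"
      using k[of x] x \<open>V \<subseteq> N\<close> hG xG
      by (intro coset_eq_mono[OF normal_subD(1)[OF M] normal_subD(1)[OF W] \<open>M \<subseteq> W\<close>]) auto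
    then have "W #> (?p \<otimes> x) #> inv ?p = W #> (x \<otimes> ?p) #> inv ?p"
      by simp
    then have "W #> (?p \<otimes> x \<otimes> inv ?p) = W #> x"
      using hG xG normal_subD(1)[OF W] subgroup.subset[of W G] by (simp add: coset_mult_assoc m_assoc)
    then show "(image f ^^ ((r - 1) * r ^ k)) u = u"
      using S.funpow_image_coset[OF f_hom fW fV x(1)] x fpow[OF xG] by simp
  next
    show "W #> w \<in> carrier S.Q" "W #> w \<noteq> \<one>\<^bsub>S.Q\<^esub>"
      using w S.coset_eq_M_iff[of w] by auto
  qed
  then obtain c :: int and u where u: "u \<in> carrier S.Q" "u \<noteq> \<one>\<^bsub>S.Q\<^esub>" "f ` u = u [^]\<^bsub>S.Q\<^esub> c"
    by blast
  obtain x where x: "x \<in> V" "u = W #> x"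
    using u(1) unfolding S.carrier_Q by blast
  have "x \<notin> W"
    using u(2) x S.coset_eq_M_iff[of x] by auto
  moreover have "W #> (h \<otimes> x \<otimes> inv h) = W #> (x [^] c)"
    using u(3) x S.image_coset[OF f_hom fW x(1)] by (simp add: S.coset_int_pow f_def)
  ultimately show ?thesis
    using that x(1) by blast
qed

end

section \<open>From eigenvectors to cyclic factors\<close>

context eigen_section
begin

text \<open>The eigenspace \<open>E\<close> of \<open>h\<close> for the eigenvalue found is a
  subgroup because \<open>V/W\<close> is abelian, and it is normal in \<open>H\<close> because
  commutators of \<open>H\<close> act trivially on \<open>N/M\<close>. It strictly contains
  \<open>W\<close>, so it is all of \<open>V\<close>.\<close>

lemma power_action_on_irreducible:
  assumes W: "normal_sub G H W" and V: "normal_sub G H V" and "M \<subseteq> W" "W \<subset> V" "V \<subseteq> N"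
    and irr: "\<And>E. normal_sub G H E \<Longrightarrow> W \<subset> E \<Longrightarrow> E \<subseteq> V \<Longrightarrow> E = V"
    and h: "h \<in> H"
  shows "\<exists>c::int. \<forall>n\<in>V. W #> (h \<otimes> n \<otimes> inv h) = W #> (n [^] c)"
proof -
  interpret S: group_section G V W
    using section_of_normal_sub'[OF W normal_subD(1)[OF V]] normal_subD(2)[OF V] \<open>W \<subset> V\<close> by blast
  \<comment> \<open>Conjugation by elements of \<open>H\<close> is computed in \<open>H/W\<close>,
    powers in the abelian group \<open>V/W\<close>.\<close>
  interpret T: group_section G H W
    using H W by (rule section_of_normal_sub)
  have "derived G V \<subseteq> W"
    using mono_derived[OF \<open>V \<subseteq> N\<close>] der \<open>M \<subseteq> W\<close> by blast
  then interpret Q: comm_group S.Q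
    by (rule S.comm_group_Q)
  obtain c :: int and u where u: "u \<in> V" "u \<notin> W" "W #> (h \<otimes> u \<otimes> inv h) = W #> (u [^] c)"
    using eigenvector_in_factor[OF W V \<open>M \<subseteq> W\<close> \<open>W \<subset> V\<close> \<open>V \<subseteq> N\<close> h] by blast
  define f where "f n = h \<otimes> n \<otimes> inv h" for n
  define E where "E = {n \<in> V. W #> f n = W #> (n [^] c)}"
  have hG: "h \<in> carrier G"
    using HG h .
  have fV: "f n \<in> V" if "n \<in> V" for n
    using normal_subD(3)[OF V h that] by (simp add: f_def)
  have VH: "n \<in> H" if "n \<in> V" for n
    using normal_subD(2)[OF V] that by blast
  have f_mult: "f (n \<otimes> m) = f n \<otimes> f m" if "n \<in> V" "m \<in> V" for n m
    using S.W_carrier[OF that(1)] S.W_carrier[OF that(2)] hG by (simp add: f_def m_assoc inv_solve_left)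
  have EV: "E \<subseteq> V"
    unfolding E_def by blast
  have "subgroup E G"
  proof (rule subgroupI)
    show "E \<subseteq> carrier G"
      using EV S.W_carrier by blast
    show "E \<noteq> {}"
      using u unfolding E_def f_def by blast
  next
    fix n assume "n \<in> E"
    then have n: "n \<in> V" "W #> f n = W #> (n [^] c)"
      unfolding E_def by auto
    have nG: "n \<in> carrier G"
      using S.W_carrier n(1) .
    have "f (inv n) = inv (f n)"
      using hG nG by (simp add: f_def inv_mult_group m_assoc)
    then have "W #> f (inv n) = inv\<^bsub>S.Q\<^esub> (W #> f n)"
      using n(1) fV by (simp add: S.coset_inv)
    also have "\<dots> = W #> (inv (n [^] c))"
      using n S.W_pow_closed by (simp add: S.coset_inv)
    also have "inv (n [^] c) = inv n [^] c"
      using nG by (simp add: int_pow_inv)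
    finally show "inv n \<in> E"
      using n(1) S.W_closed unfolding E_def by simp
  next
    fix n m assume "n \<in> E" "m \<in> E"
    then have n: "n \<in> V" "W #> f n = W #> (n [^] c)" and m: "m \<in> V" "W #> f m = W #> (m [^] c)"
      unfolding E_def by auto
    have "W #> f (n \<otimes> m) = (W #> f n) \<otimes>\<^bsub>S.Q\<^esub> (W #> f m)"
      using n(1) m(1) fV by (simp add: f_mult S.coset_mult)
    also have "\<dots> = (W #> n) [^]\<^bsub>S.Q\<^esub> c \<otimes>\<^bsub>S.Q\<^esub> (W #> m) [^]\<^bsub>S.Q\<^esub> c"
      using n m by (simp add: S.coset_int_pow)
    also have "\<dots> = ((W #> n) \<otimes>\<^bsub>S.Q\<^esub> (W #> m)) [^]\<^bsub>S.Q\<^esub> c"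
      using n(1) m(1) by (simp add: Q.int_pow_distrib)
    also have "\<dots> = W #> ((n \<otimes> m) [^] c)"
      using n(1) m(1) by (simp add: S.coset_mult S.coset_int_pow S.W_closed)
    finally show "n \<otimes> m \<in> E"
      using n(1) m(1) S.W_closed unfolding E_def by simp
  qed
  moreover have "g \<otimes> n \<otimes> inv g \<in> E" if g: "g \<in> H" and n: "n \<in> E" for g n
  proof -
    have nV: "n \<in> V" and nE: "W #> f n = W #> (n [^] c)"
      using n unfolding E_def by auto
    have gn: "g \<otimes> n \<otimes> inv g \<in> V"
      using normal_subD(3)[OF V g nV] .
    have inv: "inv h \<in> H" "inv g \<in> H"
      using g h T.W_closed by auto
    \<comment> \<open>\<open>comm_cent\<close> is used at the inverses of \<open>h\<close> and
      \<open>g\<close> to obtain the commutator for which \<open>h g = g h d\<close>.\<close>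
    let ?d = "inv h \<otimes> inv g \<otimes> h \<otimes> g"
    have gG: "g \<in> carrier G" and nG: "n \<in> carrier G"
      using HG g S.W_carrier[OF nV] by auto
    have "n \<in> N"
      using nV \<open>V \<subseteq> N\<close> by blast
    then have "M #> (?d \<otimes> n) = M #> (n \<otimes> ?d)"
      using comm_cent[OF inv] hG gG by simp
    then have "W #> (?d \<otimes> n) = W #> (n \<otimes> ?d)"
      using hG gG nG by (intro coset_eq_mono[OF normal_subD(1)[OF M] normal_subD(1)[OF W] \<open>M \<subseteq> W\<close>]) auto
    moreover have dH: "?d \<in> H"
      using g h inv by (simp add: T.W_closed)
    ultimately have d: "(W #> ?d) \<otimes>\<^bsub>T.Q\<^esub> (W #> n) = (W #> n) \<otimes>\<^bsub>T.Q\<^esub> (W #> ?d)"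
      using VH[OF nV] by (simp add: T.coset_mult)
    have pd: "W #> ?d = inv\<^bsub>T.Q\<^esub> (W #> h) \<otimes>\<^bsub>T.Q\<^esub> inv\<^bsub>T.Q\<^esub> (W #> g) \<otimes>\<^bsub>T.Q\<^esub> (W #> h) \<otimes>\<^bsub>T.Q\<^esub> (W #> g)"
      using g h inv by (simp add: T.coset_inv T.coset_mult T.W_closed)
    have fH: "f n \<in> H" "g \<otimes> n \<otimes> inv g \<in> H"
      using VH fV nV gn by auto
    have "W #> f (g \<otimes> n \<otimes> inv g) =
        (W #> h) \<otimes>\<^bsub>T.Q\<^esub> ((W #> g) \<otimes>\<^bsub>T.Q\<^esub> (W #> n) \<otimes>\<^bsub>T.Q\<^esub> inv\<^bsub>T.Q\<^esub> (W #> g)) \<otimes>\<^bsub>T.Q\<^esub> inv\<^bsub>T.Q\<^esub> (W #> h)"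
      using g h fH VH[OF nV] by (simp add: f_def T.coset_conj)
    also have "\<dots> = (W #> g) \<otimes>\<^bsub>T.Q\<^esub> ((W #> h) \<otimes>\<^bsub>T.Q\<^esub> (W #> n) \<otimes>\<^bsub>T.Q\<^esub> inv\<^bsub>T.Q\<^esub> (W #> h)) \<otimes>\<^bsub>T.Q\<^esub> inv\<^bsub>T.Q\<^esub> (W #> g)"
      using d unfolding pd by (intro T.Q.conj_commute_of_commutator) (use g h VH[OF nV] in auto)
    also have "\<dots> = (W #> g) \<otimes>\<^bsub>T.Q\<^esub> (W #> f n) \<otimes>\<^bsub>T.Q\<^esub> inv\<^bsub>T.Q\<^esub> (W #> g)"
      using h VH[OF nV] by (simp add: f_def T.coset_conj)
    also have "\<dots> = W #> (g \<otimes> n [^] c \<otimes> inv g)"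
      unfolding nE using g VH[OF nV] by (simp add: T.coset_conj T.W_pow_closed)
    also have "g \<otimes> n [^] c \<otimes> inv g = (g \<otimes> n \<otimes> inv g) [^] c"
      using gG nG by (rule conj_int_pow)
    finally show ?thesis
      using gn unfolding E_def by simp
  qed
  moreover have "E \<subseteq> H"
    using EV VH by blast
  ultimately have "normal_sub G H E"
    unfolding normal_sub_def by blast
  moreover have "W \<subset> E"
  proof -
    have "w \<in> E" if w: "w \<in> W" for w
    proof -
      have wV: "w \<in> V"
        using w \<open>W \<subset> V\<close> by blast
      have "f w \<in> W" "w [^] c \<in> W"
        using normal_subD(3)[OF W h w] subgroup_int_pow_closed[OF normal_subD(1)[OF W] w]
        by (auto simp: f_def)
      then have "W #> f w = W" "W #> (w [^] c) = W"
        using S.coset_eq_M_iff S.M_subset by blast+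
      then show ?thesis
        using wV unfolding E_def by simp
    qed
    moreover have "u \<in> E"
      using u unfolding E_def f_def by simp
    ultimately show ?thesis
      using u(2) by blast
  qed
  ultimately have "E = V"
    using irr EV by blast
  then show ?thesis
    unfolding E_def f_def by blast
qed

text \<open>Since \<open>H\<close> acts on \<open>V/W\<close> by power maps, it preserves the cyclic
  subgroup generated by any coset; a nontrivial one therefore generates \<open>V/W\<close>.\<close>

lemma cyclic_step_of_irreducible:
  assumes W: "normal_sub G H W" and V: "normal_sub G H V" and "M \<subseteq> W" "W \<subset> V" "V \<subseteq> N"
    and irr: "\<And>E. normal_sub G H E \<Longrightarrow> W \<subset> E \<Longrightarrow> E \<subseteq> V \<Longrightarrow> E = V"
  shows "cyclic_step G H W V"
proof -
  interpret S: group_section G V W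
    using section_of_normal_sub'[OF W normal_subD(1)[OF V]] normal_subD(2)[OF V] \<open>W \<subset> V\<close> by blast
  obtain t where t: "t \<in> V" "t \<notin> W"
    using \<open>W \<subset> V\<close> by blast
  define E where "E = {x \<in> V. \<exists>n::int. W #> x = (W #> t) [^]\<^bsub>S.Q\<^esub> n}"
  have EV: "E \<subseteq> V"
    unfolding E_def by blast
  have tQ: "W #> t \<in> carrier S.Q"
    using t(1) by (rule S.coset_in_Q)
  have "subgroup E G"
  proof (rule subgroupI)
    show "E \<subseteq> carrier G"
      using EV S.W_carrier by blast
    have "W #> t = (W #> t) [^]\<^bsub>S.Q\<^esub> (1::int)"
      using tQ by simp
    then show "E \<noteq> {}"
      using t(1) unfolding E_def by blast
  next
    fix x assume "x \<in> E"
    then obtain n :: int where x: "x \<in> V" "W #> x = (W #> t) [^]\<^bsub>S.Q\<^esub> n"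
      unfolding E_def by blast
    have "W #> inv x = (W #> t) [^]\<^bsub>S.Q\<^esub> (- n)"
      using x tQ by (simp add: S.Q.int_pow_neg flip: S.coset_inv)
    then show "inv x \<in> E"
      using x(1) S.W_closed unfolding E_def by blast
  next
    fix x y assume "x \<in> E" "y \<in> E"
    then obtain n m :: int where x: "x \<in> V" "W #> x = (W #> t) [^]\<^bsub>S.Q\<^esub> n"
      and y: "y \<in> V" "W #> y = (W #> t) [^]\<^bsub>S.Q\<^esub> m"
      unfolding E_def by blast
    have "W #> (x \<otimes> y) = (W #> t) [^]\<^bsub>S.Q\<^esub> (n + m)"
      using x y tQ by (simp add: S.Q.int_pow_mult flip: S.coset_mult)
    then show "x \<otimes> y \<in> E"
      using x(1) y(1) S.W_closed unfolding E_def by blast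
  qed
  moreover have "h \<otimes> x \<otimes> inv h \<in> E" if h: "h \<in> H" and xE: "x \<in> E" for h x
  proof -
    obtain n :: int where x: "x \<in> V" "W #> x = (W #> t) [^]\<^bsub>S.Q\<^esub> n"
      using xE unfolding E_def by blast
    obtain c :: int where "W #> (h \<otimes> x \<otimes> inv h) = W #> (x [^] c)"
      using power_action_on_irreducible[OF assms h] x(1) by blast
    also have "\<dots> = (W #> t) [^]\<^bsub>S.Q\<^esub> (n * c)"
      using x tQ by (simp add: S.Q.int_pow_pow flip: S.coset_int_pow)
    finally show ?thesis
      using normal_subD(3)[OF V h x(1)] unfolding E_def by blast
  qed
  moreover have "E \<subseteq> H"
    using EV normal_subD(2)[OF V] by blast
  ultimately have "normal_sub G H E"
    unfolding normal_sub_def by blast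
  moreover have "W \<subset> E"
  proof -
    have "w \<in> E" if w: "w \<in> W" for w
    proof -
      have "W #> w = (W #> t) [^]\<^bsub>S.Q\<^esub> (0::int)"
        using w S.coset_eq_M_iff S.M_subset by auto
      then show ?thesis
        using w S.M_subset unfolding E_def by blast
    qed
    moreover have "t \<in> E"
    proof -
      have "W #> t = (W #> t) [^]\<^bsub>S.Q\<^esub> (1::int)"
        using tQ by simp
      then show ?thesis
        using t(1) unfolding E_def by blast
    qed
    ultimately show ?thesis
      using t(2) by blast
  qed
  ultimately have "E = V"
    using irr EV by blast
  have "\<exists>n::int. \<exists>k\<in>W. x = t [^] n \<otimes> k" if x: "x \<in> V" for x
  proof -
    obtain n :: int where "W #> x = (W #> t) [^]\<^bsub>S.Q\<^esub> n"
      using x \<open>E = V\<close> unfolding E_def by blast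
    then have "W #> (t [^] n) = W #> x"
      using t(1) by (simp add: S.coset_int_pow)
    then have "inv (t [^] n) \<otimes> x \<in> W"
      using t(1) x by (simp add: S.coset_eq_iff' S.W_pow_closed)
    moreover have "x = t [^] n \<otimes> (inv (t [^] n) \<otimes> x)"
      using t(1) x S.W_carrier by (simp flip: m_assoc)
    ultimately show ?thesis
      by blast
  qed
  then show ?thesis
    using W V \<open>W \<subset> V\<close> t(1) unfolding cyclic_step_def by blast
qed

text \<open>Let \<open>W\<close> be largest among the terms reachable from \<open>M\<close> inside
  \<open>N\<close>. If it were not \<open>N\<close>, a minimal normal subgroup of \<open>H\<close>
  strictly above \<open>W\<close> and inside \<open>N\<close> would continue the chain.\<close>

lemma cyclic_chain: "(cyclic_step G H)\<^sup>*\<^sup>* M N"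
proof -
  have finH: "finite H"
    using finite_subset[OF subgroup.subset[OF H] finite_G] .
  have finN: "finite N"
    using finite_subset[OF normal_subD(2)[OF N] finH] .
  let ?P = "\<lambda>W. (cyclic_step G H)\<^sup>*\<^sup>* M W \<and> W \<subseteq> N"
  have "?P M"
    using MN by simp
  moreover have "\<forall>W. ?P W \<longrightarrow> card W < Suc (card N)"
    using card_mono[OF finN] by (simp add: less_Suc_eq_le)
  ultimately obtain W where W: "?P W" and max: "\<And>V. ?P V \<Longrightarrow> card V \<le> card W"
    using ex_has_greatest_nat[of ?P M card "Suc (card N)"] by blast
  have nW: "normal_sub G H W" and MW: "M \<subseteq> W"
    using cyclic_chain_normal[OF M] W by auto
  have "W = N"
  proof (rule ccontr)
    assume "W \<noteq> N"
    let ?R = "\<lambda>V. normal_sub G H V \<and> W \<subset> V \<and> V \<subseteq> N"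
    have "?R N"
      using N W \<open>W \<noteq> N\<close> by blast
    then obtain V where V: "?R V" and min: "\<And>E. ?R E \<Longrightarrow> card V \<le> card E"
      using ex_has_least_nat[of ?R N card] by blast
    have finV: "finite V"
      using V finN finite_subset by blast
    have "cyclic_step G H W V"
    proof (rule cyclic_step_of_irreducible[OF nW _ MW])
      fix E assume E: "normal_sub G H E" "W \<subset> E" "E \<subseteq> V"
      then have "card V \<le> card E"
        using V by (intro min) blast
      then show "E = V"
        using card_seteq[OF finV E(3)] by blast
    qed (use V in auto)
    then have "(cyclic_step G H)\<^sup>*\<^sup>* M V"
      using W by (meson rtranclp.rtrancl_into_rtrancl)
    then have "card V \<le> card W"
      using V by (intro max) blast
    moreover have "card W < card V"
      using V finV by (intro psubset_card_mono) auto
    ultimately show False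
      by simp
  qed
  then show ?thesis
    using W by simp
qed

end

section \<open>Chief factors of invariant subgroups\<close>

lemma (in group) cyclic_chain_imp_power_chain:
  assumes H: "subgroup H G" and "(cyclic_step G H)\<^sup>*\<^sup>* K L"
  shows "(power_step G H)\<^sup>*\<^sup>* K L"
  using assms(2)
  by (induction rule: rtranclp_induct)
    (auto intro: rtranclp.rtrancl_into_rtrancl cyclic_imp_power_step[OF H])

text \<open>Moves a commutation relation across a conjugation; with it, sets defined by commuting
  modulo \<open>M\<close> turn out to be normal in \<open>H\<close>.\<close>

lemma (in group) commute_conj_shift:
  assumes "h \<in> carrier G" "b \<in> carrier G" "n \<in> carrier G"
    and "(inv h \<otimes> b \<otimes> h) \<otimes> n = n \<otimes> (inv h \<otimes> b \<otimes> h)"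
  shows "b \<otimes> (h \<otimes> n \<otimes> inv h) = (h \<otimes> n \<otimes> inv h) \<otimes> b"
proof -
  let ?a = "inv h \<otimes> b \<otimes> h"
  have ha: "h \<otimes> ?a = b \<otimes> h"
    using assms(1,2) by (simp flip: m_assoc)
  have ah: "?a \<otimes> inv h = inv h \<otimes> b"
    using assms(1,2) by (simp add: m_assoc)
  have "b \<otimes> (h \<otimes> n \<otimes> inv h) = (h \<otimes> ?a) \<otimes> n \<otimes> inv h"
    unfolding ha using assms(1-3) by (simp add: m_assoc)
  also have "\<dots> = h \<otimes> (?a \<otimes> n) \<otimes> inv h"
    using assms(1-3) by (simp only: m_assoc m_closed inv_closed)
  also have "\<dots> = h \<otimes> n \<otimes> (?a \<otimes> inv h)"
    unfolding assms(4) using assms(1-3) by (simp only: m_assoc m_closed inv_closed)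
  also have "\<dots> = (h \<otimes> n \<otimes> inv h) \<otimes> b"
    unfolding ah using assms(1-3) by (simp add: m_assoc)
  finally show ?thesis .
qed

section \<open>Centralizers modulo a normal subgroup\<close>

lemma (in group) subgroup_commuting:
  assumes "z \<in> carrier G"
  shows "subgroup {x \<in> carrier G. z \<otimes> x = x \<otimes> z} G"
proof (rule subgroupI)
  show "{x \<in> carrier G. z \<otimes> x = x \<otimes> z} \<noteq> {}"
    using assms by (auto intro!: exI[of _ \<one>])
next
  fix x assume "x \<in> {x \<in> carrier G. z \<otimes> x = x \<otimes> z}"
  then have x: "x \<in> carrier G" "z \<otimes> x = x \<otimes> z"
    by auto
  then have "inv x \<otimes> (z \<otimes> x) \<otimes> inv x = inv x \<otimes> (x \<otimes> z) \<otimes> inv x"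
    by simp
  moreover have "inv x \<otimes> (z \<otimes> x) \<otimes> inv x = inv x \<otimes> z"
    using x(1) assms by (simp add: m_assoc)
  moreover have "inv x \<otimes> (x \<otimes> z) \<otimes> inv x = z \<otimes> inv x"
    using x(1) assms by (simp flip: m_assoc)
  ultimately show "inv x \<in> {x \<in> carrier G. z \<otimes> x = x \<otimes> z}"
    using x(1) by simp
next
  fix x y assume "x \<in> {x \<in> carrier G. z \<otimes> x = x \<otimes> z}" "y \<in> {x \<in> carrier G. z \<otimes> x = x \<otimes> z}"
  then have x: "x \<in> carrier G" "z \<otimes> x = x \<otimes> z" and y: "y \<in> carrier G" "z \<otimes> y = y \<otimes> z"
    by auto
  have "z \<otimes> (x \<otimes> y) = x \<otimes> z \<otimes> y"
    using x y assms by (simp flip: m_assoc)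
  also have "\<dots> = x \<otimes> y \<otimes> z"
    using x(1) y assms by (simp add: m_assoc)
  finally show "x \<otimes> y \<in> {x \<in> carrier G. z \<otimes> x = x \<otimes> z}"
    using x(1) y(1) by simp
qed auto

context group_section
begin

lemma coset_commute_iff:
  "x \<in> W \<Longrightarrow> y \<in> W \<Longrightarrow>
    M #> (x \<otimes> y) = M #> (y \<otimes> x) \<longleftrightarrow> (M #> x) \<otimes>\<^bsub>Q\<^esub> (M #> y) = (M #> y) \<otimes>\<^bsub>Q\<^esub> (M #> x)"
  by (simp add: coset_mult)

text \<open>This carries the arguments by generators below: once the generators commute with
  \<open>z\<close> modulo \<open>M\<close>, so does everything they generate.\<close>

lemma subgroup_commuting_mod:
  assumes z: "z \<in> W" and N: "subgroup N G" "N \<subseteq> W"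
  shows "subgroup {x \<in> N. M #> (z \<otimes> x) = M #> (x \<otimes> z)} G"
proof -
  interpret \<pi>: group_hom "G\<lparr>carrier := W\<rparr>" Q "(#>) M"
    by (intro group_hom.intro group_hom_axioms.intro Q.group_axioms subgroup_imp_group W_subgroup homI)
      (auto simp: coset_mult)
  let ?Z = "{q \<in> carrier Q. (M #> z) \<otimes>\<^bsub>Q\<^esub> q = q \<otimes>\<^bsub>Q\<^esub> (M #> z)}"
  have Z: "subgroup ?Z Q"
    using Q.subgroup_commuting[OF coset_in_Q[OF z]] .
  have eq: "{x \<in> N. M #> (z \<otimes> x) = M #> (x \<otimes> z)} = {x \<in> N. M #> x \<in> ?Z}"
    using z N(2) coset_commute_iff[of z] by auto
  show ?thesis
    unfolding eq
  proof (rule subgroupI)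
    show "{x \<in> N. M #> x \<in> ?Z} \<subseteq> carrier G"
      using N(1) subgroup.subset by blast
    have "\<one> \<in> N" "M #> \<one> = \<one>\<^bsub>Q\<^esub>"
      using subgroup.one_closed[OF N(1)] \<pi>.hom_one by auto
    then show "{x \<in> N. M #> x \<in> ?Z} \<noteq> {}"
      using subgroup.one_closed[OF Z] by fastforce
  next
    fix x assume "x \<in> {x \<in> N. M #> x \<in> ?Z}"
    then have x: "x \<in> N" "x \<in> W" "M #> x \<in> ?Z"
      using N(2) by auto
    have "M #> inv x \<in> ?Z"
      using subgroup.m_inv_closed[OF Z x(3)] coset_inv[OF x(2)] by metis
    then show "inv x \<in> {x \<in> N. M #> x \<in> ?Z}"
      using subgroup.m_inv_closed[OF N(1) x(1)] by blast
  next
    fix x y assume "x \<in> {x \<in> N. M #> x \<in> ?Z}" "y \<in> {x \<in> N. M #> x \<in> ?Z}"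
    then have xy: "x \<in> N" "x \<in> W" "M #> x \<in> ?Z" "y \<in> N" "y \<in> W" "M #> y \<in> ?Z"
      using N(2) by auto
    have "M #> (x \<otimes> y) \<in> ?Z"
      using subgroup.m_closed[OF Z xy(3,6)] coset_mult[OF xy(2,5)] by metis
    then show "x \<otimes> y \<in> {x \<in> N. M #> x \<in> ?Z}"
      using subgroup.m_closed[OF N(1) xy(1,4)] by blast
  qed
qed

end

text \<open>Irreducibility of \<open>N/M\<close> is assumed under \<open>H\<close> and
  \<open>A\<close> jointly, so a subgroup has to be shown stable under both before
  \<open>chief\<close> can be used on it.\<close>

locale chief_section = elementary_good_action +
  fixes H M N :: "'a set" and r :: nat
  assumes card_A: "p ^ 4 \<le> card (carrier A)"
    and fix_chain: "\<And>a. a \<in> carrier A \<Longrightarrow> a \<noteq> \<one>\<^bsub>A\<^esub> \<Longrightarrow>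
      (power_step G (fix_act \<phi> (carrier G) {a}))\<^sup>*\<^sup>* {\<one>} (fix_act \<phi> (carrier G) {a})"
    and H: "subgroup H G" "invariant (carrier A) H"
    and M: "normal_sub G H M" "invariant (carrier A) M"
    and N: "normal_sub G H N" "invariant (carrier A) N" and MN: "M \<subset> N"
    and der_N: "derived G N \<subseteq> M" and r: "Factorial_Ring.prime r"
    and expo: "\<And>n. n \<in> N \<Longrightarrow> n [^] r \<in> M"
    and chief: "\<And>E. normal_sub G H E \<Longrightarrow> invariant (carrier A) E \<Longrightarrow> M \<subset> E \<Longrightarrow> E \<subseteq> N \<Longrightarrow> E = N"
begin

section \<open>The centralizer of a chief factor\<close>

sublocale S: group_section G H M
  using H(1) M(1) by (rule section_of_normal_sub)

lemma M_nat_pow_closed: "x \<in> M \<Longrightarrow> x [^] (n::nat) \<in> M"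
  using subgroup_int_pow_closed[OF S.M_subgroup, of x "int n"] by (simp add: int_pow_int)

definition C :: "'a set" where
  "C = {h \<in> H. \<forall>n\<in>N. M #> (h \<otimes> n) = M #> (n \<otimes> h)}"

lemma NH: "n \<in> N \<Longrightarrow> n \<in> H"
  using normal_subD(2)[OF N(1)] by blast

lemma C_subgroup: "subgroup C G"
proof -
  have "C = H \<inter> (\<Inter>n\<in>N. {h \<in> H. M #> (n \<otimes> h) = M #> (h \<otimes> n)})"
    unfolding C_def by auto
  also have "subgroup \<dots> G"
  proof (rule subgroups_Inter_pair[OF H(1)])
    show "subgroup (\<Inter>n\<in>N. {h \<in> H. M #> (n \<otimes> h) = M #> (h \<otimes> n)}) G"
      using S.subgroup_commuting_mod[OF NH H(1) order_refl] MN by (intro subgroups_Inter) auto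
  qed
  finally show ?thesis .
qed

lemma C_normal: "normal_sub G H C"
  unfolding normal_sub_def
proof (intro conjI ballI C_subgroup)
  show "C \<subseteq> H"
    unfolding C_def by blast
  fix h c assume h: "h \<in> H" and c: "c \<in> C"
  have cH: "c \<in> H" and conj: "h \<otimes> c \<otimes> inv h \<in> H"
    using h c S.W_closed unfolding C_def by auto
  have "M #> ((h \<otimes> c \<otimes> inv h) \<otimes> n) = M #> (n \<otimes> (h \<otimes> c \<otimes> inv h))" if n: "n \<in> N" for n
  proof -
    have ih: "inv h \<in> H" and nH: "n \<in> H"
      using h S.W_closed NH n by auto
    have "inv h \<otimes> n \<otimes> inv (inv h) \<in> N"
      using normal_subD(3)[OF N(1) ih n] .
    then have n': "inv h \<otimes> n \<otimes> h \<in> N" "inv h \<otimes> n \<otimes> h \<in> H"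
      using S.W_carrier[OF h] NH by auto
    then have "M #> (c \<otimes> (inv h \<otimes> n \<otimes> h)) = M #> ((inv h \<otimes> n \<otimes> h) \<otimes> c)"
      using c unfolding C_def by blast
    then have "(M #> c) \<otimes>\<^bsub>S.Q\<^esub> (M #> (inv h \<otimes> n \<otimes> h)) = (M #> (inv h \<otimes> n \<otimes> h)) \<otimes>\<^bsub>S.Q\<^esub> (M #> c)"
      using cH n'(2) by (simp add: S.coset_commute_iff)
    moreover have "M #> (inv h \<otimes> n \<otimes> h) = inv\<^bsub>S.Q\<^esub> (M #> h) \<otimes>\<^bsub>S.Q\<^esub> (M #> n) \<otimes>\<^bsub>S.Q\<^esub> (M #> h)"
      using h ih nH by (simp add: S.coset_mult S.coset_inv S.W_closed)
    ultimately have "(M #> n) \<otimes>\<^bsub>S.Q\<^esub> ((M #> h) \<otimes>\<^bsub>S.Q\<^esub> (M #> c) \<otimes>\<^bsub>S.Q\<^esub> inv\<^bsub>S.Q\<^esub> (M #> h))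
        = ((M #> h) \<otimes>\<^bsub>S.Q\<^esub> (M #> c) \<otimes>\<^bsub>S.Q\<^esub> inv\<^bsub>S.Q\<^esub> (M #> h)) \<otimes>\<^bsub>S.Q\<^esub> (M #> n)"
      using h nH cH by (intro S.Q.commute_conj_shift) auto
    then show ?thesis
      using h cH nH conj by (simp add: S.coset_commute_iff S.coset_conj)
  qed
  then show "h \<otimes> c \<otimes> inv h \<in> C"
    using conj unfolding C_def by blast
qed

lemma M_subset_C: "M \<subseteq> C"
proof
  fix m assume m: "m \<in> M"
  have "M #> m = \<one>\<^bsub>S.Q\<^esub>"
    using m S.coset_eq_M_iff[of m] S.M_subset by auto
  then have "(M #> m) \<otimes>\<^bsub>S.Q\<^esub> (M #> n) = (M #> n) \<otimes>\<^bsub>S.Q\<^esub> (M #> m)" if "n \<in> N" for n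
    using S.coset_in_Q[OF NH[OF that]] by (simp del: one_FactGroup)
  then show "m \<in> C"
    using S.coset_commute_iff[of m] NH m S.M_subset unfolding C_def by blast
qed

lemma image_coset_act:
  assumes "a \<in> carrier A" "x \<in> carrier G"
  shows "\<phi> a ` (M #> x) = M #> \<phi> a x"
proof -
  have "\<phi> a ` M = M"
    using invariant_image_eq[OF A.subgroup_self M(2) _ assms(1)] subgroup.subset[OF S.M_subgroup] by blast
  moreover have "\<phi> a ` (M #> x) = \<phi> a ` M #> \<phi> a x"
    using assms act_mult[OF assms(1) subgroup.mem_carrier[OF S.M_subgroup] assms(2)]
    unfolding r_coset_def by (auto simp: image_iff)
  ultimately show ?thesis
    by simp
qed

lemma act_nat_pow:
  "a \<in> carrier A \<Longrightarrow> x \<in> carrier G \<Longrightarrow> \<phi> a (x [^] (n::nat)) = \<phi> a x [^] n"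
  using group_hom.hom_nat_pow[OF act_group_hom] by blast

text \<open>Let \<open>E/M\<close> consist of the cosets centralized by all \<open>(r-1)\<close>-th
  powers of \<open>Y\<close>. It is nontrivial by the bottom of the chain of \<open>Y\<close>.
  Conjugation by \<open>H\<close> and the action of \<open>A\<close> permute these powers, as
  \<open>Y\<close> is normal and invariant, so \<open>E\<close> is stable under both and equals
  \<open>N\<close>.\<close>

lemma pred_power_mem_C_of_chain:
  assumes Y: "normal_sub G H Y" "invariant (carrier A) Y" and NY: "N \<subseteq> Y"
    and chain: "(power_step G Y)\<^sup>*\<^sup>* {\<one>} Y" and x: "x \<in> Y"
  shows "x [^] (r - 1) \<in> C"
proof -
  have Yg: "subgroup Y G" and YH: "\<And>y. y \<in> Y \<Longrightarrow> y \<in> H"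
    using normal_subD(1,2)[OF Y(1)] by auto
  have nY: "normal_sub G Y K" if "normal_sub G H K" "K \<subseteq> N" for K
    using that YH NY unfolding normal_sub_def by blast
  obtain n0 where n0: "n0 \<in> N" "n0 \<notin> M"
    "\<And>y. y \<in> Y \<Longrightarrow> M #> (y [^] (r - 1) \<otimes> n0) = M #> (n0 \<otimes> y [^] (r - 1))"
    using section_centralized_element[OF chain Yg nY[OF M(1)] nY[OF N(1)] MN r expo] MN by blast
  define E where "E = N \<inter> (\<Inter>y\<in>Y. {n \<in> N. M #> (y [^] (r - 1) \<otimes> n) = M #> (n \<otimes> y [^] (r - 1))})"
  have powH: "y [^] (r - 1) \<in> H" if "y \<in> Y" for y
    using YH[OF that] by (rule S.W_pow_closed)
  have E: "subgroup E G"
    unfolding E_def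
  proof (rule subgroups_Inter_pair[OF normal_subD(1)[OF N(1)]])
    show "subgroup (\<Inter>y\<in>Y. {n \<in> N. M #> (y [^] (r - 1) \<otimes> n) = M #> (n \<otimes> y [^] (r - 1))}) G"
      using S.subgroup_commuting_mod[OF powH normal_subD(1)[OF N(1)] normal_subD(2)[OF N(1)]] x
      by (intro subgroups_Inter) auto
  qed
  have EN: "E \<subseteq> N"
    unfolding E_def by blast
  have Ecent: "M #> (y [^] (r - 1) \<otimes> n) = M #> (n \<otimes> y [^] (r - 1))" if "n \<in> E" "y \<in> Y" for n y
    using that unfolding E_def by blast
  have E_I: "n \<in> E" if "n \<in> N" "\<And>y. y \<in> Y \<Longrightarrow> M #> (y [^] (r - 1) \<otimes> n) = M #> (n \<otimes> y [^] (r - 1))" for n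
    using that unfolding E_def by blast
  have "normal_sub G H E"
    unfolding normal_sub_def
  proof (intro conjI ballI E)
    show "E \<subseteq> H"
      using EN NH by blast
    fix h n assume h: "h \<in> H" and n: "n \<in> E"
    have nN: "n \<in> N" and nH: "n \<in> H" and ih: "inv h \<in> H"
      using n EN NH h S.W_closed by auto
    show "h \<otimes> n \<otimes> inv h \<in> E"
    proof (rule E_I)
      show conjN: "h \<otimes> n \<otimes> inv h \<in> N"
        using normal_subD(3)[OF N(1) h nN] .
      fix y assume y: "y \<in> Y"
      let ?y = "inv h \<otimes> y \<otimes> inv (inv h)"
      have y': "?y \<in> Y"
        using normal_subD(3)[OF Y(1) ih y] .
      have pow: "?y [^] (r - 1) = inv h \<otimes> y [^] (r - 1) \<otimes> h"
        using conj_int_pow[of "inv h" y "int (r - 1)"] S.W_carrier[OF h] S.W_carrier[OF YH[OF y]]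
        by (simp add: int_pow_int)
      have "(M #> (?y [^] (r - 1))) \<otimes>\<^bsub>S.Q\<^esub> (M #> n) = (M #> n) \<otimes>\<^bsub>S.Q\<^esub> (M #> (?y [^] (r - 1)))"
        using Ecent[OF n y'] powH[OF y'] nH by (simp add: S.coset_commute_iff)
      moreover have "M #> (?y [^] (r - 1)) =
          inv\<^bsub>S.Q\<^esub> (M #> h) \<otimes>\<^bsub>S.Q\<^esub> (M #> (y [^] (r - 1))) \<otimes>\<^bsub>S.Q\<^esub> (M #> h)"
        unfolding pow using h ih powH[OF y] by (simp add: S.coset_mult S.coset_inv S.W_closed)
      ultimately have "(M #> (y [^] (r - 1))) \<otimes>\<^bsub>S.Q\<^esub> ((M #> h) \<otimes>\<^bsub>S.Q\<^esub> (M #> n) \<otimes>\<^bsub>S.Q\<^esub> inv\<^bsub>S.Q\<^esub> (M #> h))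
          = ((M #> h) \<otimes>\<^bsub>S.Q\<^esub> (M #> n) \<otimes>\<^bsub>S.Q\<^esub> inv\<^bsub>S.Q\<^esub> (M #> h)) \<otimes>\<^bsub>S.Q\<^esub> (M #> (y [^] (r - 1)))"
        using h nH powH[OF y] by (intro S.Q.commute_conj_shift) auto
      then show "M #> (y [^] (r - 1) \<otimes> (h \<otimes> n \<otimes> inv h)) = M #> (h \<otimes> n \<otimes> inv h \<otimes> y [^] (r - 1))"
        using h nH NH[OF conjN] powH[OF y] by (simp add: S.coset_commute_iff S.coset_conj)
    qed
  qed
  moreover have "invariant (carrier A) E"
    unfolding invariant_def
  proof (intro ballI)
    fix a n assume a: "a \<in> carrier A" and n: "n \<in> E"
    have nN: "n \<in> N" and nG: "n \<in> carrier G"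
      using n EN NH S.W_carrier by auto
    show "\<phi> a n \<in> E"
    proof (rule E_I)
      show "\<phi> a n \<in> N"
        using N(2) a nN unfolding invariant_def by blast
      fix y assume y: "y \<in> Y"
      let ?y = "\<phi> (inv\<^bsub>A\<^esub> a) y"
      have y': "?y \<in> Y"
        using Y(2) a y unfolding invariant_def by simp
      have yG: "y \<in> carrier G" "?y \<in> carrier G"
        using y y' YH S.W_carrier by auto
      have pow: "\<phi> a (?y [^] (r - 1)) = y [^] (r - 1)"
        using act_nat_pow[OF a yG(2)] act_inv_cancel(1)[OF a yG(1)] by simp
      have "\<phi> a ` (M #> (?y [^] (r - 1) \<otimes> n)) = \<phi> a ` (M #> (n \<otimes> ?y [^] (r - 1)))"
        using Ecent[OF n y'] by simp
      then show "M #> (y [^] (r - 1) \<otimes> \<phi> a n) = M #> (\<phi> a n \<otimes> y [^] (r - 1))"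
        using yG nG by (simp add: image_coset_act[OF a] act_mult[OF a] pow del: One_nat_def)
    qed
  qed
  moreover have "M \<subset> E"
  proof -
    have "m \<in> E" if m: "m \<in> M" for m
    proof (rule E_I)
      show "m \<in> N"
        using m MN by blast
      fix y assume y: "y \<in> Y"
      have "M #> m = \<one>\<^bsub>S.Q\<^esub>"
        using m S.coset_eq_M_iff[of m] S.M_subset by auto
      then have "(M #> (y [^] (r - 1))) \<otimes>\<^bsub>S.Q\<^esub> (M #> m) = (M #> m) \<otimes>\<^bsub>S.Q\<^esub> (M #> (y [^] (r - 1)))"
        using S.coset_in_Q[OF powH[OF y]] by (simp del: one_FactGroup)
      then show "M #> (y [^] (r - 1) \<otimes> m) = M #> (m \<otimes> y [^] (r - 1))"
        using S.coset_commute_iff[of "y [^] (r - 1)" m] powH[OF y] m S.M_subset by blast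
    qed
    moreover have "n0 \<in> E"
      using n0 by (intro E_I)
    ultimately show ?thesis
      using n0(2) by blast
  qed
  ultimately have "E = N"
    using chief EN by blast
  then show ?thesis
    using Ecent x powH unfolding C_def by blast
qed

text \<open>Both choices of \<open>z\<close> are carried together because the argument only needs
  \<open>z\<close> to be built from \<open>x\<close> and \<open>y\<close> inside the fixed points of
  \<open>b\<close>. For the power alone it is applied with \<open>y = x\<close>.\<close>

lemma power_mem_C_of_commuting_fixed_points:
  assumes K: "subgroup K1 A" "cocyclic A p (carrier A) K1" "subgroup K2 A" "cocyclic A p (carrier A) K2"
    and x: "x \<in> fix_act \<phi> H K1" and y: "y \<in> fix_act \<phi> H K2"
    and z: "z = x \<otimes> y \<otimes> inv x \<otimes> inv y \<or> z = x [^] (r - 1)"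
  shows "\<exists>k. z [^] (r ^ k) \<in> C"
proof -
  define B where "B = K1 \<inter> K2"
  have p1: "p > 1"
    using p_prime prime_gt_1_nat by blast
  have K1A: "K1 \<subseteq> carrier A" and K2A: "K2 \<subseteq> carrier A"
    using K subgroup.subset by blast+
  have B: "subgroup B A"
    unfolding B_def using A.subgroups_Inter_pair K by blast
  have BA: "b \<in> carrier A" if "b \<in> B" for b
    using that K1A unfolding B_def by blast
  have "p ^ 4 \<le> p * card K1"
    using card_A A.card_le_cocyclic[OF finite_A A.subgroup_self K(1) A.subgroup_self order_refl K(2)] K1A
    by (simp add: Int_absorb1)
  moreover have "card K1 \<le> p * card B"
    using A.card_le_cocyclic[OF finite_A A.subgroup_self K(3) K(1) K1A K(4)] unfolding B_def by simp
  \<comment> \<open>Two of the four factors \<open>p\<close> are spent here, one for each of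
    \<open>K1\<close> and \<open>K2\<close>.\<close>
  ultimately have "p ^ 4 \<le> p * (p * card B)"
    by (meson le_trans mult_le_mono2)
  then have card_B: "p ^ 2 \<le> card B"
    using p1 by (simp add: power2_eq_square power4_eq_xxxx)
  have xy: "x \<in> H" "y \<in> H"
    using x y unfolding fix_act_def by auto
  have zH: "z \<in> H"
    using z xy by (auto simp: S.W_closed S.W_pow_closed)
  have "\<exists>k. \<forall>n\<in>fix_act \<phi> N {b}. M #> (z [^] (r ^ k) \<otimes> n) = M #> (n \<otimes> z [^] (r ^ k))"
    if b: "b \<in> B" "b \<noteq> \<one>\<^bsub>A\<^esub>" for b
  proof -
    let ?F = "\<lambda>K. fix_act \<phi> K {b}"
    have bA: "b \<in> carrier A"
      using BA b(1) .
    have F: "subgroup (?F K) G" if "subgroup K G" for K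
      using fix_act_subgroup[OF that] bA by blast
    have FH: "?F H \<subseteq> ?F (carrier G)"
      using S.W_carrier unfolding fix_act_def by blast
    have nF: "normal_sub G (?F H) (?F K)" if K: "normal_sub G H K" for K
      unfolding normal_sub_def
    proof (intro conjI ballI)
      show "subgroup (?F K) G"
        using F normal_subD(1)[OF K] .
      show "?F K \<subseteq> ?F H"
        using normal_subD(2)[OF K] unfolding fix_act_def by blast
      fix h k assume h: "h \<in> ?F H" and k: "k \<in> ?F K"
      have "h \<otimes> k \<otimes> inv h \<in> K"
        using normal_subD(3)[OF K] h k unfolding fix_act_def by blast
      moreover have "k \<in> ?F H"
        using k normal_subD(2)[OF K] unfolding fix_act_def by blast
      then have "h \<otimes> k \<otimes> inv h \<in> ?F H"
        using h subgroup.m_closed[OF F[OF H(1)]] subgroup.m_inv_closed[OF F[OF H(1)]] by simp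
      ultimately show "h \<otimes> k \<otimes> inv h \<in> ?F K"
        unfolding fix_act_def by blast
    qed
    have expo': "n [^] r \<in> ?F M" if n: "n \<in> ?F N" for n
    proof -
      have "n [^] r \<in> ?F N"
        using n subgroup_int_pow_closed[OF F[OF normal_subD(1)[OF N(1)]], of n "int r"]
        by (simp add: int_pow_int)
      then show ?thesis
        using expo[of n] n unfolding fix_act_def by blast
    qed
    have "x \<in> ?F H" "y \<in> ?F H"
      using x y b(1) unfolding fix_act_def B_def by auto
    then obtain k where k: "\<And>n. n \<in> ?F N \<Longrightarrow>
        ?F M #> (z [^] (r ^ k) \<otimes> n) = ?F M #> (n \<otimes> z [^] (r ^ k))"
      using section_power_centralizes[OF fix_chain[OF bA b(2)] F[OF H(1)] FH nF[OF M(1)] nF[OF N(1)] r expo' _ _ z]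
      by blast
    \<comment> \<open>The chain of the centralizer of \<open>b\<close> gives commutation modulo the
      fixed points of \<open>b\<close> in \<open>M\<close>; enlarging these to \<open>M\<close>
      weakens it to the form needed.\<close>
    have "M #> (z [^] (r ^ k) \<otimes> n) = M #> (n \<otimes> z [^] (r ^ k))" if n: "n \<in> ?F N" for n
    proof (rule coset_eq_mono[OF F[OF S.M_subgroup] S.M_subgroup _ _ _ k[OF n]])
      show "?F M \<subseteq> M"
        unfolding fix_act_def by blast
      have "n \<in> carrier G"
        using n NH S.W_carrier unfolding fix_act_def by blast
      then show "z [^] (r ^ k) \<otimes> n \<in> carrier G" "n \<otimes> z [^] (r ^ k) \<in> carrier G"
        using S.W_carrier[OF zH] by auto
    qed
    then show ?thesis
      by blast
  qed
  then obtain kf where kf: "\<And>b n. b \<in> B \<Longrightarrow> b \<noteq> \<one>\<^bsub>A\<^esub> \<Longrightarrow> n \<in> fix_act \<phi> N {b} \<Longrightarrow>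
      M #> (z [^] (r ^ kf b) \<otimes> n) = M #> (n \<otimes> z [^] (r ^ kf b))"
    by metis
  have finB: "finite B"
    using finite_subset[OF subgroup.subset[OF B] finite_A] .
  \<comment> \<open>The exponents \<open>kf b\<close> vary with \<open>b\<close>. Their sum over the
    finite \<open>B\<close> bounds them all, and raising to further powers of \<open>r\<close> keeps
    what already commutes.\<close>
  define k where "k = sum kf B"
  have zk: "z [^] (r ^ k) \<in> H"
    using S.W_pow_closed(1)[OF zH] .
  let ?Z = "{n \<in> N. M #> (z [^] (r ^ k) \<otimes> n) = M #> (n \<otimes> z [^] (r ^ k))}"
  have Z: "subgroup ?Z G"
    using S.subgroup_commuting_mod[OF zk normal_subD(1,2)[OF N(1)]] .
  have cent: "M #> (z [^] (r ^ k) \<otimes> n) = M #> (n \<otimes> z [^] (r ^ k))"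
    if b: "b \<in> B" "b \<noteq> \<one>\<^bsub>A\<^esub>" and n: "n \<in> fix_act \<phi> N {b}" for b n
  proof -
    have "kf b \<le> k"
      unfolding k_def using b(1) finB by (intro member_le_sum) auto
    then have pow: "z [^] (r ^ k) = (z [^] (r ^ kf b)) [^] (r ^ (k - kf b))"
      using S.W_carrier[OF zH] by (simp add: nat_pow_pow flip: power_add)
    have nH: "n \<in> H"
      using n NH unfolding fix_act_def by blast
    have wH: "z [^] (r ^ kf b) \<in> H"
      using S.W_pow_closed(1)[OF zH] .
    let ?T = "{x \<in> H. M #> (n \<otimes> x) = M #> (x \<otimes> n)}"
    have T: "subgroup ?T G"
      using S.subgroup_commuting_mod[OF nH H(1) order_refl] .
    have "z [^] (r ^ kf b) \<in> ?T"
      using kf[OF b n] wH by simp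
    then have "(z [^] (r ^ kf b)) [^] int (r ^ (k - kf b)) \<in> ?T"
      by (rule subgroup_int_pow_closed[OF T])
    then show ?thesis
      unfolding pow int_pow_int by simp
  qed
  have "cocyclic_fix B N \<subseteq> ?Z"
  proof
    fix n assume "n \<in> cocyclic_fix B N"
    then obtain L where L: "subgroup L A" "L \<subseteq> B" "cocyclic A p B L" "n \<in> fix_act \<phi> N L"
      unfolding cocyclic_fix_def by blast
    \<comment> \<open>The third factor \<open>p\<close> goes here; the fourth leaves
      \<open>L\<close> with a nontrivial element.\<close>
    have "p ^ 2 \<le> p * card L"
      using card_B A.card_le_cocyclic[OF finite_A B L(1) B order_refl L(3)] L(2) by (simp add: Int_absorb1)
    then have "p \<le> card L"
      using p1 by (simp add: power2_eq_square)
    then have "\<not> L \<subseteq> {\<one>\<^bsub>A\<^esub>}"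
      using p1 card_mono[of "{\<one>\<^bsub>A\<^esub>}" L] by auto
    then obtain b where b: "b \<in> L" "b \<noteq> \<one>\<^bsub>A\<^esub>"
      by blast
    then have "n \<in> fix_act \<phi> N {b}"
      using L(4) unfolding fix_act_def by blast
    then show "n \<in> ?Z"
      using cent[of b n] b L(2) unfolding fix_act_def by blast
  qed
  then have "generate G (cocyclic_fix B N) \<subseteq> ?Z"
    using generate_subgroup_incl Z by blast
  moreover have "invariant B N"
    using N(2) BA unfolding invariant_def by blast
  ultimately have "N \<subseteq> ?Z"
    using generated_by_cocyclic_fix[OF B normal_subD(1)[OF N(1)]] by blast
  then have "z [^] (r ^ k) \<in> C"
    using zk unfolding C_def by blast
  then show ?thesis ..
qed

text \<open>The assumption on \<open>H'\<close> comes from the induction over invariant subgroups,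
  which takes place outside this locale.\<close>

context
  assumes derived_pow: "\<And>x. x \<in> derived G H \<Longrightarrow> x [^] (r - 1) \<in> C"
begin

text \<open>For generators \<open>x\<close> and \<open>y\<close>, the \<open>(r-1)\<close>-th and
  some \<open>r^k\<close>-th power of the commutator lie in \<open>C\<close>, hence by Bezout so
  does the commutator. Commuting modulo \<open>C\<close> then extends from generators to
  \<open>H\<close> in one argument after the other.\<close>

lemma derived_subset_C: "derived G H \<subseteq> C"
proof -
  interpret D: group_section G H C
    using H(1) C_normal by (rule section_of_normal_sub)
  have gen: "H \<subseteq> generate G (cocyclic_fix (carrier A) H)"
    using generated_by_cocyclic_fix[OF A.subgroup_self H] .
  have commutator: "x \<otimes> y \<otimes> inv x \<otimes> inv y \<in> C"
    if x: "x \<in> cocyclic_fix (carrier A) H" and y: "y \<in> cocyclic_fix (carrier A) H" for x y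
  proof -
    let ?z = "x \<otimes> y \<otimes> inv x \<otimes> inv y"
    obtain K1 where K1: "subgroup K1 A" "cocyclic A p (carrier A) K1" "x \<in> fix_act \<phi> H K1"
      using x unfolding cocyclic_fix_def by blast
    obtain K2 where K2: "subgroup K2 A" "cocyclic A p (carrier A) K2" "y \<in> fix_act \<phi> H K2"
      using y unfolding cocyclic_fix_def by blast
    have xy: "x \<in> H" "y \<in> H"
      using K1 K2 unfolding fix_act_def by auto
    obtain k where k: "?z [^] (r ^ k) \<in> C"
      using power_mem_C_of_commuting_fixed_points[OF K1(1,2) K2(1,2) K1(3) K2(3)] by blast
    have zG: "?z \<in> carrier G"
      using xy S.W_carrier by auto
    have "?z \<in> derived G H"
      unfolding derived_def using xy by (intro generate.incl) auto
    then have z1: "?z [^] (r - 1) \<in> C"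
      by (rule derived_pow)
    have "coprime (r - 1) r"
      using r prime_gt_1_nat[OF r] coprime_diff_one_left_nat by simp
    then have "coprime (int (r - 1)) (int (r ^ k))"
      by simp
    then obtain u v where uv: "u * int (r - 1) + v * int (r ^ k) = 1"
      using bezout_int[of "int (r - 1)" "int (r ^ k)"] by (auto simp: coprime_iff_gcd_eq_1)
    have "?z = (?z [^] (r - 1)) [^] u \<otimes> (?z [^] (r ^ k)) [^] v"
    proof -
      have "?z = ?z [^] (u * int (r - 1) + v * int (r ^ k))"
        unfolding uv using zG by simp
      also have "\<dots> = (?z [^] int (r - 1)) [^] u \<otimes> (?z [^] int (r ^ k)) [^] v"
        using zG by (simp only: int_pow_mult int_pow_pow mult.commute)
      finally show ?thesis
        by (simp only: int_pow_int)
    qed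
    also have "\<dots> \<in> C"
      using subgroup.m_closed[OF C_subgroup subgroup_int_pow_closed[OF C_subgroup z1]
          subgroup_int_pow_closed[OF C_subgroup k]] .
    finally show ?thesis .
  qed
  have comm_iff: "C #> (x \<otimes> y) = C #> (y \<otimes> x) \<longleftrightarrow> x \<otimes> y \<otimes> inv x \<otimes> inv y \<in> C"
    if "x \<in> H" "y \<in> H" for x y
    using that S.W_carrier by (simp add: D.coset_eq_iff S.W_closed inv_mult_group m_assoc)
  have cfH: "cocyclic_fix (carrier A) H \<subseteq> H"
    unfolding cocyclic_fix_def fix_act_def by blast
  have comm1: "C #> (x \<otimes> y) = C #> (y \<otimes> x)" if x: "x \<in> cocyclic_fix (carrier A) H" and y: "y \<in> H" for x y
  proof -
    have xH: "x \<in> H"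
      using x cfH by blast
    have sub: "subgroup {y \<in> H. C #> (x \<otimes> y) = C #> (y \<otimes> x)} G"
      using D.subgroup_commuting_mod[OF xH H(1) order_refl] .
    have "cocyclic_fix (carrier A) H \<subseteq> {y \<in> H. C #> (x \<otimes> y) = C #> (y \<otimes> x)}"
      using commutator[OF x] comm_iff[OF xH] cfH by blast
    then have "generate G (cocyclic_fix (carrier A) H) \<subseteq> {y \<in> H. C #> (x \<otimes> y) = C #> (y \<otimes> x)}"
      by (rule generate_subgroup_incl[OF _ sub])
    then show ?thesis
      using gen y by blast
  qed
  have comm2: "C #> (x \<otimes> y) = C #> (y \<otimes> x)" if x: "x \<in> H" and y: "y \<in> H" for x y
  proof -
    have sub: "subgroup {y \<in> H. C #> (x \<otimes> y) = C #> (y \<otimes> x)} G"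
      using D.subgroup_commuting_mod[OF x H(1) order_refl] .
    have "cocyclic_fix (carrier A) H \<subseteq> {y \<in> H. C #> (x \<otimes> y) = C #> (y \<otimes> x)}"
      using comm1[OF _ x] cfH by auto
    then have "generate G (cocyclic_fix (carrier A) H) \<subseteq> {y \<in> H. C #> (x \<otimes> y) = C #> (y \<otimes> x)}"
      by (rule generate_subgroup_incl[OF _ sub])
    then show ?thesis
      using gen y by blast
  qed
  show ?thesis
    unfolding derived_def
    using comm2 comm_iff by (intro generate_subgroup_incl C_subgroup) blast
qed

text \<open>Because \<open>H/C\<close> is abelian, the elements with such a power in
  \<open>C\<close> form a subgroup, with exponents \<open>k\<close> and \<open>l\<close> combined to
  \<open>k + l\<close>; it contains the generators of \<open>H\<close>.\<close>

lemma power_mem_C: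
  assumes h: "h \<in> H"
  shows "\<exists>k. h [^] ((r - 1) * r ^ k) \<in> C"
proof -
  interpret D: group_section G H C
    using H(1) C_normal by (rule section_of_normal_sub)
  interpret DQ: comm_group D.Q
    using derived_subset_C by (rule D.comm_group_Q)
  let ?e = "\<lambda>k. (r - 1) * r ^ k"
  let ?P = "{h \<in> H. \<exists>k. h [^] ?e k \<in> C}"
  have iff: "h [^] n \<in> C \<longleftrightarrow> (C #> h) [^]\<^bsub>D.Q\<^esub> n = \<one>\<^bsub>D.Q\<^esub>" if "h \<in> H" for h and n :: nat
    using that D.coset_eq_M_iff[of "h [^] n"] by (simp add: D.coset_pow D.W_pow_closed)
  have up: "h [^] ?e (k + l) \<in> C" if "h \<in> H" "h [^] ?e k \<in> C" for h k l
  proof -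
    have "h [^] ?e (k + l) = (h [^] ?e k) [^] (r ^ l)"
      using S.W_carrier[OF that(1)] by (simp add: nat_pow_pow power_add mult.assoc)
    then show ?thesis
      using subgroup_int_pow_closed[OF C_subgroup that(2), of "int (r ^ l)"] by (simp only: int_pow_int)
  qed
  have P: "subgroup ?P G"
  proof (rule subgroupI)
    show "?P \<subseteq> carrier G"
      using S.W_carrier by blast
    have "\<one> [^] ?e 0 \<in> C" "\<one> \<in> H"
      using subgroup.one_closed[OF C_subgroup] subgroup.one_closed[OF H(1)] by auto
    then show "?P \<noteq> {}"
      by blast
  next
    fix x assume "x \<in> ?P"
    then obtain k where x: "x \<in> H" "x [^] ?e k \<in> C"
      by blast
    have "inv x [^] ?e k \<in> C"
      using subgroup.m_inv_closed[OF C_subgroup x(2)] S.W_carrier[OF x(1)] by (simp add: nat_pow_inv)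
    then show "inv x \<in> ?P"
      using x(1) S.W_closed by blast
  next
    fix x y assume "x \<in> ?P" "y \<in> ?P"
    then obtain k l where x: "x \<in> H" "x [^] ?e k \<in> C" and y: "y \<in> H" "y [^] ?e l \<in> C"
      by blast
    have "x [^] ?e (k + l) \<in> C" "y [^] ?e (k + l) \<in> C"
      using up[OF x, of l] up[OF y, of k] by (simp_all add: add.commute)
    then have "(C #> x) [^]\<^bsub>D.Q\<^esub> ?e (k + l) = \<one>\<^bsub>D.Q\<^esub>" "(C #> y) [^]\<^bsub>D.Q\<^esub> ?e (k + l) = \<one>\<^bsub>D.Q\<^esub>"
      using iff x(1) y(1) by blast+
    then have "((C #> x) \<otimes>\<^bsub>D.Q\<^esub> (C #> y)) [^]\<^bsub>D.Q\<^esub> ?e (k + l) = \<one>\<^bsub>D.Q\<^esub>"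
      using DQ.nat_pow_distrib[OF D.coset_in_Q[OF x(1)] D.coset_in_Q[OF y(1)], of "?e (k + l)"]
        D.Q.l_one[OF D.Q.one_closed] by metis
    then have "(x \<otimes> y) [^] ?e (k + l) \<in> C"
      using iff[of "x \<otimes> y"] x(1) y(1) by (simp add: D.coset_mult S.W_closed)
    then show "x \<otimes> y \<in> ?P"
      using x(1) y(1) S.W_closed by blast
  qed
  have "cocyclic_fix (carrier A) H \<subseteq> ?P"
  proof
    fix x assume "x \<in> cocyclic_fix (carrier A) H"
    then obtain K where K: "subgroup K A" "cocyclic A p (carrier A) K" "x \<in> fix_act \<phi> H K"
      unfolding cocyclic_fix_def by blast
    have x: "x \<in> H"
      using K(3) unfolding fix_act_def by blast
    obtain k where "(x [^] (r - 1)) [^] (r ^ k) \<in> C"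
      using power_mem_C_of_commuting_fixed_points[OF K(1,2) K(1,2) K(3) K(3)] by blast
    then have "x [^] ?e k \<in> C"
      using S.W_carrier[OF x] by (simp add: nat_pow_pow)
    then show "x \<in> ?P"
      using x by blast
  qed
  then have "generate G (cocyclic_fix (carrier A) H) \<subseteq> ?P"
    by (rule generate_subgroup_incl[OF _ P])
  then show ?thesis
    using generated_by_cocyclic_fix[OF A.subgroup_self H] h by blast
qed

lemma cyclic_chain_of_chief_section: "(cyclic_step G H)\<^sup>*\<^sup>* M N"
proof -
  interpret eigen_section G H M N r
  proof (intro eigen_section.intro eigen_section_axioms.intro group_axioms)
    show "\<exists>k. \<forall>n\<in>N. M #> (h [^] ((r - 1) * r ^ k) \<otimes> n) = M #> (n \<otimes> h [^] ((r - 1) * r ^ k))"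
      if "h \<in> H" for h
      using power_mem_C[OF that] unfolding C_def by blast
    show "M #> (g \<otimes> h \<otimes> inv g \<otimes> inv h \<otimes> n) = M #> (n \<otimes> (g \<otimes> h \<otimes> inv g \<otimes> inv h))"
      if "g \<in> H" "h \<in> H" "n \<in> N" for g h n
    proof -
      have "g \<otimes> h \<otimes> inv g \<otimes> inv h \<in> derived G H"
        unfolding derived_def using that by (intro generate.incl) auto
      then show ?thesis
        using derived_subset_C that(3) unfolding C_def by blast
    qed
  qed (fact finite_G H(1) M(1) N(1) der_N r psubset_imp_subset[OF MN] | erule expo)+
  show ?thesis
    by (rule cyclic_chain)
qed

end

end

section \<open>Supersolvability of the whole group\<close>

lemma (in group) derived_subset_of_cyclic_step:
  assumes H: "subgroup H G" and step: "cyclic_step G H K H"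
  shows "derived G H \<subseteq> K"
proof -
  have K: "normal_sub G H K"
    using step unfolding cyclic_step_def by blast
  interpret S: group_section G H K
    using H K by (rule section_of_normal_sub)
  obtain t where t: "t \<in> H" and gen: "\<And>x. x \<in> H \<Longrightarrow> \<exists>n::int. \<exists>k\<in>K. x = t [^] n \<otimes> k"
    using step unfolding cyclic_step_def by blast
  have pow: "\<exists>n::int. K #> x = (K #> t) [^]\<^bsub>S.Q\<^esub> n" if x: "x \<in> H" for x
  proof -
    obtain n :: int and k where k: "k \<in> K" "x = t [^] n \<otimes> k"
      using gen[OF x] by blast
    have "inv (t [^] n) \<otimes> x = k"
      using k t S.W_carrier S.M_subset by (auto simp: subset_iff simp flip: m_assoc)
    then have "K #> (t [^] n) = K #> x"
      using t x k by (simp add: S.coset_eq_iff' S.W_pow_closed)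
    then show ?thesis
      using t by (auto simp: S.coset_int_pow)
  qed
  have "x \<otimes> y \<otimes> inv x \<otimes> inv y \<in> K" if xy: "x \<in> H" "y \<in> H" for x y
  proof -
    obtain n m :: int where "K #> x = (K #> t) [^]\<^bsub>S.Q\<^esub> n" "K #> y = (K #> t) [^]\<^bsub>S.Q\<^esub> m"
      using pow xy by meson
    then have "(K #> x) \<otimes>\<^bsub>S.Q\<^esub> (K #> y) = (K #> y) \<otimes>\<^bsub>S.Q\<^esub> (K #> x)"
      using S.coset_in_Q[OF t] by (simp add: add.commute flip: S.Q.int_pow_mult)
    then have "K #> (x \<otimes> y) = K #> (y \<otimes> x)"
      using xy by (simp add: S.coset_commute_iff)
    then show ?thesis
      using xy S.W_carrier by (simp add: S.coset_eq_iff S.W_closed inv_mult_group m_assoc)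
  qed
  then show ?thesis
    unfolding derived_def by (intro generate_subgroup_incl S.M_subgroup) blast
qed

text \<open>Cyclic steps may be trivial, so trailing trivial ones have to be discarded to reach a
  proper subgroup.\<close>

lemma (in group) cyclic_chain_last_step:
  assumes "(cyclic_step G H)\<^sup>*\<^sup>* N L" "N \<noteq> L"
  shows "\<exists>K. (cyclic_step G H)\<^sup>*\<^sup>* N K \<and> cyclic_step G H K L \<and> K \<noteq> L"
  using assms
proof (induction rule: rtranclp_induct)
  case (step K L)
  then show ?case
    by (cases "K = L") auto
qed simp

lemma (in group) normal_sub_derived:
  assumes H: "subgroup H G" and N: "normal_sub G H N"
  shows "normal_sub G H (derived G N)"
proof -
  interpret HG: group "G\<lparr>carrier := H\<rparr>"
    using H by (rule subgroup_imp_group)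
  have "N \<lhd> G\<lparr>carrier := H\<rparr>"
    using N normal_sub_iff_normal[OF H] by simp
  then have "derived (G\<lparr>carrier := H\<rparr>) N \<lhd> G\<lparr>carrier := H\<rparr>"
    by (rule HG.derived_is_normal)
  then show ?thesis
    using normal_sub_iff_normal[OF H] derived_consistent[OF normal_subD(2)[OF N] H] by simp
qed

section \<open>Induction on invariant subgroups\<close>

context elementary_good_action
begin

lemma invariant_generate:
  assumes S: "S \<subseteq> carrier G" and inv: "invariant (carrier A) S"
  shows "invariant (carrier A) (generate G S)"
  unfolding invariant_def
proof (intro ballI)
  fix a x assume a: "a \<in> carrier A" and x: "x \<in> generate G S"
  interpret a: group_hom G G "\<phi> a"
    using act_group_hom[OF a] .
  have "\<phi> a x \<in> generate G (\<phi> a ` S)"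
    using a.generate_img[OF S] x by blast
  moreover have "\<phi> a ` S \<subseteq> S"
    using inv a unfolding invariant_def by blast
  ultimately show "\<phi> a x \<in> generate G S"
    using mono_generate by blast
qed

text \<open>\<open>N\<close> is smallest among the invariant normal subgroups from which a chain
  leads up to \<open>H\<close>, and a chain for a chief factor \<open>N/M\<close> contradicts this.
  Descending from the top matters: the last strict step of the chain above \<open>N\<close> ends in
  a proper subgroup containing both \<open>N\<close> and \<open>H'\<close>.\<close>

lemma cyclic_chain_of_fixed_point_chains:
  assumes card_A: "p ^ 4 \<le> card (carrier A)"
    and fix_chain: "\<And>a. a \<in> carrier A \<Longrightarrow> a \<noteq> \<one>\<^bsub>A\<^esub> \<Longrightarrow>
      (power_step G (fix_act \<phi> (carrier G) {a}))\<^sup>*\<^sup>* {\<one>} (fix_act \<phi> (carrier G) {a})"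
    and "subgroup H G" "invariant (carrier A) H"
  shows "(cyclic_step G H)\<^sup>*\<^sup>* {\<one>} H"
  using assms(3,4)
proof (induction "card H" arbitrary: H rule: less_induct)
  case less
  note H = less.prems
  have finH: "finite H"
    using finite_subgroup[OF H(1)] .
  have HG: "h \<in> carrier G" if "h \<in> H" for h
    using subgroup.mem_carrier[OF H(1) that] .
  have HH: "normal_sub G H H"
    using H(1) subgroup.m_closed[OF H(1)] subgroup.m_inv_closed[OF H(1)] unfolding normal_sub_def by simp
  let ?P = "\<lambda>N. normal_sub G H N \<and> invariant (carrier A) N \<and> (cyclic_step G H)\<^sup>*\<^sup>* N H"
  have "?P H"
    using HH H(2) by simp
  then obtain N where N: "?P N" and min: "\<And>K. ?P K \<Longrightarrow> card N \<le> card K"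
    using ex_has_least_nat[of ?P H card] by blast
  have Ng: "subgroup N G" and NH: "N \<subseteq> H"
    using N normal_subD(1,2) by blast+
  have finN: "finite N"
    using finite_subset[OF NH finH] .
  have "N = {\<one>}"
  proof (rule ccontr)
    assume "N \<noteq> {\<one>}"
    \<comment> \<open>A largest such \<open>M\<close> makes \<open>N/M\<close> an abelian chief
      factor of \<open>H\<close> under \<open>A\<close>.\<close>
    let ?R = "\<lambda>M. normal_sub G H M \<and> invariant (carrier A) M \<and> derived G N \<subseteq> M \<and> M \<subset> N"
    have "derived G N \<noteq> N"
      using derived_proper_of_solvable[OF solvable_G Ng \<open>N \<noteq> {\<one>}\<close>] .
    moreover have "derived G N \<subseteq> N"
      using derived_incl[OF order_refl Ng] .
    ultimately have "?R (derived G N)"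
      using normal_sub_derived[OF H(1)] N invariant_derived[OF A.subgroup_self Ng] by blast
    moreover have "\<forall>M. ?R M \<longrightarrow> card M < card N"
      using psubset_card_mono[OF finN] by blast
    ultimately obtain M where M: "?R M" and max: "\<And>K. ?R K \<Longrightarrow> card K \<le> card M"
      using ex_has_greatest_nat[of ?R "derived G N" card "card N"] by blast
    have chief: "E = N" if E: "normal_sub G H E" "invariant (carrier A) E" "M \<subset> E" "E \<subseteq> N" for E
    proof (rule ccontr)
      assume "E \<noteq> N"
      then have "card E \<le> card M"
        using E M by (intro max) blast
      then show False
        using psubset_card_mono[OF finite_subset[OF E(4) finN] E(3)] by simp
    qed
    interpret T: group_section G N M
      using section_of_normal_sub'[OF _ Ng _ NH] M by blast
    interpret TQ: comm_group T.Q
      using M by (intro T.comm_group_Q) blast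
    obtain u where u: "u \<in> N" "u \<notin> M"
      using M by blast
    have uG: "u \<in> carrier G"
      using T.W_carrier u(1) .
    have ord: "0 < order G \<and> u [^] order G \<in> M"
      using pow_order_eq_1[OF uG] subgroup.one_closed[OF T.M_subgroup] order_gt_0_iff_finite finite_G by auto
    \<comment> \<open>The least \<open>k\<close> is the order of \<open>u\<close> modulo
      \<open>M\<close>; for a prime \<open>r\<close> dividing it, a power of \<open>u\<close> has
      order \<open>r\<close> modulo \<open>M\<close>.\<close>
    define k where "k = (LEAST k::nat. 0 < k \<and> u [^] k \<in> M)"
    have k: "0 < k" "u [^] k \<in> M"
      using LeastI[of "\<lambda>k::nat. 0 < k \<and> u [^] k \<in> M", OF ord] unfolding k_def by auto
    have least: "k \<le> j" if "0 < j" "u [^] j \<in> M" for j :: nat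
      unfolding k_def using that by (intro Least_le) simp
    have "k \<noteq> 1"
      using k(2) u(2) uG by auto
    then obtain r where r: "Factorial_Ring.prime r" "r dvd k"
      using prime_factor_nat by blast
    then obtain m where m: "k = r * m"
      by (elim dvdE)
    have m0: "0 < m" "m < k"
      using k(1) m prime_gt_1_nat[OF r(1)] by auto
    have v: "u [^] m \<notin> M" "(u [^] m) [^] r \<in> M" "u [^] m \<in> N"
      using least[of m] m0 k(2) m uG T.W_pow_closed[OF u(1)] by (auto simp: nat_pow_pow mult.commute)
    \<comment> \<open>The elements of order dividing \<open>r\<close> modulo \<open>M\<close> form
      an invariant subgroup larger than \<open>M\<close>, hence all of \<open>N\<close>: the chief
      factor has exponent \<open>r\<close>.\<close>
    define E where "E = {n \<in> N. n [^] r \<in> M}"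
    have iff: "n [^] r \<in> M \<longleftrightarrow> (M #> n) [^]\<^bsub>T.Q\<^esub> r = \<one>\<^bsub>T.Q\<^esub>" if "n \<in> N" for n
      using that T.coset_eq_M_iff[of "n [^] r"] by (simp add: T.coset_pow T.W_pow_closed)
    have "subgroup E G"
    proof (rule subgroupI)
      show "E \<subseteq> carrier G"
        using T.W_carrier unfolding E_def by blast
      show "E \<noteq> {}"
        using v unfolding E_def by blast
    next
      fix x assume "x \<in> E"
      then have x: "x \<in> N" "x [^] r \<in> M"
        unfolding E_def by auto
      then have "inv x [^] r \<in> M"
        using subgroup.m_inv_closed[OF T.M_subgroup x(2)] T.W_carrier[OF x(1)] by (simp add: nat_pow_inv)
      then show "inv x \<in> E"
        using x(1) T.W_closed unfolding E_def by blast
    next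
      fix x y assume "x \<in> E" "y \<in> E"
      then have x: "x \<in> N" "x [^] r \<in> M" and y: "y \<in> N" "y [^] r \<in> M"
        unfolding E_def by auto
      then have "((M #> x) \<otimes>\<^bsub>T.Q\<^esub> (M #> y)) [^]\<^bsub>T.Q\<^esub> r = \<one>\<^bsub>T.Q\<^esub>"
        using TQ.nat_pow_distrib[OF T.coset_in_Q[OF x(1)] T.coset_in_Q[OF y(1)], of r]
          iff[OF x(1)] iff[OF y(1)] T.Q.l_one[OF T.Q.one_closed] by metis
      then have "(x \<otimes> y) [^] r \<in> M"
        using iff[of "x \<otimes> y"] x(1) y(1) by (simp add: T.coset_mult T.W_closed)
      then show "x \<otimes> y \<in> E"
        using x(1) y(1) T.W_closed unfolding E_def by blast
    qed
    moreover have "h \<otimes> n \<otimes> inv h \<in> E" if h: "h \<in> H" and n: "n \<in> E" for h n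
    proof -
      have nN: "n \<in> N" "n [^] r \<in> M"
        using n unfolding E_def by auto
      have "h \<otimes> n [^] r \<otimes> inv h \<in> M"
        using normal_subD(3)[of H M h] M h nN(2) by blast
      then have "(h \<otimes> n \<otimes> inv h) [^] r \<in> M"
        using conj_int_pow[OF HG[OF h] T.W_carrier[OF nN(1)], of "int r"] by (simp add: int_pow_int)
      moreover have "h \<otimes> n \<otimes> inv h \<in> N"
        using normal_subD(3)[of H N h] N h nN(1) by blast
      ultimately show ?thesis
        unfolding E_def by blast
    qed
    moreover have "E \<subseteq> H"
      using NH unfolding E_def by blast
    ultimately have nE: "normal_sub G H E"
      unfolding normal_sub_def by blast
    have iE: "invariant (carrier A) E"
      unfolding invariant_def
    proof (intro ballI)
      fix a n assume a: "a \<in> carrier A" and n: "n \<in> E"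
      have nN: "n \<in> N" "n [^] r \<in> M"
        using n unfolding E_def by auto
      have "\<phi> a n [^] r = \<phi> a (n [^] r)"
        using group_hom.hom_nat_pow[OF act_group_hom[OF a] T.W_carrier[OF nN(1)], of r] by simp
      then show "\<phi> a n \<in> E"
        using M N nN a unfolding E_def invariant_def by simp
    qed
    have "M \<subset> E"
    proof -
      have "m [^] r \<in> M" if "m \<in> M" for m
        using subgroup_int_pow_closed[OF T.M_subgroup that, of "int r"] by (simp add: int_pow_int)
      then show ?thesis
        using v M unfolding E_def by blast
    qed
    then have "E = N"
      using chief[OF nE iE] unfolding E_def by blast
    then have expo: "n [^] r \<in> M" if "n \<in> N" for n
      using that unfolding E_def by blast
    interpret chief: chief_section G A p \<phi> H M N r
    proof (intro chief_section.intro chief_section_axioms.intro elementary_good_action_axioms)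
      show "normal_sub G H M" "invariant (carrier A) M" "normal_sub G H N" "invariant (carrier A) N"
        "M \<subset> N" "derived G N \<subseteq> M"
        using M N by auto
    qed (fact card_A H r(1) | erule (1) fix_chain | erule expo | erule (3) chief)+
    have pow: "x [^] (r - 1) \<in> chief.C" if x: "x \<in> derived G H" for x
    proof (cases "N = H")
      \<comment> \<open>No induction is available when \<open>N = H\<close>, but then
        \<open>H' \<le> M \<le> C\<close>.\<close>
      case True
      then show ?thesis
        using x chief.der_N chief.M_nat_pow_closed chief.M_subset_C by blast
    next
      case False
      then obtain K where K: "(cyclic_step G H)\<^sup>*\<^sup>* N K" "cyclic_step G H K H" "K \<noteq> H"
        using cyclic_chain_last_step[of H N H] N False by blast
      have nK: "normal_sub G H K" and NK: "N \<subseteq> K"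
        using cyclic_chain_normal[of H N K] N K(1) by auto
      have KH: "K \<subset> H"
        using normal_subD(2)[OF nK] K(3) by blast
      have derK: "derived G H \<subseteq> K"
        using derived_subset_of_cyclic_step[OF H(1) K(2)] .
      \<comment> \<open>This is \<open>H'N\<close>. It lies in \<open>K\<close>, so it is a proper
        subgroup of \<open>H\<close> and the induction hypothesis supplies its chain.\<close>
      define Y where "Y = generate G (N \<union> derived G H)"
      have sub: "N \<union> derived G H \<subseteq> carrier G"
        using derK KH NH HG by blast
      have Yg: "subgroup Y G"
        unfolding Y_def using sub by (rule generate_is_subgroup)
      have YK: "Y \<subseteq> K"
        unfolding Y_def using NK derK by (intro generate_subgroup_incl normal_subD(1)[OF nK]) blast
      have NY: "N \<subseteq> Y" and dY: "derived G H \<subseteq> Y"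
        unfolding Y_def by (auto intro: generate.incl)
      have YH: "Y \<subset> H"
        using YK KH by blast
      have nY: "normal_sub G H Y"
        using normal_of_derived_subset[OF H(1) Yg dY] YH normal_sub_iff_normal[OF H(1)] by blast
      have iY: "invariant (carrier A) Y"
        unfolding Y_def
      proof (rule invariant_generate[OF sub])
        show "invariant (carrier A) (N \<union> derived G H)"
          using N invariant_derived[OF A.subgroup_self H] unfolding invariant_def by blast
      qed
      have chainY: "(power_step G Y)\<^sup>*\<^sup>* {\<one>} Y"
        using less.hyps[OF psubset_card_mono[OF finH YH] Yg iY] cyclic_chain_imp_power_chain[OF Yg] by blast
      show ?thesis
        using chief.pred_power_mem_C_of_chain[OF nY iY NY chainY] dY x by blast
    qed
    have "(cyclic_step G H)\<^sup>*\<^sup>* M N"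
      using pow by (rule chief.cyclic_chain_of_chief_section)
    then have "?P M"
      using M N by (meson rtranclp_trans)
    then have "card N \<le> card M"
      by (rule min)
    moreover have "card M < card N"
      using M finN by (intro psubset_card_mono) auto
    ultimately show False
      by simp
  qed
  then show ?case
    using N by simp
qed

end

theorem theoremB:
  fixes p :: nat and G :: "('a, 'b) monoid_scheme" and A :: "('c, 'd) monoid_scheme"
    and \<phi> :: "'c \<Rightarrow> 'a \<Rightarrow> 'a"
  assumes "Factorial_Ring.prime p"
    and "group G" and "finite (carrier G)" and "solvable G"
    and "comm_group A" and "finite (carrier A)"
    and "\<forall>a \<in> carrier A. a [^]\<^bsub>A\<^esub> p = \<one>\<^bsub>A\<^esub>"
    and "order A \<ge> p ^ 4"
    and "acts_by_automorphisms A G \<phi>"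
    and "good_action A G \<phi>"
    and "\<forall>a \<in> carrier A. a \<noteq> \<one>\<^bsub>A\<^esub> \<longrightarrow>
           supersolvable (G\<lparr>carrier := fix_act \<phi> (carrier G) {a}\<rparr>)"
  shows "supersolvable G"
proof -
  interpret G: group G
    by fact
  interpret A: comm_group A
    by fact
  have hom: "\<phi> \<in> hom A (AutoGroup G)"
    using assms(9) unfolding acts_by_automorphisms_def by blast
  have auto: "\<phi> a \<in> hom G G" "\<phi> a \<in> Bij (carrier G)" if "a \<in> carrier A" for a
    using hom_in_carrier[OF hom that] by (auto simp: AutoGroup_def auto_def)
  \<comment> \<open>Members of \<open>AutoGroup G\<close> are extensional functions composed by
    \<open>compose\<close>, so the laws of an action hold on \<open>carrier G\<close> only.\<close>
  have comp: "\<phi> (a \<otimes>\<^bsub>A\<^esub> b) = compose (carrier G) (\<phi> a) (\<phi> b)"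
    if "a \<in> carrier A" "b \<in> carrier A" for a b
    using hom_mult[OF hom that] auto(2)[OF that(1)] auto(2)[OF that(2)]
    by (simp add: AutoGroup_def BijGroup_def)
  have one: "\<phi> \<one>\<^bsub>A\<^esub> = (\<lambda>x\<in>carrier G. x)"
    using hom_one[OF hom A.group_axioms G.AutoGroup] by (simp add: AutoGroup_def BijGroup_def)
  interpret elementary_good_action G A p \<phi>
  proof (intro elementary_good_action.intro elementary_good_action_axioms.intro
      G.group_axioms A.comm_group_axioms)
    fix a assume a: "a \<in> carrier A"
    show "a [^]\<^bsub>A\<^esub> p = \<one>\<^bsub>A\<^esub>"
      using assms(7) a by blast
    fix x assume x: "x \<in> carrier G"
    show "\<phi> a x \<in> carrier G"
      using hom_in_carrier[OF auto(1)[OF a] x] .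
    show "\<phi> a (x \<otimes>\<^bsub>G\<^esub> y) = \<phi> a x \<otimes>\<^bsub>G\<^esub> \<phi> a y" if "y \<in> carrier G" for y
      using hom_mult[OF auto(1)[OF a] x that] .
    show "\<phi> (a \<otimes>\<^bsub>A\<^esub> b) x = \<phi> a (\<phi> b x)" if "b \<in> carrier A" for b
      using comp[OF a that] x by (simp add: compose_eq)
  next
    show "\<phi> \<one>\<^bsub>A\<^esub> x = x" if "x \<in> carrier G" for x
      using one that by simp
  next
    fix B H assume "subgroup B A" "subgroup H G" "\<And>b. b \<in> B \<Longrightarrow> \<phi> b ` H \<subseteq> H"
    then show "H \<subseteq> comm_act G \<phi> H B <#>\<^bsub>G\<^esub> fix_act \<phi> H B"
      using assms(10) unfolding good_action_def by blast
  qed (fact assms)+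
  have "(cyclic_step G (carrier G))\<^sup>*\<^sup>* {\<one>\<^bsub>G\<^esub>} (carrier G)"
  proof (rule cyclic_chain_of_fixed_point_chains)
    show "p ^ 4 \<le> card (carrier A)"
      using assms(8) by (simp add: Coset.order_def)
    show "invariant (carrier A) (carrier G)"
      using act_closed unfolding invariant_def by blast
    fix a assume a: "a \<in> carrier A" "a \<noteq> \<one>\<^bsub>A\<^esub>"
    have F: "subgroup (fix_act \<phi> (carrier G) {a}) G"
      using fix_act_subgroup[OF G.subgroup_self] a(1) by blast
    then show "(power_step G (fix_act \<phi> (carrier G) {a}))\<^sup>*\<^sup>* {\<one>\<^bsub>G\<^esub>} (fix_act \<phi> (carrier G) {a})"
      using assms(11) a G.supersolvable_imp_cyclic_chain[OF F] G.cyclic_chain_imp_power_chain[OF F] by blast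
  qed (rule G.subgroup_self)
  then show ?thesis
    by (rule G.cyclic_chain_imp_supersolvable)
qed

end
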